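(* Let $\mathrm M$ be a loopless matroid on $[n]$, and let $P$ be a generalized permutohedron in $\mathbb R^n$ with induced partition $[n]=S_1\sqcup\dots\sqcup S_\ell$. Then the numerical dimension of $c_1(\mathcal L_P)$ in $A^\bullet(\mathrm M)$ is the minimum, over partitions $[n]=T_1\sqcup\dots\sqcup T_k$ coarsening $[n]=S_1\sqcup\dots\sqcup S_\ell$, of $$\sum_{i=1}^k(\operatorname{rk}_{\mathrm M}(T_i)-1).$$
   Context: Let $n\ge1$, $[n]=\{1,\dots,n\}$, $\mathbf e_S=\sum_{i\in S}\mathbf e_i\in\mathbb R^n$. A matroid is loopless if every element lies in a basis; $\operatorname{rk}_{\mathrm M}$ is its rank function. A generalized permutohedron is a lattice polytope $P\subset\mathbb R^n$ every edge of which is parallel to some $\mathbf e_i-\mathbf e_j$, $i\neq j$. Its induced partition of $[n]$ is the partition into equivalence classes of the equivalence relation generated by $i\sim j$ whenever $P$ has an edge of direction $\mathbf e_i-\mathbf e_j$. The Chow ring of a loopless matroid $\mathrm M$ is $$A^\bullet(\mathrm M)=\mathbb Z[x_F: F\text{ nonempty proper flat of }\mathrm M]\big/\big(x_Fx_G: F,G\text{ incomparable}\big)+\big(\textstyle\sum_{F\ni i}x_F-\sum_{F\ni j}x_F: i,j\in[n]\big),$$ where a flat is a subset maximal with respect to its rank. The Chow ring of the permutohedral toric variety $X_{[n]}$ (the smooth projective toric variety whose fan in $\mathbb R^n/\mathbb R\mathbf e_{[n]}$ has as cones the cones spanned by $\mathbf e_{S_1},\dots,\mathbf e_{S_k}$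 for chains $\emptyset\subsetneq S_1\subsetneq\dots\subsetneq S_k\subsetneq[n]$) has the same presentation with all nonempty proper subsets in place of flats, and there is a surjection $A^\bullet(X_{[n]})\to A^\bullet(\mathrm M)$ with $x_S\mapsto x_S$ if $S$ is a flat and $x_S\mapsto0$ otherwise. $\mathcal L_P$ is the nef line bundle on $X_{[n]}$ associated to $P$ (its global sections have torus-invariant basis $P\cap\mathbb Z^n$); after translating $P$ by a lattice vector into $\{\sum_i x_i=0\}$, $c_1(\mathcal L_P)=\sum_{\emptyset\ne S\subsetneq[n]}-\min_{p\in P}\langle p,\mathbf e_S\rangle\,x_S$. We also write $c_1(\mathcal L_P)$ for its image in $A^1(\mathrm M)$. Its numerical dimension in $A^\bullet(\mathrm M)$ is the largest $d$ such that $c_1(\mathcal L_P)^d\neq0$ in $A^\bullet(\mathrm M)$. *)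

theory Defs
  imports
    "HOL-Algebra.QuotRing"
    "HOL-Analysis.Analysis"
    "HOL-Library.Poly_Mapping"
    "HOL-Library.Disjoint_Sets"
begin

text \<open>The ground set \<open>[n]\<close> is the universe of a finite type \<open>'n\<close>, and \<open>\<real>\<^sup>n\<close> is \<open>real ^ 'n\<close>.\<close>

section \<open>Matroids\<close>

text \<open>A matroid is given by its set of bases.\<close>

definition is_matroid :: "'n::finite set set \<Rightarrow> bool" where
  "is_matroid \<B> \<longleftrightarrow> \<B> \<noteq> {} \<and>
     (\<forall>A\<in>\<B>. \<forall>B\<in>\<B>. \<forall>a\<in>A - B. \<exists>b\<in>B - A. insert b (A - {a}) \<in> \<B>)"

definition loopless :: "'n::finite set set \<Rightarrow> bool" where
  "loopless \<B> \<longleftrightarrow> (\<forall>i. \<exists>B\<in>\<B>. i \<in> B)"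

definition independent_in :: "'n::finite set set \<Rightarrow> 'n set \<Rightarrow> bool" where
  "independent_in \<B> I \<longleftrightarrow> (\<exists>B\<in>\<B>. I \<subseteq> B)"

definition rk :: "'n::finite set set \<Rightarrow> 'n set \<Rightarrow> nat" where
  "rk \<B> S = Max {card I |I. I \<subseteq> S \<and> independent_in \<B> I}"

definition flat :: "'n::finite set set \<Rightarrow> 'n set \<Rightarrow> bool" where
  "flat \<B> F \<longleftrightarrow> (\<forall>S. F \<subset> S \<longrightarrow> rk \<B> S \<noteq> rk \<B> F)"

definition proper_subsets :: "'n::finite set set" where
  "proper_subsets = {S. S \<noteq> {} \<and> S \<noteq> UNIV}"

definition proper_flats :: "'n::finite set set \<Rightarrow> 'n set set" where
  "proper_flats \<B> = {F \<in> proper_subsets. flat \<B> F}"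


section \<open>Chow rings\<close>

text \<open>An element of \<open>'n cpoly\<close> is an integer polynomial in variables \<open>x\<^sub>S\<close> indexed by
  arbitrary sets \<open>S\<close>: it maps a monomial (an exponent vector) to its coefficient.
  The polynomials using only variables from a family \<open>\<F>\<close> form the ring \<open>poly_ring_on \<F>\<close>.\<close>

type_synonym 'n cpoly = "('n set \<Rightarrow>\<^sub>0 nat) \<Rightarrow>\<^sub>0 int"

definition xvar :: "'n set \<Rightarrow> 'n cpoly" where
  "xvar S = Poly_Mapping.single (Poly_Mapping.single S 1) 1"

definition poly_ring_on :: "'n set set \<Rightarrow> 'n cpoly ring" where
  "poly_ring_on \<F> =
     \<lparr>carrier = {p. \<forall>m\<in>Poly_Mapping.keys p. Poly_Mapping.keys m \<subseteq> \<F>}, monoid.mult = (*), one = 1, zero = 0, add = (+)\<rparr>"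

definition chow_relations :: "'n::finite set set \<Rightarrow> 'n cpoly set" where
  "chow_relations \<F> =
     {xvar F * xvar G |F G. F \<in> \<F> \<and> G \<in> \<F> \<and> \<not> F \<subseteq> G \<and> \<not> G \<subseteq> F} \<union>
     {(\<Sum>F\<in>{F\<in>\<F>. i \<in> F}. xvar F) - (\<Sum>F\<in>{F\<in>\<F>. j \<in> F}. xvar F) |i j. True}"

definition chow_ideal :: "'n::finite set set \<Rightarrow> 'n cpoly set" where
  "chow_ideal \<F> = Idl\<^bsub>poly_ring_on \<F>\<^esub> (chow_relations \<F>)"

definition chow_ring_on :: "'n::finite set set \<Rightarrow> 'n cpoly set ring" where
  "chow_ring_on \<F> = poly_ring_on \<F> Quot chow_ideal \<F>"

definition chow_class :: "'n::finite set set \<Rightarrow> 'n cpoly \<Rightarrow> 'n cpoly set" where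
  "chow_class \<F> p = chow_ideal \<F> +>\<^bsub>poly_ring_on \<F>\<^esub> p"

text \<open>The rays of the permutohedral fan are indexed by all nonempty proper subsets, so they take the
  place of the flats in the presentation of the Chow ring of the permutohedral variety.\<close>

definition perm_chow_ring :: "'n::finite cpoly set ring" where
  "perm_chow_ring = chow_ring_on proper_subsets"

definition chow_ring :: "'n::finite set set \<Rightarrow> 'n cpoly set ring" where
  "chow_ring \<B> = chow_ring_on (proper_flats \<B>)"

text \<open>The substitution \<open>x\<^sub>S \<mapsto> 0\<close> for \<open>S \<notin> \<G>\<close> discards all monomials involving such a variable.\<close>

definition kill_outside :: "'n set set \<Rightarrow> 'n cpoly \<Rightarrow> 'n cpoly" where
  "kill_outside \<G> p =
     (\<Sum>m\<in>{m\<in>Poly_Mapping.keys p. Poly_Mapping.keys m \<subseteq> \<G>}. Poly_Mapping.single m (Poly_Mapping.lookup p m))"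

text \<open>The surjection from the Chow ring of the permutohedral variety to that of a matroid.
  Elements of the source are cosets, on which \<open>kill_outside\<close> induces a well-defined map;
  see \<open>chow_restrict_hom\<close> and \<open>chow_restrict_xvar\<close> below.\<close>

definition chow_restrict :: "'n::finite set set \<Rightarrow> 'n cpoly set \<Rightarrow> 'n cpoly set" where
  "chow_restrict \<B> C =
     the_elem ((\<lambda>p. chow_class (proper_flats \<B>) (kill_outside (proper_flats \<B>) p)) ` C)"

text \<open>The predicate form avoids any default value: \<open>d\<close> is the largest exponent with
  \<open>c\<^sup>d \<noteq> 0\<close> in the ring \<open>A\<close>.\<close>

definition numerical_dimension :: "('a, 'b) ring_scheme \<Rightarrow> 'a \<Rightarrow> nat \<Rightarrow> bool" where
  "numerical_dimension A c d \<longleftrightarrow>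
     c [^]\<^bsub>A\<^esub> d \<noteq> \<zero>\<^bsub>A\<^esub> \<and> (\<forall>e::nat. c [^]\<^bsub>A\<^esub> e \<noteq> \<zero>\<^bsub>A\<^esub> \<longrightarrow> e \<le> d)"


section \<open>Generalized permutohedra\<close>

definition lattice_vectors :: "(real ^ 'n::finite) set" where
  "lattice_vectors = {x. \<forall>i. x $ i \<in> \<int>}"

definition lattice_polytope :: "(real ^ 'n::finite) set \<Rightarrow> bool" where
  "lattice_polytope P \<longleftrightarrow>
     (\<exists>V. finite V \<and> V \<noteq> {} \<and> V \<subseteq> lattice_vectors \<and> P = convex hull V)"

definition parallel_to :: "(real ^ 'n::finite) set \<Rightarrow> real ^ 'n \<Rightarrow> bool" where
  "parallel_to E v \<longleftrightarrow> (\<forall>x\<in>E. \<forall>y\<in>E. \<exists>c. x - y = c *\<^sub>R v)"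

definition has_edge_dir :: "(real ^ 'n::finite) set \<Rightarrow> 'n \<Rightarrow> 'n \<Rightarrow> bool" where
  "has_edge_dir P i j \<longleftrightarrow>
     i \<noteq> j \<and> (\<exists>E. E edge_of P \<and> parallel_to E (axis i 1 - axis j 1))"

definition generalized_permutohedron :: "(real ^ 'n::finite) set \<Rightarrow> bool" where
  "generalized_permutohedron P \<longleftrightarrow> lattice_polytope P \<and>
     (\<forall>E. E edge_of P \<longrightarrow> (\<exists>i j. i \<noteq> j \<and> parallel_to E (axis i 1 - axis j 1)))"

definition induced_partition :: "(real ^ 'n::finite) set \<Rightarrow> 'n set set" where
  "induced_partition P = UNIV // {(i, j). equivclp (has_edge_dir P) i j}"


section \<open>The first Chern class\<close>

definition e_vec :: "'n::finite set \<Rightarrow> real ^ 'n" where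
  "e_vec S = (\<Sum>i\<in>S. axis i 1)"

definition min_on :: "(real ^ 'n::finite) set \<Rightarrow> 'n set \<Rightarrow> real" where
  "min_on P S = (INF p\<in>P. p \<bullet> e_vec S)"

text \<open>On a lattice polytope \<open>min_on\<close> is an attained minimum and an integer (\<open>min_on_attained\<close>,
  \<open>min_on_Ints\<close> below), so the floor only converts types.\<close>

definition c1_centered :: "(real ^ 'n::finite) set \<Rightarrow> 'n cpoly set" where
  "c1_centered P =
     chow_class proper_subsets (\<Sum>S\<in>proper_subsets. of_int (- \<lfloor>min_on P S\<rfloor>) * xvar S)"

definition centering :: "(real ^ 'n::finite) set \<Rightarrow> real ^ 'n \<Rightarrow> bool" where
  "centering P t \<longleftrightarrow> t \<in> lattice_vectors \<and> (+) t ` P \<subseteq> {x. (\<Sum>i\<in>UNIV. x $ i) = 0}"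

text \<open>For a generalized permutohedron a centering translation exists and the class does not depend
  on it (\<open>centering_exists\<close>, \<open>c1_perm_eq\<close> below).\<close>

definition c1_perm :: "(real ^ 'n::finite) set \<Rightarrow> 'n cpoly set" where
  "c1_perm P = c1_centered ((+) (SOME t. centering P t) ` P)"

definition c1 :: "'n::finite set set \<Rightarrow> (real ^ 'n) set \<Rightarrow> 'n cpoly set" where
  "c1 \<B> P = chow_restrict \<B> (c1_perm P)"


section \<open>Well-definedness\<close>

subsection \<open>The restriction map\<close>

lemma keys_add_nat: "Poly_Mapping.keys (m + n) = Poly_Mapping.keys m \<union> Poly_Mapping.keys (n :: 'a \<Rightarrow>\<^sub>0 nat)"
  by (auto simp: in_keys_iff lookup_add)

lemma keys_add_sub: "Poly_Mapping.keys (m + n :: 'a \<Rightarrow>\<^sub>0 nat) \<subseteq> F \<longleftrightarrow> Poly_Mapping.keys m \<subseteq> F \<and> Poly_Mapping.keys n \<subseteq> F"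
  by (simp add: keys_add_nat)

lemma keys_mult_obtain:
  fixes p q :: "'n cpoly"
  assumes "m \<in> Poly_Mapping.keys (p * q)"
  obtains a b where "m = a + b" "a \<in> Poly_Mapping.keys p" "b \<in> Poly_Mapping.keys q"
  using keys_mult[of p q] assms by auto

lemma poly_ring_on_cring: "cring (poly_ring_on \<F>)"
proof (rule cringI)
  show "abelian_group (poly_ring_on \<F>)"
  proof (rule abelian_groupI)
    fix x assume "x \<in> carrier (poly_ring_on \<F>)"
    then have "- x \<in> carrier (poly_ring_on \<F>)" by (simp add: poly_ring_on_def)
    then show "\<exists>y\<in>carrier (poly_ring_on \<F>). y \<oplus>\<^bsub>poly_ring_on \<F>\<^esub> x = \<zero>\<^bsub>poly_ring_on \<F>\<^esub>"
      by (intro bexI[of _ "- x"]) (simp_all add: poly_ring_on_def)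
  next
    fix x y assume "x \<in> carrier (poly_ring_on \<F>)" "y \<in> carrier (poly_ring_on \<F>)"
    then show "x \<oplus>\<^bsub>poly_ring_on \<F>\<^esub> y \<in> carrier (poly_ring_on \<F>)"
      using Poly_Mapping.keys_add[of x y] unfolding poly_ring_on_def by (simp, blast)
  qed (simp_all add: poly_ring_on_def algebra_simps)
  show "comm_monoid (poly_ring_on \<F>)"
  proof (rule comm_monoidI)
    fix x y assume a: "x \<in> carrier (poly_ring_on \<F>)" "y \<in> carrier (poly_ring_on \<F>)"
    have "Poly_Mapping.keys m \<subseteq> \<F>" if "m \<in> Poly_Mapping.keys (x * y)" for m
      using that a by (elim keys_mult_obtain) (simp add: poly_ring_on_def keys_add_sub)
    then show "x \<otimes>\<^bsub>poly_ring_on \<F>\<^esub> y \<in> carrier (poly_ring_on \<F>)"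
      by (simp add: poly_ring_on_def)
  qed (simp_all add: poly_ring_on_def algebra_simps)
qed (simp_all add: poly_ring_on_def algebra_simps)

lemma poly_ring_on_diff:
  assumes "p \<in> carrier (poly_ring_on \<F>)" "q \<in> carrier (poly_ring_on \<F>)"
  shows "p - q \<in> carrier (poly_ring_on \<F>)" "p \<ominus>\<^bsub>poly_ring_on \<F>\<^esub> q = p - q"
proof -
  interpret cring "poly_ring_on \<F>" by (rule poly_ring_on_cring)
  have q: "- q \<in> carrier (poly_ring_on \<F>)"
    using assms by (simp add: poly_ring_on_def)
  have "- q \<oplus>\<^bsub>poly_ring_on \<F>\<^esub> q = \<zero>\<^bsub>poly_ring_on \<F>\<^esub>" by (simp add: poly_ring_on_def)
  then have m: "\<ominus>\<^bsub>poly_ring_on \<F>\<^esub> q = - q" using q assms(2) minus_equality by blast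
  show e: "p \<ominus>\<^bsub>poly_ring_on \<F>\<^esub> q = p - q"
    unfolding a_minus_def m by (simp add: poly_ring_on_def)
  show "p - q \<in> carrier (poly_ring_on \<F>)"
    using minus_closed[OF assms] e by simp
qed

lemma poly_ring_on_sum:
  assumes "\<And>a. a \<in> A \<Longrightarrow> f a \<in> carrier (poly_ring_on \<F>)"
  shows "sum f A \<in> carrier (poly_ring_on \<F>)"
proof (cases "finite A")
  case True
  then show ?thesis using assms
  proof (induction A)
    case empty show ?case by (simp add: poly_ring_on_def)
  next
    case (insert a A)
    interpret cring "poly_ring_on \<F>" by (rule poly_ring_on_cring)
    have "f a \<oplus>\<^bsub>poly_ring_on \<F>\<^esub> sum f A \<in> carrier (poly_ring_on \<F>)"
      using insert by (intro a_closed) auto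
    then show ?case using insert.hyps by (simp add: poly_ring_on_def)
  qed
next
  case False then show ?thesis by (simp add: poly_ring_on_def)
qed

lemma poly_ring_on_mult:
  assumes "p \<in> carrier (poly_ring_on \<F>)" "q \<in> carrier (poly_ring_on \<F>)"
  shows "p * q \<in> carrier (poly_ring_on \<F>)"
proof -
  interpret cring "poly_ring_on \<F>" by (rule poly_ring_on_cring)
  show ?thesis using m_closed[OF assms] by (simp add: poly_ring_on_def)
qed

lemma poly_ring_on_of_int: "of_int c \<in> carrier (poly_ring_on \<F>)"
  by (simp add: poly_ring_on_def flip: single_of_int)

lemma keys_xvar: "Poly_Mapping.keys (xvar S) = {Poly_Mapping.single S 1}"
  by (simp add: xvar_def)

lemma xvar_carrier: "S \<in> \<F> \<Longrightarrow> xvar S \<in> carrier (poly_ring_on \<F>)"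
  by (simp add: poly_ring_on_def keys_xvar)

lemma chow_relations_carrier: "chow_relations \<F> \<subseteq> carrier (poly_ring_on \<F>)"
  unfolding chow_relations_def
  by (auto intro!: poly_ring_on_mult poly_ring_on_diff poly_ring_on_sum xvar_carrier)

lemma chow_ideal_ideal: "ideal (chow_ideal \<F>) (poly_ring_on \<F>)"
proof -
  interpret cring "poly_ring_on \<F>" by (rule poly_ring_on_cring)
  show ?thesis unfolding chow_ideal_def by (rule genideal_ideal[OF chow_relations_carrier])
qed

lemma chow_relations_in_ideal: "chow_relations \<F> \<subseteq> chow_ideal \<F>"
proof -
  interpret cring "poly_ring_on \<F>" by (rule poly_ring_on_cring)
  show ?thesis unfolding chow_ideal_def by (rule genideal_self[OF chow_relations_carrier])
qed

lemma chow_ring_on_cring: "cring (chow_ring_on \<F>)"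
  unfolding chow_ring_on_def
  by (rule ideal.quotient_is_cring[OF chow_ideal_ideal poly_ring_on_cring])

lemma chow_class_hom: "ring_hom_cring (poly_ring_on \<F>) (chow_ring_on \<F>) (chow_class \<F>)"
proof -
  have "chow_class \<F> = (+>\<^bsub>poly_ring_on \<F>\<^esub>) (chow_ideal \<F>)"
    by (intro ext) (simp add: chow_class_def)
  then show ?thesis
    unfolding chow_ring_on_def
    using ideal.rcos_ring_hom_cring[OF chow_ideal_ideal poly_ring_on_cring, of \<F>]
    by simp
qed

lemma chow_class_eq_iff:
  assumes "p \<in> carrier (poly_ring_on \<F>)" "q \<in> carrier (poly_ring_on \<F>)"
  shows "chow_class \<F> p = chow_class \<F> q \<longleftrightarrow> p - q \<in> chow_ideal \<F>"
proof -
  interpret cring "poly_ring_on \<F>" by (rule poly_ring_on_cring)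
  show ?thesis
    using quotient_eq_iff_same_a_r_cos[OF chow_ideal_ideal assms] poly_ring_on_diff[OF assms]
    by (auto simp: chow_class_def)
qed

lemma lookup_kill_outside:
  "Poly_Mapping.lookup (kill_outside \<G> p) m = (if Poly_Mapping.keys m \<subseteq> \<G> then Poly_Mapping.lookup p m else 0)"
proof -
  have "Poly_Mapping.lookup (kill_outside \<G> p) m =
      (\<Sum>k\<in>{k\<in>Poly_Mapping.keys p. Poly_Mapping.keys k \<subseteq> \<G>}. if k = m then Poly_Mapping.lookup p m else 0)"
    unfolding kill_outside_def lookup_sum
    by (intro sum.cong) (auto simp: lookup_single when_def)
  also have "\<dots> = (if Poly_Mapping.keys m \<subseteq> \<G> then Poly_Mapping.lookup p m else 0)"
    by (auto simp: sum.delta' in_keys_iff)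
  finally show ?thesis .
qed

lemma kill_outside_carrier: "kill_outside \<G> p \<in> carrier (poly_ring_on \<G>)"
proof -
  have "Poly_Mapping.keys m \<subseteq> \<G>" if "m \<in> Poly_Mapping.keys (kill_outside \<G> p)" for m
    using that by (metis in_keys_iff lookup_kill_outside)
  then show ?thesis by (simp add: poly_ring_on_def)
qed

lemma kill_outside_id: "p \<in> carrier (poly_ring_on \<G>) \<Longrightarrow> kill_outside \<G> p = p"
  by (rule poly_mapping_eqI) (auto simp: lookup_kill_outside poly_ring_on_def in_keys_iff)

lemma kill_outside_zero:
  "(\<And>m. m \<in> Poly_Mapping.keys p \<Longrightarrow> \<not> Poly_Mapping.keys m \<subseteq> \<G>) \<Longrightarrow> kill_outside \<G> p = 0"
  by (rule poly_mapping_eqI) (auto simp: lookup_kill_outside in_keys_iff)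

lemma kill_outside_add: "kill_outside \<G> (p + q) = kill_outside \<G> p + kill_outside \<G> q"
  by (rule poly_mapping_eqI) (auto simp: lookup_kill_outside lookup_add)

lemma kill_outside_diff: "kill_outside \<G> (p - q) = kill_outside \<G> p - kill_outside \<G> q"
  by (rule poly_mapping_eqI) (auto simp: lookup_kill_outside lookup_minus)

lemma kill_outside_sum: "kill_outside \<G> (sum f A) = (\<Sum>a\<in>A. kill_outside \<G> (f a))"
  by (rule poly_mapping_eqI) (auto simp: lookup_kill_outside lookup_sum)

lemma kill_outside_mult: "kill_outside \<G> (p * q) = kill_outside \<G> p * kill_outside \<G> q"
proof -
  define p' q' where "p' = p - kill_outside \<G> p" and "q' = q - kill_outside \<G> q"
  have k: "kill_outside \<G> (a * b) = 0" if "\<And>m. m \<in> Poly_Mapping.keys a \<Longrightarrow> \<not> Poly_Mapping.keys m \<subseteq> \<G>"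
    for a b :: "'a cpoly"
    using that by (intro kill_outside_zero) (auto elim!: keys_mult_obtain simp: keys_add_sub)
  have p': "\<not> Poly_Mapping.keys m \<subseteq> \<G>" if "m \<in> Poly_Mapping.keys p'" for m
    using that by (auto simp: p'_def in_keys_iff lookup_minus lookup_kill_outside)
  have q': "\<not> Poly_Mapping.keys m \<subseteq> \<G>" if "m \<in> Poly_Mapping.keys q'" for m
    using that by (auto simp: q'_def in_keys_iff lookup_minus lookup_kill_outside)
  have "p * q = kill_outside \<G> p * kill_outside \<G> q + (p' * q + q' * kill_outside \<G> p)"
    by (simp add: p'_def q'_def algebra_simps)
  then show ?thesis
    using k[of p' q, OF p'] k[of q' "kill_outside \<G> p", OF q']
      kill_outside_id[OF poly_ring_on_mult[OF kill_outside_carrier kill_outside_carrier]]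
    by (simp add: kill_outside_add)
qed

lemma kill_outside_one: "kill_outside \<G> 1 = 1"
  by (rule kill_outside_id) (simp add: poly_ring_on_def)

lemma kill_outside_xvar: "kill_outside \<G> (xvar S) = (if S \<in> \<G> then xvar S else 0)"
  by (auto intro: kill_outside_id kill_outside_zero xvar_carrier simp: keys_xvar)

lemma kill_class_hom:
  "ring_hom_cring (poly_ring_on \<F>) (chow_ring_on \<G>) (\<lambda>p. chow_class \<G> (kill_outside \<G> p))"
proof -
  interpret h: ring_hom_cring "poly_ring_on \<G>" "chow_ring_on \<G>" "chow_class \<G>"
    by (rule chow_class_hom)
  have eqs: "x \<oplus>\<^bsub>poly_ring_on \<H>\<^esub> y = x + y" "x \<otimes>\<^bsub>poly_ring_on \<H>\<^esub> y = x * y"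
    "\<one>\<^bsub>poly_ring_on \<H>\<^esub> = 1" for x y :: "'a cpoly" and \<H>
    by (simp_all add: poly_ring_on_def)
  have add: "chow_class \<G> (kill_outside \<G> (x + y)) =
    chow_class \<G> (kill_outside \<G> x) \<oplus>\<^bsub>chow_ring_on \<G>\<^esub> chow_class \<G> (kill_outside \<G> y)" for x y
    using h.hom_add[OF kill_outside_carrier kill_outside_carrier, of x y]
    by (simp add: kill_outside_add eqs)
  have mult: "chow_class \<G> (kill_outside \<G> (x * y)) =
    chow_class \<G> (kill_outside \<G> x) \<otimes>\<^bsub>chow_ring_on \<G>\<^esub> chow_class \<G> (kill_outside \<G> y)" for x y
    using h.hom_mult[OF kill_outside_carrier kill_outside_carrier, of x y]
    by (simp add: kill_outside_mult eqs)
  have "(\<lambda>p. chow_class \<G> (kill_outside \<G> p)) \<in> ring_hom (poly_ring_on \<F>) (chow_ring_on \<G>)"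
    by (rule ring_hom_memI)
      (use h.hom_closed[OF kill_outside_carrier] h.hom_one add mult in
        \<open>simp_all add: eqs kill_outside_one\<close>)
  then show ?thesis
    by (intro ring_hom_cring.intro ring_hom_cring_axioms.intro poly_ring_on_cring chow_ring_on_cring)
qed

lemma kill_outside_relations:
  assumes "\<G> \<subseteq> \<F>" and r: "r \<in> chow_relations \<F>"
  shows "kill_outside \<G> r \<in> chow_ideal \<G>"
proof -
  interpret i: ideal "chow_ideal \<G>" "poly_ring_on \<G>" by (rule chow_ideal_ideal)
  have zero: "0 \<in> chow_ideal \<G>"
    using additive_subgroup.zero_closed[OF i.additive_subgroup_axioms] by (simp add: poly_ring_on_def)
  from r consider
    (1) F G where "r = xvar F * xvar G" "\<not> F \<subseteq> G" "\<not> G \<subseteq> F"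
  | (2) a b where "r = (\<Sum>F\<in>{F\<in>\<F>. a \<in> F}. xvar F) - (\<Sum>F\<in>{F\<in>\<F>. b \<in> F}. xvar F)"
    unfolding chow_relations_def by blast
  then show ?thesis
  proof cases
    case 1
    show ?thesis
    proof (cases "F \<in> \<G> \<and> G \<in> \<G>")
      case True
      then have "xvar F * xvar G \<in> chow_relations \<G>"
        using 1 unfolding chow_relations_def by blast
      then show ?thesis
        using chow_relations_in_ideal True 1 by (auto simp: kill_outside_mult kill_outside_xvar)
    next
      case False
      then show ?thesis using zero 1 by (auto simp: kill_outside_mult kill_outside_xvar)
    qed
  next
    case 2
    have s: "kill_outside \<G> (\<Sum>F\<in>{F\<in>\<F>. a \<in> F}. xvar F) = (\<Sum>F\<in>{F\<in>\<G>. a \<in> F}. xvar F)" for a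
      unfolding kill_outside_sum kill_outside_xvar
      using assms(1) by (intro sum.mono_neutral_cong_right) auto
    have "kill_outside \<G> r \<in> chow_relations \<G>"
      unfolding 2 kill_outside_diff s chow_relations_def by blast
    then show ?thesis using chow_relations_in_ideal by blast
  qed
qed

lemma kill_outside_ideal:
  assumes "\<G> \<subseteq> \<F>" and "p \<in> chow_ideal \<F>"
  shows "kill_outside \<G> p \<in> chow_ideal \<G>"
proof -
  interpret R: cring "poly_ring_on \<F>" by (rule poly_ring_on_cring)
  interpret h: ring_hom_cring "poly_ring_on \<F>" "chow_ring_on \<G>"
    "\<lambda>p. chow_class \<G> (kill_outside \<G> p)" by (rule kill_class_hom)
  interpret g: ring_hom_cring "poly_ring_on \<G>" "chow_ring_on \<G>" "chow_class \<G>"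
    by (rule chow_class_hom)
  let ?K = "a_kernel (poly_ring_on \<F>) (chow_ring_on \<G>) (\<lambda>p. chow_class \<G> (kill_outside \<G> p))"
  have z: "chow_class \<G> q = \<zero>\<^bsub>chow_ring_on \<G>\<^esub> \<longleftrightarrow> q \<in> chow_ideal \<G>"
    if "q \<in> carrier (poly_ring_on \<G>)" for q
  proof -
    have "0 \<in> carrier (poly_ring_on \<G>)" "chow_class \<G> 0 = \<zero>\<^bsub>chow_ring_on \<G>\<^esub>"
      using g.hom_zero by (simp_all add: poly_ring_on_def)
    then show ?thesis using chow_class_eq_iff[OF that, of 0] by simp
  qed
  have K: "q \<in> ?K \<longleftrightarrow> q \<in> carrier (poly_ring_on \<F>) \<and> kill_outside \<G> q \<in> chow_ideal \<G>" for q
    unfolding a_kernel_def' mem_Collect_eq z[OF kill_outside_carrier] ..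
  have "chow_relations \<F> \<subseteq> ?K"
    using kill_outside_relations[OF assms(1)] chow_relations_carrier[of \<F>] K by blast
  then have "chow_ideal \<F> \<subseteq> ?K"
    unfolding chow_ideal_def by (intro R.genideal_minimal h.ring.kernel_is_ideal)
  then show ?thesis using assms(2) K by blast
qed

lemma chow_restrict_class:
  assumes p: "p \<in> carrier (poly_ring_on proper_subsets)"
  shows "chow_restrict \<B> (chow_class proper_subsets p) =
    chow_class (proper_flats \<B>) (kill_outside (proper_flats \<B>) p)"
proof -
  let ?f = "\<lambda>p. chow_class (proper_flats \<B>) (kill_outside (proper_flats \<B>) p)"
  interpret i: ideal "chow_ideal proper_subsets" "poly_ring_on proper_subsets"
    by (rule chow_ideal_ideal)
  have sub: "proper_flats \<B> \<subseteq> proper_subsets" by (auto simp: proper_flats_def)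
  have self: "p \<in> chow_class proper_subsets p"
    unfolding chow_class_def by (rule i.a_rcos_self[OF p])
  have const: "?f q = ?f p" if q: "q \<in> chow_class proper_subsets p" for q
  proof -
    obtain r where r: "r \<in> chow_ideal proper_subsets" "q = r + p"
      using q by (auto simp: chow_class_def a_r_coset_def' poly_ring_on_def)
    then have "kill_outside (proper_flats \<B>) q - kill_outside (proper_flats \<B>) p
        \<in> chow_ideal (proper_flats \<B>)"
      using kill_outside_ideal[OF sub r(1)] by (simp add: kill_outside_add)
    then show ?thesis by (subst chow_class_eq_iff) (auto intro: kill_outside_carrier)
  qed
  have "?f ` chow_class proper_subsets p = (\<lambda>_. ?f p) ` chow_class proper_subsets p"
    by (intro image_cong refl const)
  also have "\<dots> = {?f p}" by (rule image_constant[OF self])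
  finally show ?thesis unfolding chow_restrict_def by (simp only: the_elem_eq)
qed

lemma perm_chow_ring_carrier:
  "carrier perm_chow_ring = chow_class proper_subsets ` carrier (poly_ring_on proper_subsets)"
  by (auto simp: perm_chow_ring_def chow_ring_on_def chow_class_def FactRing_def A_RCOSETS_def')

lemma chow_restrict_hom:
  fixes \<B> :: "'n::finite set set"
  shows "chow_restrict \<B> \<in> ring_hom perm_chow_ring (chow_ring \<B>)"
proof -
  interpret g: ring_hom_cring "poly_ring_on proper_subsets" perm_chow_ring
    "chow_class proper_subsets"
    unfolding perm_chow_ring_def by (rule chow_class_hom)
  interpret h: ring_hom_cring "poly_ring_on proper_subsets" "chow_ring \<B>"
    "\<lambda>p. chow_class (proper_flats \<B>) (kill_outside (proper_flats \<B>) p)"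
    unfolding chow_ring_def by (rule kill_class_hom)
  have r: "chow_restrict \<B> (chow_class proper_subsets p) =
    chow_class (proper_flats \<B>) (kill_outside (proper_flats \<B>) p)"
    if "p \<in> carrier (poly_ring_on proper_subsets)" for p :: "'n cpoly"
    by (rule chow_restrict_class[OF that])
  show ?thesis
  proof (rule ring_hom_memI)
    show "chow_restrict \<B> \<one>\<^bsub>perm_chow_ring\<^esub> = \<one>\<^bsub>chow_ring \<B>\<^esub>"
      using r[OF g.R.one_closed] g.hom_one h.hom_one by simp
    show "chow_restrict \<B> C \<in> carrier (chow_ring \<B>)" if "C \<in> carrier perm_chow_ring" for C
      using that r h.hom_closed by (auto simp: perm_chow_ring_carrier)
    fix C D :: "'n cpoly set"
    assume "C \<in> carrier perm_chow_ring" "D \<in> carrier perm_chow_ring"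
    then obtain p q where pq: "p \<in> carrier (poly_ring_on proper_subsets)"
      "q \<in> carrier (poly_ring_on proper_subsets)"
      "C = chow_class proper_subsets p" "D = chow_class proper_subsets q"
      by (auto simp: perm_chow_ring_carrier)
    show "chow_restrict \<B> (C \<otimes>\<^bsub>perm_chow_ring\<^esub> D) =
        chow_restrict \<B> C \<otimes>\<^bsub>chow_ring \<B>\<^esub> chow_restrict \<B> D"
      unfolding pq(3,4) g.hom_mult[OF pq(1,2), symmetric] r[OF g.R.m_closed[OF pq(1,2)]]
        r[OF pq(1)] r[OF pq(2)] h.hom_mult[OF pq(1,2)] ..
    show "chow_restrict \<B> (C \<oplus>\<^bsub>perm_chow_ring\<^esub> D) =
        chow_restrict \<B> C \<oplus>\<^bsub>chow_ring \<B>\<^esub> chow_restrict \<B> D"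
      unfolding pq(3,4) g.hom_add[OF pq(1,2), symmetric] r[OF g.R.a_closed[OF pq(1,2)]]
        r[OF pq(1)] r[OF pq(2)] h.hom_add[OF pq(1,2)] ..
  qed
qed

lemma chow_restrict_xvar:
  assumes "S \<in> proper_subsets"
  shows "chow_restrict \<B> (chow_class proper_subsets (xvar S)) =
    (if flat \<B> S then chow_class (proper_flats \<B>) (xvar S) else \<zero>\<^bsub>chow_ring \<B>\<^esub>)"
proof -
  interpret g: ring_hom_cring "poly_ring_on (proper_flats \<B>)" "chow_ring \<B>"
    "chow_class (proper_flats \<B>)"
    unfolding chow_ring_def by (rule chow_class_hom)
  have "chow_class (proper_flats \<B>) 0 = \<zero>\<^bsub>chow_ring \<B>\<^esub>"
    using g.hom_zero by (simp add: poly_ring_on_def)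
  then show ?thesis
    using assms chow_restrict_class[OF xvar_carrier[OF assms]]
    by (simp add: kill_outside_xvar proper_flats_def)
qed


subsection \<open>The induced partition\<close>

lemma induced_partition_partition: "partition_on UNIV (induced_partition P)"
proof -
  have "equiv UNIV {(i, j). equivclp (has_edge_dir P) i j}"
    by (intro equivI) (auto simp: refl_on_def sym_def trans_def
        intro: equivclp_sym equivclp_trans)
  then show ?thesis unfolding induced_partition_def by (rule partition_on_quotient)
qed


subsection \<open>Minima over lattice polytopes\<close>

lemma inner_e_vec: "x \<bullet> e_vec S = (\<Sum>i\<in>S. x $ i)"
  by (simp add: e_vec_def inner_sum_right inner_axis)

lemma min_on_attained_lattice:
  assumes "lattice_polytope P"
  obtains v where "v \<in> P" "v \<in> lattice_vectors" "min_on P S = v \<bullet> e_vec S"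
    "\<And>p. p \<in> P \<Longrightarrow> v \<bullet> e_vec S \<le> p \<bullet> e_vec S"
proof -
  from assms obtain V where V: "finite V" "V \<noteq> {}" "V \<subseteq> lattice_vectors" "P = convex hull V"
    unfolding lattice_polytope_def by blast
  define w where "w = e_vec S"
  have "\<exists>m\<in>(\<lambda>v. v \<bullet> w) ` V. \<not> (\<exists>x\<in>(\<lambda>v. v \<bullet> w) ` V. x < m)"
    using V(1,2) by (intro ex_min_if_finite) auto
  then obtain v where v: "v \<in> V" "\<And>u. u \<in> V \<Longrightarrow> v \<bullet> w \<le> u \<bullet> w"
    by (force simp: not_less)
  have "V \<subseteq> {x. w \<bullet> x \<ge> v \<bullet> w}" using v(2) by (auto simp: inner_commute)
  then have "P \<subseteq> {x. w \<bullet> x \<ge> v \<bullet> w}"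
    unfolding V(4) by (intro hull_minimal convex_halfspace_ge)
  then have le: "\<And>p. p \<in> P \<Longrightarrow> v \<bullet> w \<le> p \<bullet> w" by (auto simp: inner_commute)
  have vP: "v \<in> P" using v(1) V(4) hull_inc by metis
  have "min_on P S = v \<bullet> w"
    unfolding min_on_def w_def[symmetric]
    by (rule cInf_eq_minimum) (use vP le in auto)
  then show thesis using that[of v] vP le v(1) V(3) by (auto simp: w_def)
qed

lemma min_on_attained:
  assumes "lattice_polytope P"
  shows "\<exists>p\<in>P. min_on P S = p \<bullet> e_vec S \<and> (\<forall>q\<in>P. p \<bullet> e_vec S \<le> q \<bullet> e_vec S)"
  using min_on_attained_lattice[OF assms, of S] by metis

lemma min_on_Ints: "lattice_polytope P \<Longrightarrow> min_on P S \<in> \<int>"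
  by (erule min_on_attained_lattice[of _ S]) (auto simp: inner_e_vec lattice_vectors_def)

lemma lattice_polytope_translate:
  assumes "lattice_polytope P" "t \<in> lattice_vectors"
  shows "lattice_polytope ((+) t ` P)"
proof -
  from assms obtain V where V: "finite V" "V \<noteq> {}" "V \<subseteq> lattice_vectors" "P = convex hull V"
    unfolding lattice_polytope_def by blast
  then show ?thesis
    unfolding lattice_polytope_def using assms(2)
    by (intro exI[of _ "(+) t ` V"]) (auto simp: convex_hull_translation lattice_vectors_def)
qed

lemma min_on_translate:
  assumes "lattice_polytope P" "t \<in> lattice_vectors"
  shows "min_on ((+) t ` P) S = t \<bullet> e_vec S + min_on P S"
proof -
  obtain v where v: "v \<in> P" "min_on P S = v \<bullet> e_vec S"
    "\<And>p. p \<in> P \<Longrightarrow> v \<bullet> e_vec S \<le> p \<bullet> e_vec S"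
    using min_on_attained_lattice[OF assms(1), of S] by metis
  show ?thesis unfolding v(2) unfolding min_on_def image_image
    by (rule cInf_eq_minimum) (use v in \<open>auto simp: inner_add_left\<close>)
qed


subsection \<open>Existence and irrelevance of the centering translation\<close>

text \<open>A linear functional that is constant on every edge of a polytope is constant on it.\<close>

lemma polytope_const_if_const_on_edges:
  fixes P :: "'a::euclidean_space set"
  assumes "polytope P" "\<And>E x y. E edge_of P \<Longrightarrow> x \<in> E \<Longrightarrow> y \<in> E \<Longrightarrow> w \<bullet> x = w \<bullet> y"
    "x \<in> P" "y \<in> P"
  shows "w \<bullet> x = w \<bullet> y"
  using assms
proof (induction "nat (aff_dim P)" arbitrary: P x y rule: less_induct)
  case less
  have conv: "convex P" and cpt: "compact P" and poly: "polyhedron P"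
    using less.prems(1) polytope_imp_convex polytope_imp_compact polytope_imp_polyhedron by auto
  have bd: "bounded P" using cpt compact_imp_bounded by blast
  have ne: "aff_dim P \<ge> 0" using less.prems(3) aff_dim_negative_iff[of P] by (metis empty_iff not_le)
  have const_face: "w \<bullet> a = w \<bullet> b" if F: "F face_of P" "F \<noteq> P" and ab: "a \<in> F" "b \<in> F" for F a b
  proof (rule less.hyps[of F])
    have "aff_dim F < aff_dim P" by (rule face_of_aff_dim_lt[OF conv F])
    moreover have "0 \<le> aff_dim F" using ab aff_dim_negative_iff[of F] by (metis empty_iff not_le)
    ultimately show "nat (aff_dim F) < nat (aff_dim P)" by linarith
    show "polytope F" using less.prems(1) F(1) face_of_polytope_polytope by blast
    show "w \<bullet> x = w \<bullet> y" if "E edge_of F" "x \<in> E" "y \<in> E" for E x y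
      using that less.prems(2)[of E x y] F(1) face_of_trans unfolding edge_of_def by blast
  qed (use ab in auto)
  consider "aff_dim P = 0" | "aff_dim P = 1" | "aff_dim P \<ge> 2" using ne by linarith
  then show ?case
  proof cases
    case 1
    then obtain a where "P = {a}" using aff_dim_eq_0 by metis
    then show ?thesis using less.prems by auto
  next
    case 2
    then have "P edge_of P" using conv by (simp add: edge_of_def face_of_refl)
    then show ?thesis using less.prems by blast
  next
    case 3
    show ?thesis
    proof (rule ccontr)
      assume neq: "w \<bullet> x \<noteq> w \<bullet> y"
      obtain c where c: "c \<in> rel_interior P"
        using rel_interior_eq_empty[OF conv] less.prems(3) by blast
      then have cP: "c \<in> P" using rel_interior_subset by blast
      define W where "W = affine hull P \<inter> {z. w \<bullet> z = w \<bullet> c}"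
      have affW: "affine W" unfolding W_def by (intro affine_Int affine_affine_hull affine_hyperplane)
      have cW: "c \<in> W" using cP by (simp add: W_def hull_inc)
      have dimW: "aff_dim W = aff_dim P - 1"
      proof -
        have hP: "x \<in> affine hull P" "y \<in> affine hull P"
          using less.prems(3,4) by (auto intro: hull_inc)
        have n1: "\<not> affine hull P \<subseteq> {z. w \<bullet> z = w \<bullet> c}"
        proof
          assume "affine hull P \<subseteq> {z. w \<bullet> z = w \<bullet> c}"
          then have "w \<bullet> x = w \<bullet> c" "w \<bullet> y = w \<bullet> c" using hP by auto
          then show False using neq by simp
        qed
        have n2: "affine hull P \<inter> {z. w \<bullet> z = w \<bullet> c} \<noteq> {}" using cW unfolding W_def by auto
        show ?thesis
          unfolding W_def aff_dim_affine_Int_hyperplane[OF affine_affine_hull]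
          by (simp only: n1 n2 if_False aff_dim_affine_hull)
      qed
      then obtain d where d: "d \<in> W" "d \<noteq> c"
      proof -
        have "W \<noteq> {c}" using 3 dimW by auto
        then show ?thesis using that cW by blast
      qed
      have l: "d - c \<noteq> 0" "c + (d - c) \<in> affine hull P" using d by (auto simp: W_def)
      obtain s where s: "0 < s" "c + s *\<^sub>R (d - c) \<in> rel_frontier P"
        using ray_to_rel_frontier[OF bd c l(2,1)] by metis
      define z where "z = c + s *\<^sub>R (d - c)"
      have wz: "w \<bullet> z = w \<bullet> c" using d(1) by (simp add: z_def W_def inner_add_right inner_diff_right)
      from s(2) obtain F where F: "F facet_of P" "z \<in> F"
        using rel_frontier_of_polyhedron[OF poly] by (auto simp: z_def)
      have Ff: "F face_of P" and Fd: "aff_dim F = aff_dim P - 1" using F(1) by (auto simp: facet_of_def)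
      have FP: "F \<noteq> P" using Fd by auto
      have "F \<subseteq> W"
        using const_face[OF Ff FP _ F(2)] wz face_of_imp_subset[OF Ff] hull_subset[of P affine]
        by (auto simp: W_def)
      then have "affine hull F = W"
        using affine_dim_equal[OF affine_affine_hull affW, of F] affW dimW Fd F(2)
          hull_minimal[of F W affine] hull_inc[OF F(2), of affine]
        by (auto simp: aff_dim_affine_hull)
      then have "c \<in> F"
        using cW cP face_of_imp_eq_affine_Int[OF conv Ff] by auto
      then show False
        using face_of_disjoint_rel_interior[OF Ff FP] c by blast
    qed
  qed
qed

lemma gp_sum_const:
  assumes "generalized_permutohedron P" "x \<in> P" "y \<in> P"
  shows "(\<Sum>i\<in>UNIV. x $ i) = (\<Sum>i\<in>UNIV. y $ i)"
proof -
  have pt: "polytope P"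
    using assms(1) unfolding generalized_permutohedron_def lattice_polytope_def polytope_def by blast
  have "e_vec UNIV \<bullet> x = e_vec UNIV \<bullet> y"
  proof (rule polytope_const_if_const_on_edges[OF pt _ assms(2,3)])
    fix E x y assume E: "E edge_of P" "x \<in> E" "y \<in> E"
    then obtain i j :: 'a and c where "x - y = c *\<^sub>R (axis i 1 - axis j 1)"
      using assms(1) unfolding generalized_permutohedron_def parallel_to_def by metis
    then have "(x - y) \<bullet> e_vec UNIV = 0"
      by (simp add: inner_e_vec axis_def sum_subtractf flip: sum_distrib_left)
    then show "e_vec UNIV \<bullet> x = e_vec UNIV \<bullet> y"
      by (simp add: inner_diff_left inner_commute[of "e_vec UNIV"])
  qed
  then show ?thesis by (simp add: inner_commute[of "e_vec UNIV"] inner_e_vec)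
qed

lemma centering_exists:
  assumes "generalized_permutohedron P"
  shows "\<exists>t. centering P t"
proof -
  from assms obtain v where v: "v \<in> P" "v \<in> lattice_vectors"
    using min_on_attained_lattice[of P "{}"] unfolding generalized_permutohedron_def by metis
  have "(\<Sum>i\<in>UNIV. (- v + x) $ i) = 0" if "x \<in> P" for x
    using gp_sum_const[OF assms that v(1)] by (simp add: sum.distrib sum_negf sum_subtractf)
  then show ?thesis using v(2) by (intro exI[of _ "- v"]) (auto simp: centering_def lattice_vectors_def)
qed

lemma chow_linear_relation:
  fixes u :: "'n::finite \<Rightarrow> int"
  assumes "(\<Sum>i\<in>UNIV. u i) = 0"
  shows "(\<Sum>S\<in>\<F>. of_int (\<Sum>i\<in>S. u i) * xvar S) \<in> chow_ideal \<F>"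
proof -
  interpret i: ideal "chow_ideal \<F>" "poly_ring_on \<F>" by (rule chow_ideal_ideal)
  define X where "X i = (\<Sum>S\<in>{S\<in>\<F>. i \<in> S}. xvar S)" for i
  obtain j :: 'n where True by simp
  have "(\<Sum>S\<in>\<F>. of_int (\<Sum>i\<in>S. u i) * xvar S) =
      (\<Sum>S\<in>\<F>. \<Sum>i\<in>UNIV. if i \<in> S then of_int (u i) * xvar S else 0)"
    by (intro sum.cong refl) (simp add: sum_distrib_right sum.If_cases)
  also have "\<dots> = (\<Sum>i\<in>UNIV. of_int (u i) * X i)"
    by (subst sum.swap)
      (simp add: X_def sum_distrib_left sum.inter_filter[symmetric])
  also have "\<dots> = (\<Sum>i\<in>UNIV. of_int (u i) * (X i - X j)) + of_int (\<Sum>i\<in>UNIV. u i) * X j"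
    by (simp add: right_diff_distrib sum_subtractf sum_distrib_right)
  also have "\<dots> = (\<Sum>i\<in>UNIV. of_int (u i) * (X i - X j))" using assms by simp
  finally have eq: "(\<Sum>S\<in>\<F>. of_int (\<Sum>i\<in>S. u i) * xvar S) = \<dots>" .
  have mem: "of_int (u i) * (X i - X j) \<in> chow_ideal \<F>" for i
  proof -
    have "X i - X j \<in> chow_ideal \<F>"
      using chow_relations_in_ideal unfolding X_def chow_relations_def by blast
    from i.I_l_closed[OF this poly_ring_on_of_int, of "u i"]
    show ?thesis by (simp add: poly_ring_on_def)
  qed
  have "(\<Sum>i\<in>A. of_int (u i) * (X i - X j)) \<in> chow_ideal \<F>" if "finite A" for A
    using that
  proof induction
    case empty show ?case
      using additive_subgroup.zero_closed[OF i.additive_subgroup_axioms]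
      by (simp add: poly_ring_on_def)
  next
    case (insert a A)
    then show ?case
      using additive_subgroup.a_closed[OF i.additive_subgroup_axioms mem insert.IH] by (simp add: poly_ring_on_def)
  qed
  then show ?thesis unfolding eq by simp
qed

lemma c1_perm_eq:
  assumes P: "generalized_permutohedron P" and t: "centering P t"
  shows "c1_perm P = c1_centered ((+) t ` P)"
proof -
  define s where "s = (SOME t. centering P t)"
  have s: "centering P s" unfolding s_def using t by (rule someI)
  have lp: "lattice_polytope P" using P by (simp add: generalized_permutohedron_def)
  have st: "s \<in> lattice_vectors" "t \<in> lattice_vectors" using s t by (auto simp: centering_def)
  define u where "u i = \<lfloor>t $ i\<rfloor> - \<lfloor>s $ i\<rfloor>" for i
  have u: "of_int (u i) = t $ i - s $ i" for i
    using st by (simp add: u_def lattice_vectors_def)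
  obtain x where x: "x \<in> P" using min_on_attained[OF lp] by blast
  have "(\<Sum>i\<in>UNIV. (s + x) $ i) = 0" "(\<Sum>i\<in>UNIV. (t + x) $ i) = 0"
    using s t x unfolding centering_def by blast+
  then have "real_of_int (\<Sum>i\<in>UNIV. u i) = 0" by (simp add: u sum.distrib sum_subtractf)
  then have sum0: "(\<Sum>i\<in>UNIV. u i) = 0" by (simp only: of_int_eq_0_iff)
  have fl: "\<lfloor>min_on ((+) t ` P) S\<rfloor> - \<lfloor>min_on ((+) s ` P) S\<rfloor> = (\<Sum>i\<in>S. u i)" for S
  proof -
    have "real_of_int (\<lfloor>min_on ((+) t ` P) S\<rfloor> - \<lfloor>min_on ((+) s ` P) S\<rfloor>) =
        min_on ((+) t ` P) S - min_on ((+) s ` P) S"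
      using min_on_Ints[OF lattice_polytope_translate[OF lp st(1)], of S]
        min_on_Ints[OF lattice_polytope_translate[OF lp st(2)], of S] by simp
    also have "\<dots> = real_of_int (\<Sum>i\<in>S. u i)"
      by (simp add: min_on_translate lp st inner_e_vec u sum_subtractf)
    finally show ?thesis by linarith
  qed
  have car: "(\<Sum>S\<in>proper_subsets. of_int (- \<lfloor>min_on Q S\<rfloor>) * xvar S)
      \<in> carrier (poly_ring_on proper_subsets)" for Q :: "(real ^ 'a) set"
    by (intro poly_ring_on_sum poly_ring_on_mult poly_ring_on_of_int xvar_carrier)
  have "(\<Sum>S\<in>proper_subsets. of_int (- \<lfloor>min_on ((+) s ` P) S\<rfloor>) * xvar S) -
      (\<Sum>S\<in>proper_subsets. of_int (- \<lfloor>min_on ((+) t ` P) S\<rfloor>) * xvar S) =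
      (\<Sum>S\<in>proper_subsets. of_int (\<Sum>i\<in>S. u i) * (xvar S :: 'a cpoly))"
    unfolding sum_subtractf[symmetric] fl[symmetric]
    by (intro sum.cong) (simp_all add: algebra_simps)
  also have "\<dots> \<in> chow_ideal proper_subsets" by (rule chow_linear_relation[OF sum0])
  finally show ?thesis
    unfolding c1_perm_def s_def[symmetric] c1_centered_def using chow_class_eq_iff[OF car car] by blast
qed

end

theory Submission
  imports Defs
begin

text \<open>
  The centred support function \<open>f\<close> of \<open>P\<close> is submodular, and it is additive over every partition coarsening
  the induced one. Hence for such a partition \<open>c\<^sub>1\<close> is a sum of classes pulled back from the Chow rings of
  the restrictions of the matroid to the blocks \<open>T\<close>; these vanish in degree \<open>rk T\<close>, which bounds the
  numerical dimension from above.

  For the lower bound, let \<open>h\<^sub>S\<close> be the class of the simplex on \<open>S\<close>. The functional that sends a monomial in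
  the \<open>h\<^sub>S\<close> to one or zero according to the dragon Hall-Rado condition respects the relations
  \<open>(h\<^sub>S - h\<^sub>S\<^sub>T) (h\<^sub>T - h\<^sub>S\<^sub>T) = 0\<close>, \<open>ST\<close> denoting the union, and these generate the relations of the Chow ring.
  In degree \<open>rk - 1\<close> it is nonnegative on flags, hence on products of submodular classes, and therefore
  monotone in the support functions. A multiple of \<open>f\<close>, suitably translated, dominates
  the support functions of the simplices on the blocks \<open>S\<^sub>j\<close> of the induced partition. So \<open>c\<^sub>1\<close> to the
  power \<open>d = \<Sum> a\<^sub>j\<close> is nonzero as soon as \<open>\<Prod> h\<^bsub>S_j\<^esub> ^ a\<^sub>j\<close> satisfies the dragon Hall-Rado condition.
  For a maximal vector \<open>a\<close> with this property, the maximal tight sets of blocks form a coarsening for which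
  \<open>d\<close> attains the upper bound.
\<close>

section \<open>Ideals of a commutative ring\<close>

text \<open>Nonvanishing in a quotient ring needs a certificate. The functional used here is
  explicit on monomials in the \<open>h S\<close>, and the ideal on which it vanishes need only
  contain the image of the Chow ideal, so neither a basis of the Chow ring nor Poincare duality
  enters. The price is that ray classes are alternating sums of monomials; positivity is visible
  only for complete flags, where a single monomial survives. This fixes the degree
  \<open>rk - 1\<close>. A power with smaller exponent is brought there by extra factors
  \<open>h UNIV\<close>, which affect the dragon Hall-Rado condition at the flat \<open>UNIV\<close>
  alone.

  The upper bound holds for every coarsening and the lower bound for every admissible exponent
  vector \<open>a\<close>. The formula is thus a min-max equality, the one for the Dilworth
  truncation: the largest sum of a vector bounded by \<open>rk - 1\<close> on unions of blocks
  equals the smallest value of \<open>\<Sum> (rk T - 1)\<close>.\<close>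

locale ring_ideal =
  fixes I :: "'a::comm_ring_1 set"
  assumes zero_mem: "0 \<in> I"
    and add_mem: "x \<in> I \<Longrightarrow> y \<in> I \<Longrightarrow> x + y \<in> I"
    and mult_mem: "x \<in> I \<Longrightarrow> x * y \<in> I"
begin

lemma mult_mem': "x \<in> I \<Longrightarrow> y * x \<in> I"
  using mult_mem[of x y] by (simp add: mult.commute)

lemma uminus_mem: "x \<in> I \<Longrightarrow> - x \<in> I"
  using mult_mem[of x "- 1"] by simp

lemma diff_mem: "x \<in> I \<Longrightarrow> y \<in> I \<Longrightarrow> x - y \<in> I"
  using add_mem[of x "- y"] uminus_mem[of y] by simp

lemma sum_mem: "(\<And>a. a \<in> A \<Longrightarrow> f a \<in> I) \<Longrightarrow> sum f A \<in> I"
  by (induction A rule: infinite_finite_induct) (auto intro: zero_mem add_mem)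

lemma mem_cong: "x - y \<in> I \<Longrightarrow> y \<in> I \<Longrightarrow> x \<in> I"
  using add_mem[of "x - y" y] by simp

lemma cong_mult: "x - y \<in> I \<Longrightarrow> x' - y' \<in> I \<Longrightarrow> x * x' - y * y' \<in> I"
proof -
  assume "x - y \<in> I" "x' - y' \<in> I"
  then have "(x - y) * x' + y * (x' - y') \<in> I" by (intro add_mem mult_mem mult_mem')
  then show ?thesis by (simp add: algebra_simps)
qed

lemma cong_trans: "x - y \<in> I \<Longrightarrow> y - z \<in> I \<Longrightarrow> x - z \<in> I"
  using add_mem[of "x - y" "y - z"] by simp

lemma cong_power: "x - y \<in> I \<Longrightarrow> x ^ k - y ^ k \<in> I"
  by (induction k) (auto intro: zero_mem cong_mult)

lemma power_mono_mem: "x ^ k \<in> I \<Longrightarrow> k \<le> l \<Longrightarrow> x ^ l \<in> I"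
  using mult_mem[of "x ^ k" "x ^ (l - k)"] by (simp flip: power_add)

text \<open>With exponents written as successors, \<open>m\<close> and \<open>n\<close> bound the
  last nonvanishing powers, and such bounds add: every term of the expansion has \<open>a\<close> at
  least \<open>m + 1\<close> times or \<open>b\<close> at least \<open>n + 1\<close> times. This is
  the source of the \<open>- 1\<close> for each block.\<close>

lemma power_add_mem:
  assumes "a ^ Suc m \<in> I" "b ^ Suc n \<in> I"
  shows "(a + b) ^ Suc (m + n) \<in> I"
  unfolding binomial_ring
proof (rule sum_mem)
  fix k assume k: "k \<in> {..Suc (m + n)}"
  show "of_nat (Suc (m + n) choose k) * a ^ k * b ^ (Suc (m + n) - k) \<in> I"
  proof (cases "Suc m \<le> k")
    case True
    then show ?thesis using power_mono_mem[OF assms(1)] by (intro mult_mem mult_mem')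
  next
    case False
    then have "Suc n \<le> Suc (m + n) - k" by simp
    then show ?thesis using power_mono_mem[OF assms(2)] by (intro mult_mem')
  qed
qed

lemma power_sum_mem:
  assumes "finite A" "\<And>a. a \<in> A \<Longrightarrow> f a ^ Suc (n a) \<in> I"
  shows "sum f A ^ Suc (sum n A) \<in> I"
  using assms
proof (induction A)
  case empty
  show ?case by (simp add: zero_mem)
next
  case (insert a A)
  then have "(f a + sum f A) ^ Suc (n a + sum n A) \<in> I"
    by (intro power_add_mem) auto
  then show ?case using insert.hyps by simp
qed

end


section \<open>The rank function of a loopless matroid\<close>

locale loopless_matroid =
  fixes \<B> :: "'n::finite set set"
  assumes matroid: "is_matroid \<B>" and loopless: "loopless \<B>"
begin

abbreviation r :: "'n set \<Rightarrow> nat" where "r \<equiv> rk \<B>"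
abbreviation indep :: "'n set \<Rightarrow> bool" where "indep \<equiv> independent_in \<B>"

lemma exchange:
  assumes "A \<in> \<B>" "B \<in> \<B>" "a \<in> A - B"
  obtains b where "b \<in> B - A" "insert b (A - {a}) \<in> \<B>"
  using matroid assms unfolding is_matroid_def by blast

lemma bases_card_eq: "A \<in> \<B> \<Longrightarrow> B \<in> \<B> \<Longrightarrow> card A = card B"
proof (induction "card (A - B)" arbitrary: A)
  case 0
  then have "A \<subseteq> B" by simp
  moreover have "B \<subseteq> A"
  proof
    fix b assume "b \<in> B"
    then show "b \<in> A" using exchange[OF 0(3,2), of b] calculation by blast
  qed
  ultimately show ?case by simp
next
  case (Suc k)
  then obtain a where a: "a \<in> A - B" by (metis card.empty equals0I nat.distinct(1))
  obtain b where b: "b \<in> B - A" "insert b (A - {a}) \<in> \<B>" using exchange[OF Suc.prems a] .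
  have "insert b (A - {a}) - B = (A - B) - {a}" using b by auto
  then have "k = card (insert b (A - {a}) - B)" using Suc.hyps(2) a by simp
  from Suc.hyps(1)[OF this b(2) Suc.prems(2)] have "card (insert b (A - {a})) = card B" .
  moreover have "card (insert b (A - {a})) = card A"
    using a b card_Suc_Diff1[of A a] by simp
  ultimately show ?case by simp
qed

text \<open>Among the bases containing \<open>I\<close>, one that meets a basis
  \<open>B \<supseteq> J\<close> most lies in \<open>I \<union> B\<close>, since an exchange would
  otherwise improve it. Counting then puts an element of \<open>J - I\<close> into it.\<close>

lemma indep_augment:
  assumes "indep I" "indep J" "card I < card J"
  obtains e where "e \<in> J - I" "indep (insert e I)"
proof -
  obtain B where B: "B \<in> \<B>" "J \<subseteq> B" using assms(2) by (auto simp: independent_in_def)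
  obtain A0 where A0: "A0 \<in> \<B> \<and> I \<subseteq> A0" using assms(1) by (auto simp: independent_in_def)
  obtain A where A: "A \<in> \<B>" "I \<subseteq> A"
    and max: "\<And>A'. A' \<in> \<B> \<Longrightarrow> I \<subseteq> A' \<Longrightarrow> card (A' \<inter> B) \<le> card (A \<inter> B)"
    using ex_has_greatest_nat[of "\<lambda>A. A \<in> \<B> \<and> I \<subseteq> A" A0 "\<lambda>A. card (A \<inter> B)" "card B + 1"]
    using A0 card_mono[of B] by (metis Int_lower2 finite less_add_one not_le order.strict_trans2)
  have "A \<subseteq> I \<union> B"
  proof (rule ccontr)
    assume "\<not> A \<subseteq> I \<union> B"
    then obtain a where a: "a \<in> A - B" "a \<notin> I" by blast
    obtain b where b: "b \<in> B - A" "insert b (A - {a}) \<in> \<B>" using exchange[OF A(1) B(1) a(1)] .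
    have "insert b (A - {a}) \<inter> B = insert b (A \<inter> B)" using a b by auto
    then have "card (insert b (A - {a}) \<inter> B) > card (A \<inter> B)" using b by simp
    moreover have "I \<subseteq> insert b (A - {a})" using A(2) a(2) by blast
    ultimately show False using max[OF b(2)] by simp
  qed
  then have "A - B \<subseteq> I - J" using B(2) by blast
  then have "card (A - B) \<le> card (I - J)" by (intro card_mono) auto
  moreover have "card (B - A) = card (A - B)"
    using bases_card_eq[OF A(1) B(1)] card_Diff_subset_Int[of A B] card_Diff_subset_Int[of B A]
    by (simp add: Int_commute)
  moreover have "card (I - J) < card (J - I)"
    using assms(3) card_Int_Diff[of I J] card_Int_Diff[of J I] by (simp add: Int_commute)
  ultimately have "\<not> J - I \<subseteq> B - A" using card_mono[of "B - A" "J - I"] by auto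
  then obtain e where "e \<in> J - I" "e \<in> A" using B(2) by blast
  then show thesis using that[of e] A by (auto simp: independent_in_def)
qed

lemma indep_subset: "indep I \<Longrightarrow> J \<subseteq> I \<Longrightarrow> indep J"
  by (auto simp: independent_in_def)

lemma indep_empty: "indep {}"
  using matroid by (auto simp: independent_in_def is_matroid_def)

lemma card_le_rk: "indep I \<Longrightarrow> I \<subseteq> S \<Longrightarrow> card I \<le> r S"
  unfolding rk_def by (intro Max_ge) auto

lemma rk_attained: obtains I where "I \<subseteq> S" "indep I" "card I = r S"
proof -
  have "r S \<in> {card I |I. I \<subseteq> S \<and> indep I}"
    unfolding rk_def using indep_empty by (intro Max_in) auto
  then show thesis using that by auto
qed

lemma rk_leI: "(\<And>I. I \<subseteq> S \<Longrightarrow> indep I \<Longrightarrow> card I \<le> k) \<Longrightarrow> r S \<le> k"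
  by (rule rk_attained[of S]) metis

lemma rk_mono: "S \<subseteq> T \<Longrightarrow> r S \<le> r T"
  by (rule rk_leI) (auto intro: card_le_rk)

lemma rk_le_card: "r S \<le> card S"
  by (rule rk_leI) (auto intro: card_mono)

lemma indep_extend:
  assumes "indep I" "I \<subseteq> S"
  obtains J where "I \<subseteq> J" "J \<subseteq> S" "indep J" "card J = r S"
proof -
  have "\<exists>J. I \<subseteq> J \<and> J \<subseteq> S \<and> indep J \<and> card J = r S"
    using assms
  proof (induction "r S - card I" arbitrary: I rule: less_induct)
    case less
    show ?case
    proof (cases "card I = r S")
      case True
      then show ?thesis using less.prems by blast
    next
      case False
      then have lt: "card I < r S" using card_le_rk[OF less.prems] by simp
      obtain J where J: "J \<subseteq> S" "indep J" "card J = r S" using rk_attained .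
      obtain e where e: "e \<in> J - I" "indep (insert e I)"
        using indep_augment[OF less.prems(1) J(2)] lt J(3) by auto
      have "r S - card (insert e I) < r S - card I" using e lt by simp
      from less.hyps[OF this e(2)] show ?thesis using e J less.prems by auto
    qed
  qed
  then show thesis using that by blast
qed

text \<open>A maximal independent subset of \<open>X \<inter> Y\<close> is extended inside
  \<open>X\<close> and then inside \<open>X \<union> Y\<close>; the result \<open>K\<close> meets
  \<open>X\<close> and \<open>Y\<close> in independent sets.\<close>

lemma rk_submodular: "r (X \<union> Y) + r (X \<inter> Y) \<le> r X + r Y"
proof -
  obtain I where I: "I \<subseteq> X \<inter> Y" "indep I" "card I = r (X \<inter> Y)" using rk_attained .
  obtain J where J: "I \<subseteq> J" "J \<subseteq> X" "indep J" "card J = r X"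
    using indep_extend[OF I(2), of X] I(1) by blast
  obtain K where K: "J \<subseteq> K" "K \<subseteq> X \<union> Y" "indep K" "card K = r (X \<union> Y)"
    using indep_extend[OF J(3), of "X \<union> Y"] J(2) by blast
  have "card (K \<inter> X) \<le> r X" "card (K \<inter> Y) \<le> r Y"
    using indep_subset[OF K(3)] by (auto intro: card_le_rk)
  moreover have "card I \<le> card ((K \<inter> X) \<inter> (K \<inter> Y))" using I J K by (intro card_mono) auto
  moreover have "card (K \<inter> X) + card (K \<inter> Y) = card K + card ((K \<inter> X) \<inter> (K \<inter> Y))"
  proof -
    have "(K \<inter> X) \<union> (K \<inter> Y) = K" using K(2) by blast
    then show ?thesis using card_Un_Int[of "K \<inter> X" "K \<inter> Y"] by simp
  qed
  ultimately show ?thesis using I K by simp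
qed

lemma rk_singleton: "r {e} = 1"
proof (rule antisym)
  show "r {e} \<le> 1" using rk_le_card[of "{e}"] by simp
  have "indep {e}" using loopless by (auto simp: loopless_def independent_in_def)
  from card_le_rk[OF this order.refl] show "1 \<le> r {e}" by simp
qed

lemma rk_pos: "S \<noteq> {} \<Longrightarrow> 0 < r S"
  by (metis One_nat_def Suc_le_eq all_not_in_conv empty_subsetI insert_subset rk_mono rk_singleton)

section \<open>Closure and flats\<close>

definition cl :: "'n set \<Rightarrow> 'n set" where
  "cl S = {e. r (insert e S) = r S}"

lemma mem_clI: "r (insert e S) \<le> r S \<Longrightarrow> e \<in> cl S"
  unfolding cl_def mem_Collect_eq by (rule antisym[OF _ rk_mono[OF subset_insertI]])

lemma subset_cl: "S \<subseteq> cl S"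
  by (auto simp: cl_def insert_absorb)

lemma mem_cl_mono:
  assumes "e \<in> cl S" "S \<subseteq> T"
  shows "e \<in> cl T"
proof (cases "e \<in> T")
  case False
  have eq: "insert e S \<union> T = insert e T" using assms(2) by blast
  have "r (insert e T) + r (insert e S \<inter> T) \<le> r (insert e S) + r T"
    using rk_submodular[of "insert e S" T] eq by simp
  moreover have "r S \<le> r (insert e S \<inter> T)" using assms(2) by (intro rk_mono) auto
  moreover have "r (insert e S) = r S" using assms(1) by (simp add: cl_def)
  ultimately have "r (insert e T) \<le> r T" by simp
  then show ?thesis by (rule mem_clI)
qed (use subset_cl in blast)

lemma cl_mono: "S \<subseteq> T \<Longrightarrow> cl S \<subseteq> cl T"
  using mem_cl_mono by blast

lemma rk_Un_cl:
  assumes "T \<subseteq> cl S"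
  shows "r (S \<union> T) = r S"
  using finite[of T] assms
proof (induction T)
  case (insert e T)
  have "e \<in> cl (S \<union> T)" using insert.prems mem_cl_mono[of e S "S \<union> T"] by blast
  then show ?case using insert by (simp add: cl_def)
qed simp

lemma rk_cl: "r (cl S) = r S"
  using rk_Un_cl[of "cl S" S] subset_cl[of S] by (simp add: Un_absorb1)

lemma cl_insert: "e \<in> cl S \<Longrightarrow> cl (insert e S) = cl S"
proof
  assume e: "e \<in> cl S"
  then have eq: "r (insert e S) = r S" by (simp add: cl_def)
  show "cl (insert e S) \<subseteq> cl S"
  proof
    fix x assume "x \<in> cl (insert e S)"
    then have "r (insert x (insert e S)) = r S" using eq by (simp add: cl_def)
    then have "r (insert x S) \<le> r S" using rk_mono[of "insert x S" "insert x (insert e S)"] by auto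
    then show "x \<in> cl S" by (rule mem_clI)
  qed
qed (rule cl_mono[OF subset_insertI])

lemma flat_rk_less: "flat \<B> F \<Longrightarrow> F \<subset> S \<Longrightarrow> r F < r S"
  unfolding flat_def by (metis le_neq_implies_less psubset_imp_subset rk_mono)

lemma flat_iff_cl: "flat \<B> F \<longleftrightarrow> cl F \<subseteq> F"
proof
  assume F: "flat \<B> F"
  show "cl F \<subseteq> F"
  proof
    fix e assume "e \<in> cl F"
    then show "e \<in> F" using flat_rk_less[OF F, of "insert e F"] by (auto simp: cl_def)
  qed
next
  assume c: "cl F \<subseteq> F"
  show "flat \<B> F" unfolding flat_def
  proof (intro allI impI notI)
    fix S assume S: "F \<subset> S" "r S = r F"
    then obtain e where e: "e \<in> S" "e \<notin> F" by blast
    then have "r (insert e F) \<le> r S" using S by (intro rk_mono) auto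
    then have "e \<in> cl F" using S(2) by (intro mem_clI) simp
    then show False using c e by blast
  qed
qed

lemma cl_subset_flat: "flat \<B> F \<Longrightarrow> S \<subseteq> F \<Longrightarrow> cl S \<subseteq> F"
  using cl_mono flat_iff_cl by blast

lemma flat_cl: "flat \<B> (cl S)"
  unfolding flat_iff_cl
proof
  fix e assume "e \<in> cl (cl S)"
  then have "r (insert e (cl S)) = r S" using rk_cl[of S] by (simp only: cl_def[of "cl S"] mem_Collect_eq)
  then have "r (insert e S) \<le> r S"
    using rk_mono[OF insert_mono[OF subset_cl[of S]], of e] by simp
  then show "e \<in> cl S" by (rule mem_clI)
qed

lemma flat_UNIV: "flat \<B> UNIV"
  by (auto simp: flat_def)

end

section \<open>Support functions of generalized permutohedra\<close>

lemma min_on_eqI: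
  assumes "v \<in> P" "\<And>p. p \<in> P \<Longrightarrow> v \<bullet> e_vec S \<le> p \<bullet> e_vec S"
  shows "min_on P S = v \<bullet> e_vec S"
  unfolding min_on_def by (rule cInf_eq_minimum) (use assms in auto)

lemma min_on_le:
  assumes "lattice_polytope P" "p \<in> P"
  shows "min_on P S \<le> p \<bullet> e_vec S"
  using min_on_attained[OF assms(1), of S] assms(2) by auto

lemma hull_inner_ge:
  fixes w :: "'a::real_inner"
  assumes "\<And>v. v \<in> V \<Longrightarrow> b \<le> w \<bullet> v" "x \<in> convex hull V"
  shows "b \<le> w \<bullet> x"
proof -
  have "convex hull V \<subseteq> {x. w \<bullet> x \<ge> b}"
    by (intro hull_minimal convex_halfspace_ge) (use assms(1) in auto)
  then show ?thesis using assms(2) by auto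
qed

lemma inner_axis_diff_e_vec:
  "(axis i 1 - axis j 1) \<bullet> e_vec S = of_bool (i \<in> S) - of_bool (j \<in> S)"
  by (simp add: inner_e_vec axis_def sum_subtractf of_bool_def)

text \<open>The minimum is taken at a vertex that minimises \<open>e_vec A\<close> first and \<open>e_vec B\<close> second. If a vertex with
  smaller \<open>e_vec B\<close>-value existed, some positive combination \<open>s \<cdot> e_vec A + e_vec B\<close> would be minimal on a
  face on which \<open>e_vec B\<close> varies, but no edge direction allows this.\<close>

lemma gp_simultaneous_min:
  fixes P :: "(real ^ 'n::finite) set"
  assumes P: "generalized_permutohedron P" and AB: "A \<subseteq> B"
  obtains v where "v \<in> P" "min_on P A = v \<bullet> e_vec A" "min_on P B = v \<bullet> e_vec B"
proof -
  obtain V where V: "finite V" "V \<noteq> {}" "P = convex hull V"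
    using P unfolding generalized_permutohedron_def lattice_polytope_def by blast
  have pt: "polytope P" using V unfolding polytope_def by blast
  define a b where "a v = v \<bullet> e_vec A" and "b v = v \<bullet> e_vec B" for v :: "real ^ 'n"
  obtain v0 where v0: "v0 \<in> V" "\<And>u. u \<in> V \<Longrightarrow> a v0 \<le> a u"
    using arg_min_if_finite[OF V(1,2), of a] by (metis not_less)
  define V1 where "V1 = {v \<in> V. a v = a v0}"
  have V1: "finite V1" "V1 \<noteq> {}" using V v0 by (auto simp: V1_def)
  obtain v where v: "v \<in> V1" "\<And>u. u \<in> V1 \<Longrightarrow> b v \<le> b u"
    using arg_min_if_finite[OF V1, of b] by (metis not_less)
  have vV: "v \<in> V" and av: "\<And>u. u \<in> V \<Longrightarrow> a v \<le> a u" using v v0 by (auto simp: V1_def)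
  have vP: "v \<in> P" using vV V(3) hull_inc by metis
  have bv: "b v \<le> b u" if "u \<in> V" for u
  proof (rule ccontr)
    assume "\<not> b v \<le> b u"
    define U where "U = {u \<in> V. b u < b v}"
    have U: "finite U" "U \<noteq> {}" using V(1) \<open>u \<in> V\<close> \<open>\<not> b v \<le> b u\<close> by (auto simp: U_def)
    have aU: "a v < a u" if "u \<in> U" for u
    proof (rule ccontr)
      assume "\<not> a v < a u"
      then have "u \<in> V1" using that av[of u] v(1) by (auto simp: U_def V1_def)
      then show False using v(2)[of u] that by (simp add: U_def)
    qed
    \<comment> \<open>\<open>sl u\<close> is the weight \<open>s\<close> at which \<open>u\<close>
      and \<open>v\<close> tie for \<open>s * a + b\<close>. For the largest of these weights
      \<open>v\<close> is still minimal, and \<open>m\<close> ties with it.\<close>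
    define sl where "sl u = (b v - b u) / (a u - a v)" for u
    obtain m where m: "m \<in> U" "\<And>u. u \<in> U \<Longrightarrow> sl u \<le> sl m"
      using arg_min_if_finite[OF U, of "\<lambda>u. - sl u"] by (metis neg_less_iff_less not_less)
    define s where "s = sl m"
    have s: "0 < s" using m(1) aU[OF m(1)] by (simp add: s_def sl_def U_def)
    define w where "w = s *\<^sub>R e_vec A + e_vec B"
    have w: "w \<bullet> x = s * a x + b x" for x
      by (simp add: w_def a_def b_def inner_add_left inner_add_right inner_commute)
    have le: "w \<bullet> v \<le> w \<bullet> z" if "z \<in> V" for z
    proof (cases "z \<in> U")
      case True
      then have "sl z \<le> s" "0 < a z - a v" using m(2) aU by (auto simp: s_def)
      then have "b v - b z \<le> s * (a z - a v)" by (simp add: sl_def pos_divide_le_eq)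
      then show ?thesis by (simp add: w algebra_simps)
    next
      case False
      then have "b v \<le> b z" using that by (auto simp: U_def)
      moreover have "s * a v \<le> s * a z" using s av[OF that] by simp
      ultimately show ?thesis by (simp add: w)
    qed
    have leP: "w \<bullet> v \<le> w \<bullet> x" if "x \<in> P" for x
      using hull_inner_ge[of V "w \<bullet> v" w x] le that V(3) by blast
    define F where "F = P \<inter> {x. w \<bullet> x = w \<bullet> v}"
    have F: "F face_of P" unfolding F_def
      by (rule face_of_Int_supporting_hyperplane_ge[OF polytope_imp_convex[OF pt]]) (use leP in auto)
    have vF: "v \<in> F" using vP by (simp add: F_def)
    have "s * (a m - a v) = b v - b m" using aU[OF m(1)] by (simp add: s_def sl_def)
    then have "w \<bullet> m = w \<bullet> v" by (simp add: w algebra_simps)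
    moreover have "m \<in> P" using m(1) V(3) hull_inc by (auto simp: U_def)
    ultimately have mF: "m \<in> F" by (simp add: F_def)
    have "e_vec B \<bullet> v = e_vec B \<bullet> m"
    proof (rule polytope_const_if_const_on_edges[OF face_of_polytope_polytope[OF pt F] _ vF mF])
      fix E x y assume E: "E edge_of F" "x \<in> E" "y \<in> E"
      then have "E edge_of P" using F face_of_trans unfolding edge_of_def by blast
      then obtain i j :: 'n and c where c: "x - y = c *\<^sub>R (axis i 1 - axis j 1)"
        using P E unfolding generalized_permutohedron_def parallel_to_def by metis
      have "x \<in> F" "y \<in> F" using E face_of_imp_subset unfolding edge_of_def by blast+
      then have "w \<bullet> (x - y) = 0" by (simp add: F_def inner_diff_right)
      then have "c = 0 \<or> s * (of_bool (i \<in> A) - of_bool (j \<in> A)) + (of_bool (i \<in> B) - of_bool (j \<in> B)) = 0"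
        unfolding c by (simp add: w a_def b_def inner_axis_diff_e_vec flip: distrib_left)
      \<comment> \<open>If exactly one of \<open>i\<close>, \<open>j\<close> lies in
        \<open>B\<close>, then by \<open>A \<subseteq> B\<close> the difference for \<open>A\<close>
        is zero or has the same sign as that for \<open>B\<close>, so with \<open>s > 0\<close> the
        sum cannot vanish.\<close>
      then have "c = 0 \<or> (i \<in> B \<longleftrightarrow> j \<in> B)"
        using s AB by (auto simp: of_bool_def split: if_splits)
      then have "(x - y) \<bullet> e_vec B = 0" unfolding c by (auto simp: inner_axis_diff_e_vec)
      then show "e_vec B \<bullet> x = e_vec B \<bullet> y" by (metis eq_iff_diff_eq_0 inner_commute inner_diff_left)
    qed
    then have "b v = b m" by (simp add: b_def inner_commute)
    then show False using m(1) by (simp add: U_def)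
  qed
  have "v \<bullet> e_vec A \<le> x \<bullet> e_vec A" "v \<bullet> e_vec B \<le> x \<bullet> e_vec B" if "x \<in> P" for x
    using hull_inner_ge[of V "a v" "e_vec A" x] hull_inner_ge[of V "b v" "e_vec B" x] that V(3) av bv
    by (auto simp: a_def b_def inner_commute)
  then show thesis using that[OF vP min_on_eqI[OF vP] min_on_eqI[OF vP]] by blast
qed

text \<open>At a point minimal for both \<open>S \<inter> T\<close> and \<open>S \<union> T\<close>
  the right-hand side is attained, and there it equals the sum of the values of
  \<open>e_vec S\<close> and \<open>e_vec T\<close>.\<close>

lemma gp_min_on_supermodular:
  assumes "generalized_permutohedron P"
  shows "min_on P S + min_on P T \<le> min_on P (S \<union> T) + min_on P (S \<inter> T)"
proof -
  obtain v where v: "v \<in> P" "min_on P (S \<inter> T) = v \<bullet> e_vec (S \<inter> T)" "min_on P (S \<union> T) = v \<bullet> e_vec (S \<union> T)"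
    using gp_simultaneous_min[OF assms, of "S \<inter> T" "S \<union> T"] by blast
  have "min_on P S + min_on P T \<le> v \<bullet> e_vec S + v \<bullet> e_vec T"
    using assms v(1) by (intro add_mono min_on_le) (auto simp: generalized_permutohedron_def)
  also have "\<dots> = v \<bullet> e_vec (S \<union> T) + v \<bullet> e_vec (S \<inter> T)"
    by (simp add: inner_e_vec sum.union_inter)
  finally show ?thesis using v by simp
qed

lemma induced_partition_on: "partition_on UNIV (induced_partition P)"
  unfolding induced_partition_def
  by (rule partition_on_quotient) (auto simp: equiv_def refl_on_def sym_def trans_def
      intro: equivclp_sym equivclp_trans)

text \<open>A functional is constant on a polytope iff it is constant along the edges, and along a
  direction \<open>axis i 1 - axis j 1\<close> the functional \<open>e_vec S\<close> is constant iff
  \<open>S\<close> contains both or neither of \<open>i\<close>, \<open>j\<close>. Apart from being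
  a partition, this is all the main argument uses about the induced partition.\<close>

lemma gp_e_vec_const_iff:
  fixes P :: "(real ^ 'n::finite) set"
  assumes P: "generalized_permutohedron P"
  shows "(\<forall>x\<in>P. \<forall>y\<in>P. x \<bullet> e_vec S = y \<bullet> e_vec S) \<longleftrightarrow> (\<forall>X\<in>induced_partition P. X \<subseteq> S \<or> X \<inter> S = {})"
    (is "?L \<longleftrightarrow> ?R")
proof
  assume L: ?L
  have step: "i \<in> S \<longleftrightarrow> j \<in> S" if ij: "has_edge_dir P i j" for i j
  proof -
    obtain E where E: "E edge_of P" "parallel_to E (axis i 1 - axis j 1)"
      using ij by (auto simp: has_edge_dir_def)
    \<comment> \<open>A singleton would be parallel to every direction; two distinct points of the
      edge give a nonzero \<open>c\<close>.\<close>
    have "\<not> (\<exists>a. E \<subseteq> {a})"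
    proof
      assume "\<exists>a. E \<subseteq> {a}"
      then obtain a where "E \<subseteq> {a}" by blast
      from aff_dim_subset[OF this] show False using E(1) by (simp add: edge_of_def)
    qed
    then obtain x y where xy: "x \<in> E" "y \<in> E" "x \<noteq> y" by blast
    then obtain c where c: "x - y = c *\<^sub>R (axis i 1 - axis j 1)"
      using E(2) by (auto simp: parallel_to_def)
    have "E \<subseteq> P" using E(1) face_of_imp_subset by (auto simp: edge_of_def)
    then have "x \<bullet> e_vec S = y \<bullet> e_vec S" using L xy by blast
    then have "(x - y) \<bullet> e_vec S = 0" by (simp add: inner_diff_left)
    moreover have "c \<noteq> 0" using c xy(3) by auto
    ultimately show ?thesis unfolding c by (simp add: inner_axis_diff_e_vec of_bool_eq_iff)
  qed
  have *: "a \<in> S \<longleftrightarrow> b \<in> S" if "equivclp (has_edge_dir P) a b" for a b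
    using that by (induction rule: equivclp_induct) (use step in auto)
  show ?R
  proof
    fix X assume "X \<in> induced_partition P"
    then obtain a where "X = {b. equivclp (has_edge_dir P) a b}"
      by (auto simp: induced_partition_def quotient_def)
    then show "X \<subseteq> S \<or> X \<inter> S = {}" using * by auto
  qed
next
  assume R: ?R
  have same: "i \<in> S \<longleftrightarrow> j \<in> S" if "has_edge_dir P i j" for i j
  proof -
    define X where "X = {b. equivclp (has_edge_dir P) i b}"
    have "X \<in> induced_partition P" by (auto simp: X_def induced_partition_def quotient_def)
    moreover have "i \<in> X" "j \<in> X" using that by (auto simp: X_def)
    ultimately show ?thesis using R by blast
  qed
  have pt: "polytope P"
    using P unfolding generalized_permutohedron_def lattice_polytope_def polytope_def by blast
  have "e_vec S \<bullet> x = e_vec S \<bullet> y" if "x \<in> P" "y \<in> P" for x y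
  proof (rule polytope_const_if_const_on_edges[OF pt _ that])
    fix E x y assume E: "E edge_of P" "x \<in> E" "y \<in> E"
    then obtain i j :: 'n where ij: "i \<noteq> j" "parallel_to E (axis i 1 - axis j 1)"
      using P unfolding generalized_permutohedron_def by metis
    then obtain c where c: "x - y = c *\<^sub>R (axis i 1 - axis j 1)"
      using E by (auto simp: parallel_to_def)
    have "has_edge_dir P i j" using E ij by (auto simp: has_edge_dir_def)
    then have "(x - y) \<bullet> e_vec S = 0" unfolding c using same by (simp add: inner_axis_diff_e_vec)
    then show "e_vec S \<bullet> x = e_vec S \<bullet> y" by (metis eq_iff_diff_eq_0 inner_commute inner_diff_left)
  qed
  then show ?L by (metis inner_commute)
qed

section \<open>The support function of the centred polytope\<close>

context
  fixes P :: "(real ^ 'n::finite) set" and t and f :: "'n set \<Rightarrow> int"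
  assumes P: "generalized_permutohedron P" and t: "centering P t"
  defines "f \<equiv> \<lambda>S. - \<lfloor>min_on ((+) t ` P) S\<rfloor>"
begin

lemma gp_lattice_polytope: "lattice_polytope P"
  using P by (simp add: generalized_permutohedron_def)

lemma centering_lattice_vector: "t \<in> lattice_vectors"
  using t by (simp add: centering_def)

lemma lattice_polytope_centered: "lattice_polytope ((+) t ` P)"
  by (rule lattice_polytope_translate[OF gp_lattice_polytope centering_lattice_vector])

lemma centered_inner_UNIV: "y \<in> (+) t ` P \<Longrightarrow> y \<bullet> e_vec UNIV = 0"
  using t unfolding centering_def inner_e_vec by blast

lemma gp_nonempty: obtains x where "x \<in> P"
  using min_on_attained[OF gp_lattice_polytope, of "{}"] by blast

lemma support_fn_eq: "real_of_int (f S) = - min_on ((+) t ` P) S"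
proof -
  obtain n where "min_on ((+) t ` P) S = of_int n"
    using min_on_Ints[OF lattice_polytope_centered, of S] by (rule Ints_cases)
  then show ?thesis by (simp add: f_def)
qed

lemma support_fn_eq': "real_of_int (f S) = - (t \<bullet> e_vec S + min_on P S)"
  unfolding support_fn_eq min_on_translate[OF gp_lattice_polytope centering_lattice_vector] ..

lemma support_fn_submodular: "f (S \<union> T) + f (S \<inter> T) \<le> f S + f T"
proof -
  have "t \<bullet> e_vec S + t \<bullet> e_vec T = t \<bullet> e_vec (S \<union> T) + t \<bullet> e_vec (S \<inter> T)"
    by (simp add: inner_e_vec sum.union_inter)
  then have "real_of_int (f (S \<union> T) + f (S \<inter> T)) \<le> real_of_int (f S + f T)"
    using gp_min_on_supermodular[OF P, of S T] unfolding of_int_add support_fn_eq' by linarith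
  then show ?thesis by (simp only: of_int_le_iff)
qed

text \<open>Coordinates of the centred polytope sum to zero, so \<open>e_vec (- S)\<close> is the
  negative of \<open>e_vec S\<close> there; if the latter is constant, the two minima cancel. This
  equality is what makes \<open>f\<close> additive over a coarsening.\<close>

lemma support_fn_compl:
  assumes "\<And>x y. x \<in> P \<Longrightarrow> y \<in> P \<Longrightarrow> x \<bullet> e_vec S = y \<bullet> e_vec S"
  shows "f S + f (- S) = 0"
proof -
  obtain x where x: "x \<in> P" by (rule gp_nonempty)
  have *: "y \<bullet> e_vec (- S) = - (y \<bullet> e_vec S)" if "y \<in> (+) t ` P" for y
    using centered_inner_UNIV[OF that] sum.union_disjoint[of S "- S" "\<lambda>i. y $ i"] by (simp add: inner_e_vec)
  have const: "p \<bullet> e_vec S = (t + x) \<bullet> e_vec S" if p: "p \<in> (+) t ` P" for p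
  proof -
    obtain y where y: "y \<in> P" "p = t + y" using p by blast
    show ?thesis unfolding y(2) inner_add_left assms[OF y(1) x] ..
  qed
  have tx: "t + x \<in> (+) t ` P" using x by blast
  have 1: "min_on ((+) t ` P) S = (t + x) \<bullet> e_vec S"
    by (rule min_on_eqI[OF tx eq_refl[OF const[symmetric]]])
  have "(t + x) \<bullet> e_vec (- S) = p \<bullet> e_vec (- S)" if p: "p \<in> (+) t ` P" for p
    unfolding *[OF p] *[OF tx] const[OF p] ..
  from min_on_eqI[OF tx eq_refl[OF this]]
  have 2: "min_on ((+) t ` P) (- S) = - ((t + x) \<bullet> e_vec S)" unfolding *[OF tx] .
  have "real_of_int (f S + f (- S)) = 0" by (simp add: support_fn_eq 1 2)
  then show ?thesis by (simp only: of_int_eq_0_iff)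
qed

lemma support_fn_empty: "f {} = 0"
proof -
  obtain x where x: "x \<in> P" by (rule gp_nonempty)
  have "min_on ((+) t ` P) {} = (t + x) \<bullet> e_vec {}"
    by (rule min_on_eqI) (use x in \<open>auto simp: inner_e_vec\<close>)
  then show ?thesis by (simp add: f_def inner_e_vec)
qed

lemma support_fn_UNIV: "f UNIV = 0"
proof -
  have "f {} + f (- {}) = 0" by (rule support_fn_compl) (simp add: inner_e_vec)
  then show ?thesis by (simp add: support_fn_empty)
qed

text \<open>Translating a dilate so that the barycentre of a vertex set becomes the origin makes the support
  function strictly positive wherever it can be.\<close>

lemma support_fn_strict:
  obtains N :: nat and u :: "'n \<Rightarrow> int" where "(\<Sum>i\<in>UNIV. u i) = 0"
    "\<And>S. 0 \<le> int N * f S + (\<Sum>i\<in>S. u i)"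
    "\<And>S. \<exists>x\<in>P. \<exists>y\<in>P. x \<bullet> e_vec S \<noteq> y \<bullet> e_vec S \<Longrightarrow> 1 \<le> int N * f S + (\<Sum>i\<in>S. u i)"
proof -
  let ?Q = "(+) t ` P"
  obtain V where V: "finite V" "V \<noteq> {}" "V \<subseteq> lattice_vectors" "?Q = convex hull V"
    using lattice_polytope_centered unfolding lattice_polytope_def by blast
  have VQ: "v \<in> ?Q" if "v \<in> V" for v using that hull_inc V(4) by metis
  \<comment> \<open>\<open>u\<close> is \<open>card V\<close> times the barycentre of
    \<open>V\<close>, hence integral; the floors are exact. With \<open>N = card V\<close> the value
    at \<open>S\<close> becomes the sum of the gaps
    \<open>v \<bullet> e_vec S - min_on ?Q S\<close>, which is zero only if \<open>e_vec S\<close>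
    is constant on \<open>V\<close> and so on its hull.\<close>
  define u where "u i = (\<Sum>v\<in>V. \<lfloor>v $ i\<rfloor>)" for i
  have u: "real_of_int (\<Sum>i\<in>S. u i) = (\<Sum>v\<in>V. v \<bullet> e_vec S)" for S
  proof -
    have "real_of_int (\<Sum>i\<in>S. u i) = (\<Sum>i\<in>S. \<Sum>v\<in>V. v $ i)"
      unfolding u_def of_int_sum
      by (intro sum.cong refl) (use subsetD[OF V(3)] in \<open>simp add: lattice_vectors_def\<close>)
    also have "\<dots> = (\<Sum>v\<in>V. v \<bullet> e_vec S)" unfolding inner_e_vec by (rule sum.swap)
    finally show ?thesis .
  qed
  have val: "real_of_int (int (card V) * f S + (\<Sum>i\<in>S. u i)) = (\<Sum>v\<in>V. v \<bullet> e_vec S - min_on ?Q S)" for S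
    by (simp add: u support_fn_eq sum_subtractf del: of_int_sum)
  have ge: "0 \<le> v \<bullet> e_vec S - min_on ?Q S" if "v \<in> V" for v S
    using min_on_le[OF lattice_polytope_centered VQ[OF that], of S] by simp
  show thesis
  proof (rule that)
    have "(\<Sum>v\<in>V. v \<bullet> e_vec UNIV) = 0"
      by (intro sum.neutral ballI centered_inner_UNIV VQ)
    then have "real_of_int (\<Sum>i\<in>UNIV. u i) = 0" unfolding u .
    then show "(\<Sum>i\<in>UNIV. u i) = 0" by (simp only: of_int_eq_0_iff)
    show nonneg: "0 \<le> int (card V) * f S + (\<Sum>i\<in>S. u i)" for S
    proof -
      have "0 \<le> (\<Sum>v\<in>V. v \<bullet> e_vec S - min_on ?Q S)" by (intro sum_nonneg ge)
      then show ?thesis unfolding val[symmetric] by (simp only: of_int_0_le_iff)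
    qed
    show "1 \<le> int (card V) * f S + (\<Sum>i\<in>S. u i)" if ex: "\<exists>x\<in>P. \<exists>y\<in>P. x \<bullet> e_vec S \<noteq> y \<bullet> e_vec S" for S
    proof (rule ccontr)
      assume "\<not> ?thesis"
      then have "int (card V) * f S + (\<Sum>i\<in>S. u i) = 0" using nonneg[of S] by simp
      then have "(\<Sum>v\<in>V. v \<bullet> e_vec S - min_on ?Q S) = 0" using val[of S] by simp
      then have V0: "v \<bullet> e_vec S = min_on ?Q S" if "v \<in> V" for v
        using sum_nonneg_eq_0_iff[of V "\<lambda>v. v \<bullet> e_vec S - min_on ?Q S"] V(1) ge that by auto
      have Vs: "V \<subseteq> {x. e_vec S \<bullet> x = min_on ?Q S}" using V0 by (auto simp: inner_commute)
      have const: "(t + x) \<bullet> e_vec S = min_on ?Q S" if "x \<in> P" for x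
      proof -
        have "t + x \<in> convex hull V" using that V(4) by blast
        then have "t + x \<in> {x. e_vec S \<bullet> x = min_on ?Q S}"
          using hull_minimal[where S = convex, OF Vs convex_hyperplane] by blast
        then show ?thesis unfolding inner_commute[of "t + x"] mem_Collect_eq .
      qed
      obtain x y where "x \<in> P" "y \<in> P" "x \<bullet> e_vec S \<noteq> y \<bullet> e_vec S" using ex by blast
      then show False using const[of x] const[of y] by (simp add: inner_add_left)
    qed
  qed
qed

end

section \<open>Submodular functions and chains\<close>

text \<open>The largest member of a finite chain contains all the others and is still proper in
  \<open>X\<close>.\<close>

lemma chain_avoids_point:
  assumes "finite \<C>" "\<And>F G. F \<in> \<C> \<Longrightarrow> G \<in> \<C> \<Longrightarrow> F \<subseteq> G \<or> G \<subseteq> F"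
    "\<And>F. F \<in> \<C> \<Longrightarrow> F \<subset> X" "X \<noteq> {}"
  shows "\<exists>x\<in>X. \<forall>F\<in>\<C>. x \<notin> F"
proof (cases "\<C> = {}")
  case False
  then obtain M where M: "M \<in> \<C>" "\<And>F. F \<in> \<C> \<Longrightarrow> M \<subseteq> F \<Longrightarrow> M = F"
    using finite_has_maximal[OF assms(1)] by metis
  then obtain x where "x \<in> X" "x \<notin> M" using assms(3) by blast
  moreover have "F \<subseteq> M" if "F \<in> \<C>" for F using assms(2)[OF that M(1)] M(2)[OF that] by blast
  ultimately show ?thesis by blast
qed (use assms(4) in blast)

text \<open>Edmonds' greedy algorithm, run backwards: \<open>u\<close> is a vertex of the base
  polytope of \<open>f\<close> for an ordering in which the members of the chain are initial
  segments. The last point \<open>x\<close> avoids all proper members, and its weight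
  \<open>f X - f (X - {x})\<close> is at most \<open>f S - f (S - {x})\<close> for every
  \<open>S\<close> containing it.\<close>

lemma submodular_chain_minorant:
  fixes f :: "'a set \<Rightarrow> int"
  assumes sub: "\<And>S T. f (S \<union> T) + f (S \<inter> T) \<le> f S + f T" and f0: "f {} = 0"
    and X: "finite X" and C: "\<And>F. F \<in> \<C> \<Longrightarrow> F \<subseteq> X"
    and chain: "\<And>F G. F \<in> \<C> \<Longrightarrow> G \<in> \<C> \<Longrightarrow> F \<subseteq> G \<or> G \<subseteq> F"
  shows "\<exists>u. (\<forall>S\<subseteq>X. sum u S \<le> f S) \<and> (\<forall>F\<in>\<C>. sum u F = f F) \<and> sum u X = f X"
  using X C chain
proof (induction X arbitrary: \<C> rule: finite_psubset_induct)
  case (psubset X)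
  show ?case
  proof (cases "X = {}")
    case True
    then show ?thesis using psubset.prems(1) f0 by (intro exI[of _ "\<lambda>_. 0"]) auto
  next
    case False
    have finC: "finite (\<C> - {X})"
    proof (rule finite_subset)
      show "\<C> - {X} \<subseteq> Pow X" using psubset.prems(1) by blast
      show "finite (Pow X)" using psubset.hyps by simp
    qed
    have chain': "F \<subseteq> G \<or> G \<subseteq> F" if "F \<in> \<C> - {X}" "G \<in> \<C> - {X}" for F G
      using psubset.prems(2)[of F G] that by blast
    have sub': "F \<subset> X" if "F \<in> \<C> - {X}" for F using psubset.prems(1)[of F] that by blast
    obtain x where x: "x \<in> X" "\<And>F. F \<in> \<C> - {X} \<Longrightarrow> x \<notin> F"
      using chain_avoids_point[OF finC chain' sub' False] by blast
    have "\<exists>u. (\<forall>S\<subseteq>X - {x}. sum u S \<le> f S) \<and> (\<forall>F\<in>\<C> - {X}. sum u F = f F) \<and> sum u (X - {x}) = f (X - {x})"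
    proof (rule psubset.IH)
      show "X - {x} \<subset> X" using x(1) by blast
      show "F \<subseteq> X - {x}" if "F \<in> \<C> - {X}" for F using sub'[OF that] x(2)[OF that] by blast
    qed (rule chain')
    then obtain u where u: "\<And>S. S \<subseteq> X - {x} \<Longrightarrow> sum u S \<le> f S" "\<And>F. F \<in> \<C> - {X} \<Longrightarrow> sum u F = f F"
      "sum u (X - {x}) = f (X - {x})" by blast
    define u' where "u' = u(x := f X - f (X - {x}))"
    have outside: "sum u' S = sum u S" if "x \<notin> S" for S
      using that by (intro sum.cong) (auto simp: u'_def)
    have inside: "sum u' S = sum u (S - {x}) + f X - f (X - {x})" if "x \<in> S" "S \<subseteq> X" for S
    proof -
      have "finite S" using that psubset.hyps finite_subset by blast
      then show ?thesis using sum.remove[of S x u'] that outside[of "S - {x}"] by (simp add: u'_def)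
    qed
    have le: "sum u' S \<le> f S" if "S \<subseteq> X" for S
    proof (cases "x \<in> S")
      case True
      have "S \<union> (X - {x}) = X" "S \<inter> (X - {x}) = S - {x}" using True that x by auto
      then have "f X + f (S - {x}) \<le> f S + f (X - {x})" using sub[of S "X - {x}"] by simp
      moreover have "sum u (S - {x}) \<le> f (S - {x})" using that by (intro u(1)) auto
      ultimately show ?thesis using inside[OF True that] by simp
    next
      case False
      then show ?thesis using outside[OF False] u(1)[of S] that by auto
    qed
    have X': "sum u' X = f X" using inside[OF x(1)] u(3) by simp
    have "sum u' F = f F" if "F \<in> \<C>" for F
      using X' outside[of F] x(2)[of F] u(2)[of F] that by (cases "F = X") auto
    then show ?thesis using le X' by (intro exI[of _ u']) simp
  qed
qed


section \<open>A maximal vector in the Dilworth truncation\<close>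

context loopless_matroid
begin

text \<open>The function \<open>J \<mapsto> r (\<Union>J) - 1\<close> on nonempty sets of blocks is
  submodular only on intersecting pairs. A vector below it of maximal sum is a basis of the Dilworth
  truncation, and \<open>\<T>\<close> certifies its maximality.\<close>

lemma dilworth_vector:
  assumes \<P>: "partition_on UNIV \<P>"
  obtains a :: "'n set \<Rightarrow> nat" and \<T>
  where "\<And>J. J \<subseteq> \<P> \<Longrightarrow> J \<noteq> {} \<Longrightarrow> sum a J < r (\<Union>J)"
    and "refines UNIV \<P> \<T>" and "sum a \<P> = (\<Sum>T\<in>\<T>. r T - 1)"
proof -
  define feas where "feas a \<longleftrightarrow> (\<forall>J. J \<subseteq> \<P> \<longrightarrow> J \<noteq> {} \<longrightarrow> sum a J < r (\<Union>J))" for a :: "'n set \<Rightarrow> nat"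
  have ne: "X \<noteq> {}" if "X \<in> \<P>" for X using \<P> that by (auto simp: partition_on_def)
  have UN: "\<Union>\<P> = UNIV" using \<P> by (auto simp: partition_on_def)
  have neP: "\<P> \<noteq> {}" using UN by auto
  have disj: "X = Y" if "X \<in> \<P>" "Y \<in> \<P>" "x \<in> X" "x \<in> Y" for X Y x
    using \<P> that unfolding partition_on_def disjoint_def by blast
  have "feas (\<lambda>_. 0)" unfolding feas_def using ne by (auto intro!: rk_pos)
  moreover have "sum a \<P> < r UNIV" if "feas a" for a
    using that neP UN by (auto simp: feas_def)
  ultimately obtain a where a: "feas a" and max: "\<And>b. feas b \<Longrightarrow> sum b \<P> \<le> sum a \<P>"
    using ex_has_greatest_nat[of feas "\<lambda>_. 0" "\<lambda>a. sum a \<P>" "r UNIV"] by (metis less_imp_le)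
  have feasD: "sum a J < r (\<Union>J)" if "J \<subseteq> \<P>" "J \<noteq> {}" for J
    using a that unfolding feas_def by blast
  define tight where "tight J \<longleftrightarrow> J \<subseteq> \<P> \<and> J \<noteq> {} \<and> r (\<Union>J) = Suc (sum a J)" for J
  have tightI: "tight J" if "J \<subseteq> \<P>" "J \<noteq> {}" "r (\<Union>J) \<le> Suc (sum a J)" for J
    using feasD[OF that(1,2)] that unfolding tight_def by simp
  have cover: "\<exists>J. tight J \<and> X \<in> J" if X: "X \<in> \<P>" for X
  proof -
    \<comment> \<open>By maximality raising \<open>a X\<close> violates some constraint; the
      violated set must contain \<open>X\<close>, and a violation by one unit means that it was
      tight.\<close>
    have "\<not> feas (a(X := Suc (a X)))"
    proof
      assume "feas (a(X := Suc (a X)))"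
      from max[OF this] show False using X by (simp add: sum.remove[of \<P> X])
    qed
    then obtain J where J: "J \<subseteq> \<P>" "J \<noteq> {}" "r (\<Union>J) \<le> sum (a(X := Suc (a X))) J"
      by (auto simp: feas_def not_less)
    show ?thesis
    proof (cases "X \<in> J")
      case True
      then have "sum (a(X := Suc (a X))) J = Suc (sum a J)" by (simp add: sum.remove[of J X])
      then show ?thesis using tightI[of J] J True by auto
    next
      case False
      then have "sum (a(X := Suc (a X))) J = sum a J" by (intro sum.cong) auto
      then show ?thesis using feasD[OF J(1,2)] J(3) by simp
    qed
  qed
  \<comment> \<open>A common block is essential: the strict constraint on
    \<open>J \<inter> K\<close> exists only if this is nonempty, and it compensates the second
    \<open>- 1\<close>.\<close>
  have tight_Un: "tight (J \<union> K)" if J: "tight J" and K: "tight K" and JK: "J \<inter> K \<noteq> {}" for J K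
  proof (rule tightI)
    have "sum a (J \<inter> K) < r (\<Union>(J \<inter> K))" using J JK by (intro feasD) (auto simp: tight_def)
    also have "\<dots> \<le> r (\<Union>J \<inter> \<Union>K)" by (intro rk_mono) auto
    finally have 1: "sum a (J \<inter> K) < r (\<Union>J \<inter> \<Union>K)" .
    have 2: "r (\<Union>(J \<union> K)) + r (\<Union>J \<inter> \<Union>K) \<le> r (\<Union>J) + r (\<Union>K)"
      using rk_submodular[of "\<Union>J" "\<Union>K"] by simp
    have "sum a (J \<union> K) + sum a (J \<inter> K) = sum a J + sum a K" by (rule sum.union_inter) auto
    then show "r (\<Union>(J \<union> K)) \<le> Suc (sum a (J \<union> K))" using 1 2 J K by (simp add: tight_def)
  qed (use J K in \<open>auto simp: tight_def\<close>)
  define \<M> where "\<M> = {J. tight J \<and> (\<forall>K. tight K \<longrightarrow> J \<subseteq> K \<longrightarrow> J = K)}"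
  have M_disj: "J = K" if "J \<in> \<M>" "K \<in> \<M>" "J \<inter> K \<noteq> {}" for J K
    using that tight_Un[of J K] unfolding \<M>_def by blast
  have M_cover: "\<exists>J\<in>\<M>. X \<in> J" if X: "X \<in> \<P>" for X
  proof -
    obtain J where J: "tight J" "X \<in> J" using cover[OF X] by blast
    obtain M where M: "tight M" "J \<subseteq> M" "\<forall>K\<in>{K. tight K}. M \<subseteq> K \<longrightarrow> M = K"
      using finite_has_maximal2[of "{K. tight K}" J] J by auto
    then have "M \<in> \<M>" by (auto simp: \<M>_def)
    then show ?thesis using M J by auto
  qed
  have M_sub: "J \<subseteq> \<P>" "J \<noteq> {}" "r (\<Union>J) = Suc (sum a J)" if "J \<in> \<M>" for J
    using that by (auto simp: \<M>_def tight_def)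
  have Un_disj: "J = K" if JK: "J \<in> \<M>" "K \<in> \<M>" "x \<in> \<Union>J" "x \<in> \<Union>K" for J K x
  proof -
    obtain X Y where XY: "X \<in> J" "Y \<in> K" "x \<in> X" "x \<in> Y" using JK by blast
    then have "X = Y" using disj[of X Y x] M_sub(1)[OF JK(1)] M_sub(1)[OF JK(2)] by blast
    then show ?thesis using M_disj[OF JK(1,2)] XY by blast
  qed
  have Un_ne: "\<Union>J \<noteq> {}" if "J \<in> \<M>" for J using M_sub(1,2)[OF that] ne by blast
  define \<T> where "\<T> = \<Union> ` \<M>"
  have "refines UNIV \<P> \<T>"
    unfolding refines_def
  proof (intro conjI ballI)
    show "partition_on UNIV \<T>"
    proof (rule partition_onI)
      show "\<Union>\<T> = UNIV"
      proof -
        have "x \<in> \<Union>\<T>" for x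
        proof -
          obtain X where X: "x \<in> X" "X \<in> \<P>" using UN by (metis UNIV_I UnionE)
          from M_cover[OF X(2)] X(1) show ?thesis unfolding \<T>_def by blast
        qed
        then show ?thesis by blast
      qed
      show "disjnt p q" if pq: "p \<in> \<T>" "q \<in> \<T>" "p \<noteq> q" for p q
      proof -
        obtain J K where "p = \<Union>J" "q = \<Union>K" "J \<in> \<M>" "K \<in> \<M>" using pq by (auto simp: \<T>_def)
        then show ?thesis using Un_disj[of J K] pq(3) unfolding disjnt_iff by blast
      qed
      show "{} \<notin> \<T>" using Un_ne by (auto simp: \<T>_def)
    qed
    show "\<exists>Y\<in>\<T>. X \<subseteq> Y" if "X \<in> \<P>" for X using M_cover[OF that] by (auto simp: \<T>_def)
  qed (rule \<P>)
  moreover have "sum a \<P> = (\<Sum>T\<in>\<T>. r T - 1)"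
  proof -
    have inj: "inj_on \<Union> \<M>"
      using Un_disj Un_ne by (intro inj_onI) (metis all_not_in_conv)
    have "(\<Sum>T\<in>\<T>. r T - 1) = (\<Sum>J\<in>\<M>. r (\<Union>J) - 1)"
      unfolding \<T>_def by (rule sum.reindex_cong[OF inj refl refl])
    also have "\<dots> = (\<Sum>J\<in>\<M>. sum a J)" using M_sub by (intro sum.cong) auto
    also have "\<dots> = sum a (\<Union>\<M>)"
      using M_disj by (subst sum.Union_disjoint) auto
    also have "\<Union>\<M> = \<P>" using M_sub(1) M_cover by blast
    finally show ?thesis by simp
  qed
  ultimately show thesis using that[of a \<T>] a by (auto simp: feas_def)
qed

end

section \<open>The upper bound\<close>

context ring_ideal
begin

text \<open>A repeated factor \<open>y G\<close> is replaced, using a linear relation for a point \<open>i\<close> of \<open>G\<close> outside all smaller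
  factors and a point \<open>j\<close> outside \<open>G\<close> in all larger ones, by factors that do not occur yet. Iterating, only
  squarefree products remain, and those are too long to be supported on a chain.\<close>

lemma long_product_mem:
  fixes y :: "'b set \<Rightarrow> 'a"
  assumes fin: "finite \<G>" and sub: "\<And>G. G \<in> \<G> \<Longrightarrow> G \<noteq> {} \<and> G \<subset> T"
    and incomp: "\<And>G H. G \<in> \<G> \<Longrightarrow> H \<in> \<G> \<Longrightarrow> \<not> G \<subseteq> H \<Longrightarrow> \<not> H \<subseteq> G \<Longrightarrow> y G * y H \<in> I"
    and lin: "\<And>i j. i \<in> T \<Longrightarrow> j \<in> T \<Longrightarrow> sum y {G\<in>\<G>. i \<in> G} - sum y {G\<in>\<G>. j \<in> G} \<in> I"
    and short: "\<And>\<C>. \<C> \<subseteq> \<G> \<Longrightarrow> (\<And>F G. F \<in> \<C> \<Longrightarrow> G \<in> \<C> \<Longrightarrow> F \<subseteq> G \<or> G \<subseteq> F) \<Longrightarrow> card \<C> < k"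
    and M: "set_mset M \<subseteq> \<G>" "size M = k"
  shows "prod_mset (image_mset y M) \<in> I"
  using M
proof (induction "card \<G> - card (set_mset M)" arbitrary: M rule: less_induct)
  case less
  show ?case
  proof (cases "\<forall>F\<in>set_mset M. \<forall>G\<in>set_mset M. F \<subseteq> G \<or> G \<subseteq> F")
    case False
    then obtain F G where FG: "F \<in># M" "G \<in># M" "\<not> F \<subseteq> G" "\<not> G \<subseteq> F" by blast
    obtain M1 where M1: "M = add_mset F M1" using multi_member_split[OF FG(1)] by blast
    have "G \<in># M1" using FG M1 by auto
    then obtain M2 where M2: "M1 = add_mset G M2" using multi_member_split by metis
    have "y F * y G \<in> I" using incomp FG less.prems(1) by blast
    from mult_mem[OF this, of "prod_mset (image_mset y M2)"] show ?thesis
      by (simp add: M1 M2 mult.assoc)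
  next
    case True
    then have lt: "card (set_mset M) < size M"
      using short[of "set_mset M"] less.prems by simp
    have "\<exists>G\<in>#M. 2 \<le> count M G"
    proof (rule ccontr)
      assume neg: "\<not> (\<exists>G\<in>#M. 2 \<le> count M G)"
      have "size M = (\<Sum>G\<in>set_mset M. count M G)" by (rule size_multiset_overloaded_eq)
      also have "\<dots> \<le> (\<Sum>G\<in>set_mset M. 1)" by (rule sum_mono) (use neg in fastforce)
      finally show False using lt by simp
    qed
    then obtain G where G: "G \<in># M" "2 \<le> count M G" by blast
    obtain M1 where M1: "M = add_mset G M1" using multi_member_split[OF G(1)] by blast
    have "G \<in># M1" using G(2) M1 by (simp add: count_greater_zero_iff[symmetric] del: count_greater_zero_iff)
    then obtain M2 where M2: "M1 = add_mset G M2" using multi_member_split by metis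
    have MG: "M = add_mset G (add_mset G M2)" using M1 M2 by simp
    have G\<G>: "G \<in> \<G>" using less.prems(1) G(1) by blast
    have "\<exists>i\<in>G. \<forall>F\<in>{H \<in> set_mset M. H \<subset> G}. i \<notin> F"
    proof (rule chain_avoids_point)
      show "F \<subseteq> F' \<or> F' \<subseteq> F" if "F \<in> {H \<in> set_mset M. H \<subset> G}" "F' \<in> {H \<in> set_mset M. H \<subset> G}" for F F'
        using True that by simp
    qed (use sub[OF G\<G>] in auto)
    then obtain i where i: "i \<in> G" "\<And>H. H \<in># M \<Longrightarrow> H \<subset> G \<Longrightarrow> i \<notin> H" by blast
    have "\<exists>j\<in>T - G. \<forall>F\<in>(\<lambda>H. T - H) ` {H \<in> set_mset M. G \<subset> H}. j \<notin> F"
    proof (rule chain_avoids_point)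
      show "F \<subseteq> F' \<or> F' \<subseteq> F" if F: "F \<in> (\<lambda>H. T - H) ` {H \<in> set_mset M. G \<subset> H}"
        "F' \<in> (\<lambda>H. T - H) ` {H \<in> set_mset M. G \<subset> H}" for F F'
      proof -
        obtain H H' where H: "H \<in># M" "H' \<in># M" "F = T - H" "F' = T - H'" using F by blast
        then have "H \<subseteq> H' \<or> H' \<subseteq> H" using True by blast
        then show ?thesis using H by blast
      qed
      show "F \<subset> T - G" if F: "F \<in> (\<lambda>H. T - H) ` {H \<in> set_mset M. G \<subset> H}" for F
      proof -
        obtain H where H: "H \<in># M" "G \<subset> H" "F = T - H" using F by blast
        then have "H \<subset> T" using sub less.prems(1) by blast
        then show ?thesis using H by blast
      qed
    qed (use sub[OF G\<G>] in auto)
    then obtain j where j0: "j \<in> T - G" "\<forall>F\<in>(\<lambda>H. T - H) ` {H \<in> set_mset M. G \<subset> H}. j \<notin> F" ..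
    have j: "j \<in> T" "j \<notin> G" using j0(1) by auto
    have j': "j \<in> H" if "H \<in># M" "G \<subset> H" for H using j0(2) j(1) that by auto
    define A where "A = {H\<in>\<G>. i \<in> H \<and> j \<notin> H \<and> H \<noteq> G}"
    define B where "B = {H\<in>\<G>. i \<in> H \<and> j \<in> H}"
    define D where "D = {H\<in>\<G>. i \<notin> H \<and> j \<in> H}"
    have "A \<subseteq> \<G>" "B \<subseteq> \<G>" "D \<subseteq> \<G>" unfolding A_def B_def D_def by blast+
    then have fABD: "finite A" "finite B" "finite D" by (auto intro: finite_subset[OF _ fin])
    have Si: "sum y {H\<in>\<G>. i \<in> H} = y G + (sum y A + sum y B)"
    proof -
      have "{H\<in>\<G>. i \<in> H} = insert G (A \<union> B)" using G\<G> i(1) j(2) unfolding A_def B_def by blast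
      moreover have "G \<notin> A \<union> B" "A \<inter> B = {}" using j by (auto simp: A_def B_def)
      ultimately show ?thesis using fABD by (simp add: sum.union_disjoint)
    qed
    have Sj: "sum y {H\<in>\<G>. j \<in> H} = sum y B + sum y D"
    proof -
      have "{H\<in>\<G>. j \<in> H} = B \<union> D" by (auto simp: B_def D_def)
      moreover have "B \<inter> D = {}" by (auto simp: B_def D_def)
      ultimately show ?thesis using fABD by (simp add: sum.union_disjoint)
    qed
    define R where "R = y G * prod_mset (image_mset y M2)"
    have "i \<in> T" using i(1) sub[OF G\<G>] by blast
    from lin[OF this j(1)] have "(y G + sum y A - sum y D) * R \<in> I"
      unfolding Si Sj by (intro mult_mem) (simp add: algebra_simps)
    moreover have "sum y A * R \<in> I"
      unfolding sum_distrib_right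
    proof (rule sum_mem)
      fix H assume H: "H \<in> A"
      have "H \<notin># M"
      proof
        assume HM: "H \<in># M"
        then have "H \<subset> G \<or> G \<subset> H" using True G(1) H by (auto simp: A_def)
        then show False using i(2)[OF HM] j'[OF HM] H by (auto simp: A_def)
      qed
      then have s: "set_mset M \<subset> set_mset (add_mset H (add_mset G M2))" using MG by auto
      have H\<G>: "set_mset (add_mset H (add_mset G M2)) \<subseteq> \<G>" using H less.prems(1) MG by (auto simp: A_def)
      have "card (set_mset M) < card (set_mset (add_mset H (add_mset G M2)))"
        by (intro psubset_card_mono s) simp
      moreover have "card (set_mset (add_mset H (add_mset G M2))) \<le> card \<G>"
        by (intro card_mono fin H\<G>)
      ultimately have "card \<G> - card (set_mset (add_mset H (add_mset G M2))) < card \<G> - card (set_mset M)"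
        by linarith
      from less.hyps[OF this H\<G>] have "prod_mset (image_mset y (add_mset H (add_mset G M2))) \<in> I"
        using less.prems(2) MG by simp
      then show "y H * R \<in> I" by (simp add: R_def)
    qed
    moreover have "sum y D * R \<in> I"
      unfolding sum_distrib_right
    proof (rule sum_mem)
      fix H assume H: "H \<in> D"
      then have "y H * y G \<in> I" using i(1) j(2) by (intro incomp G\<G>) (auto simp: D_def)
      from mult_mem[OF this, of "prod_mset (image_mset y M2)"] show "y H * R \<in> I"
        by (simp add: R_def mult.assoc)
    qed
    ultimately have "(y G + sum y A - sum y D) * R - sum y A * R + sum y D * R \<in> I"
      by (intro add_mem diff_mem)
    then have "y G * R \<in> I" by (simp add: algebra_simps)
    then show ?thesis by (simp add: MG R_def)
  qed
qed

lemma power_combination_mem: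
  fixes y :: "'b \<Rightarrow> 'a"
  assumes prods: "\<And>M. set_mset M \<subseteq> \<G> \<Longrightarrow> size M = k \<Longrightarrow> prod_mset (image_mset y M) \<in> I"
  shows "(\<Sum>G\<in>\<G>. a G * y G) ^ k \<in> I"
proof -
  let ?c = "\<Sum>G\<in>\<G>. a G * y G"
  \<comment> \<open>The power is expanded one factor at a time: \<open>M\<close> collects the
    factors already chosen and \<open>l\<close> counts those left.\<close>
  have "?c ^ l * prod_mset (image_mset y M) \<in> I" if "set_mset M \<subseteq> \<G>" "size M + l = k" for l M
    using that
  proof (induction l arbitrary: M)
    case 0
    then show ?case using prods by simp
  next
    case (Suc l)
    have "?c ^ Suc l * prod_mset (image_mset y M) =
        (\<Sum>G\<in>\<G>. a G * (?c ^ l * prod_mset (image_mset y (add_mset G M))))"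
      by (simp add: sum_distrib_left sum_distrib_right mult_ac)
    also have "\<dots> \<in> I"
      by (intro sum_mem mult_mem' Suc.IH) (use Suc.prems in auto)
    finally show ?case .
  qed
  from this[of "{#}" k] show ?thesis by simp
qed

end


text \<open>Elements satisfying the Chow relations modulo \<open>I\<close>, with two instances
  below: the variables with the preimage of the Chow ideal, and the rays with the kernel ideal of
  the degree functional. Indexing by all sets lets sums run over \<open>UNIV\<close>.\<close>

locale chow_elements = loopless_matroid \<B> + ring_ideal I
  for \<B> :: "'n::finite set set" and I :: "'a::comm_ring_1 set" +
  fixes x :: "'n set \<Rightarrow> 'a"
  assumes x_outside: "S \<notin> proper_flats \<B> \<Longrightarrow> x S \<in> I"
    and x_incomparable: "\<not> S \<subseteq> T \<Longrightarrow> \<not> T \<subseteq> S \<Longrightarrow> x S * x T \<in> I"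
    and x_linear: "(\<Sum>S\<in>{S. i \<in> S}. x S) - (\<Sum>S\<in>{S. j \<in> S}. x S) \<in> I"
begin

text \<open>The divisor of the piecewise linear function on the fan with value \<open>f S\<close> at
  the ray of \<open>S\<close>.\<close>

definition dv :: "('n set \<Rightarrow> int) \<Rightarrow> 'a" where
  "dv f = (\<Sum>S\<in>UNIV. of_int (f S) * x S)"

lemma dv_diff: "dv (\<lambda>S. f S - g S) = dv f - dv g"
  by (simp add: dv_def left_diff_distrib sum_subtractf)

lemma dv_sum: "dv (\<lambda>S. \<Sum>a\<in>A. f a S) = (\<Sum>a\<in>A. dv (f a))"
  by (simp add: dv_def sum_distrib_right sum.swap[of _ A])

lemma dv_scale: "dv (\<lambda>S. c * f S) = of_int c * dv f"
  by (simp add: dv_def sum_distrib_left mult.assoc)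

text \<open>Linear functions have principal divisors: as the \<open>u i\<close> sum to zero, the
  class is a combination of the linear relations against one arbitrary fixed
  \<open>j\<close>.\<close>

lemma dv_modular_mem:
  assumes "(\<Sum>i\<in>UNIV. u i) = 0"
  shows "dv (\<lambda>S. \<Sum>i\<in>S. u i) \<in> I"
proof -
  define X where "X i = (\<Sum>S\<in>{S. i \<in> S}. x S)" for i
  obtain j :: 'n where True by simp
  have "dv (\<lambda>S. \<Sum>i\<in>S. u i) = (\<Sum>S\<in>UNIV. \<Sum>i\<in>UNIV. if i \<in> S then of_int (u i) * x S else 0)"
    unfolding dv_def by (intro sum.cong refl) (simp add: sum_distrib_right sum.If_cases)
  also have "\<dots> = (\<Sum>i\<in>UNIV. of_int (u i) * X i)"
    by (subst sum.swap) (simp add: X_def sum_distrib_left sum.If_cases)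
  also have "\<dots> = (\<Sum>i\<in>UNIV. of_int (u i) * (X i - X j)) + of_int (\<Sum>i\<in>UNIV. u i) * X j"
    by (simp add: right_diff_distrib sum_subtractf sum_distrib_right)
  also have "\<dots> = (\<Sum>i\<in>UNIV. of_int (u i) * (X i - X j))" using assms by simp
  also have "\<dots> \<in> I" using x_linear unfolding X_def by (intro sum_mem mult_mem')
  finally show ?thesis .
qed

text \<open>Grouping flats by their trace on \<open>T\<close> gives \<open>y G\<close>, the pullback
  of the variable of a flat \<open>G\<close> of the restriction to \<open>T\<close>. The conditions
  on \<open>g\<close> remove the traces \<open>{}\<close> and \<open>T\<close>, and a chain of the
  remaining traces has at most \<open>r T - 1\<close> members.\<close>

lemma restriction_power_mem:
  assumes T: "T \<noteq> {}" and g: "g {} = 0" "g T = 0"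
  shows "dv (\<lambda>S. g (S \<inter> T)) ^ r T \<in> I"
proof -
  define \<F> where "\<F> = proper_flats \<B>"
  define \<G> where "\<G> = (\<lambda>F. F \<inter> T) ` \<F> - {{}, T}"
  define y where "y G = (\<Sum>F\<in>{F\<in>\<F>. F \<inter> T = G}. x F)" for G
  have cong: "dv (\<lambda>S. g (S \<inter> T)) - (\<Sum>G\<in>\<G>. of_int (g G) * y G) \<in> I"
  proof -
    have "dv (\<lambda>S. g (S \<inter> T)) = (\<Sum>F\<in>\<F>. of_int (g (F \<inter> T)) * x F) + (\<Sum>F\<in>- \<F>. of_int (g (F \<inter> T)) * x F)"
      unfolding dv_def by (subst sum.union_disjoint[symmetric]) (auto simp: Un_commute)
    moreover have "(\<Sum>F\<in>- \<F>. of_int (g (F \<inter> T)) * x F) \<in> I"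
      using x_outside by (intro sum_mem mult_mem') (auto simp: \<F>_def)
    moreover have "(\<Sum>F\<in>\<F>. of_int (g (F \<inter> T)) * x F) = (\<Sum>G\<in>\<G>. of_int (g G) * y G)"
    proof -
      have "(\<Sum>F\<in>\<F>. of_int (g (F \<inter> T)) * x F) =
          (\<Sum>G\<in>(\<lambda>F. F \<inter> T) ` \<F>. \<Sum>F\<in>{F\<in>\<F>. F \<inter> T = G}. of_int (g (F \<inter> T)) * x F)"
        by (rule sum.group[symmetric]) auto
      also have "\<dots> = (\<Sum>G\<in>(\<lambda>F. F \<inter> T) ` \<F>. of_int (g G) * y G)"
        unfolding y_def sum_distrib_left by (intro sum.cong) auto
      also have "\<dots> = (\<Sum>G\<in>\<G>. of_int (g G) * y G)"
        unfolding \<G>_def using g by (intro sum.mono_neutral_right) auto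
      finally show ?thesis .
    qed
    ultimately show ?thesis by simp
  qed
  have flat: "flat \<B> F" if "F \<in> \<F>" for F using that by (simp add: \<F>_def proper_flats_def)
  have "(\<Sum>G\<in>\<G>. of_int (g G) * y G) ^ r T \<in> I"
  proof (rule power_combination_mem, rule long_product_mem[of \<G> T y])
    show "G \<noteq> {} \<and> G \<subset> T" if "G \<in> \<G>" for G using that by (auto simp: \<G>_def)
    show "y G * y H \<in> I" if "G \<in> \<G>" "H \<in> \<G>" "\<not> G \<subseteq> H" "\<not> H \<subseteq> G" for G H
      unfolding y_def sum_product using that(3,4) by (intro sum_mem x_incomparable) auto
    show "sum y {G\<in>\<G>. i \<in> G} - sum y {G\<in>\<G>. j \<in> G} \<in> I" if ij: "i \<in> T" "j \<in> T" for i j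
    proof -
      \<comment> \<open>The traces omit the flats containing \<open>T\<close>; their contribution is
        the same for all \<open>i \<in> T\<close> and cancels in the difference.\<close>
      have eq: "sum y {G\<in>\<G>. i \<in> G} = sum x {S. i \<in> S} - (sum x {F\<in>\<F>. T \<subseteq> F} + sum x {S. i \<in> S \<and> S \<notin> \<F>})"
        if "i \<in> T" for i
      proof -
        have "sum y {G\<in>\<G>. i \<in> G} = (\<Sum>G\<in>{G\<in>\<G>. i \<in> G}. \<Sum>F\<in>{F\<in>{F\<in>\<F>. i \<in> F \<and> \<not> T \<subseteq> F}. F \<inter> T = G}. x F)"
          unfolding y_def using that by (intro sum.cong) (auto simp: \<G>_def)
        also have "\<dots> = sum x {F\<in>\<F>. i \<in> F \<and> \<not> T \<subseteq> F}"
          using that by (intro sum.group) (auto simp: \<G>_def)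
        finally have "sum y {G\<in>\<G>. i \<in> G} = \<dots>" .
        moreover have "sum x {S. i \<in> S} = sum x {F\<in>\<F>. i \<in> F \<and> \<not> T \<subseteq> F} + (sum x {F\<in>\<F>. T \<subseteq> F} + sum x {S. i \<in> S \<and> S \<notin> \<F>})"
          using that by (subst sum.union_disjoint[symmetric]; (subst sum.union_disjoint[symmetric])?) (auto intro!: sum.cong)
        ultimately show ?thesis by simp
      qed
      have out: "sum x {S. i \<in> S \<and> S \<notin> \<F>} \<in> I" for i
        using x_outside by (intro sum_mem) (auto simp: \<F>_def)
      have mem: "(sum x {S. i \<in> S} - sum x {S. j \<in> S}) - sum x {S. i \<in> S \<and> S \<notin> \<F>} + sum x {S. j \<in> S \<and> S \<notin> \<F>} \<in> I"
        by (intro add_mem diff_mem out x_linear)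
      have "sum y {G\<in>\<G>. i \<in> G} - sum y {G\<in>\<G>. j \<in> G} =
          (sum x {S. i \<in> S} - sum x {S. j \<in> S}) - sum x {S. i \<in> S \<and> S \<notin> \<F>} + sum x {S. j \<in> S \<and> S \<notin> \<F>}"
        unfolding eq[OF ij(1)] eq[OF ij(2)] by (simp add: algebra_simps)
      then show ?thesis using mem by (simp only:)
    qed
    show "card \<C> < r T" if C: "\<C> \<subseteq> \<G>" and chain: "\<And>F G. F \<in> \<C> \<Longrightarrow> G \<in> \<C> \<Longrightarrow> F \<subseteq> G \<or> G \<subseteq> F" for \<C>
    proof -
      \<comment> \<open>The trace of a flat need not be a flat, but its closure stays inside
        \<open>F\<close>, so adding a point of \<open>T\<close> outside \<open>F\<close> raises the
        rank.\<close>
      have less: "r (F \<inter> T) < r H" if FH: "F \<in> \<F>" "F \<inter> T \<subset> H" "H \<subseteq> T" for F H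
      proof -
        obtain e where e: "e \<in> H" "e \<notin> F" using FH by blast
        have "e \<notin> cl (F \<inter> T)" using cl_subset_flat[OF flat[OF FH(1)], of "F \<inter> T"] e by blast
        then have "r (F \<inter> T) < r (insert e (F \<inter> T))" using mem_clI by (meson not_less)
        also have "\<dots> \<le> r H" using e FH by (intro rk_mono) auto
        finally show ?thesis .
      qed
      have rG: "r G < r H" if GH: "G \<in> \<G>" "G \<subset> H" "H \<subseteq> T" for G H
      proof -
        obtain F where "F \<in> \<F>" "G = F \<inter> T" using GH(1) by (auto simp: \<G>_def)
        then show ?thesis using less[of F H] GH by blast
      qed
      have "inj_on r \<C>"
      proof (rule inj_onI)
        fix G H assume GH: "G \<in> \<C>" "H \<in> \<C>" "r G = r H"
        have "G \<in> \<G>" "H \<in> \<G>" "G \<subseteq> T" "H \<subseteq> T" using GH C by (auto simp: \<G>_def)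
        then show "G = H" using chain[OF GH(1,2)] rG[of G H] rG[of H G] GH(3) by (metis less_irrefl psubsetI)
      qed
      moreover have "r ` \<C> \<subseteq> {1..<r T}"
      proof
        fix k assume "k \<in> r ` \<C>"
        then obtain G where G: "k = r G" "G \<in> \<G>" using C by blast
        then have "G \<noteq> {}" "G \<subset> T" by (auto simp: \<G>_def)
        then show "k \<in> {1..<r T}" using G rk_pos[of G] rG[of G T] by auto
      qed
      ultimately have "card \<C> \<le> card {1..<r T}" by (metis card_image card_mono finite_atLeastLessThan)
      then show ?thesis using rk_pos[OF T] by simp
    qed
  qed auto
  then show ?thesis using mem_cong[OF cong_power[OF cong]] by blast
qed

text \<open>The summand of \<open>T\<close> must vanish at \<open>T\<close> itself before
  \<open>restriction_power_mem\<close> applies, so \<open>f T\<close> is subtracted wherever a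
  chosen point \<open>p T\<close> is present. The corrections add up to a modular function of total
  \<open>f UNIV = 0\<close>, which does not change the class.\<close>

lemma dv_power_mem:
  assumes T: "partition_on UNIV \<T>" and f0: "f {} = 0" "f UNIV = 0"
    and split: "\<And>S. f S = (\<Sum>T\<in>\<T>. f (S \<inter> T))"
  shows "dv f ^ Suc (\<Sum>T\<in>\<T>. r T - 1) \<in> I"
proof -
  have ne: "T \<noteq> {}" if "T \<in> \<T>" for T using T that by (auto simp: partition_on_def)
  define p where "p T = (SOME i. i \<in> T)" for T :: "'n set"
  have p: "p T \<in> T" if "T \<in> \<T>" for T
    unfolding p_def using ne[OF that] by (simp add: some_in_eq)
  define g where "g T A = f A - (if p T \<in> A then f T else 0)" for T A
  define u where "u i = (\<Sum>T\<in>\<T>. if i = p T then f T else 0)" for i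
  have u: "(\<Sum>i\<in>S. u i) = (\<Sum>T\<in>\<T>. if p T \<in> S then f T else 0)" for S
    unfolding u_def by (subst sum.swap) (simp add: sum.delta)
  have "(\<Sum>i\<in>UNIV. u i) = 0" using split[of UNIV] f0 by (simp add: u)
  then have "dv (\<lambda>S. \<Sum>i\<in>S. u i) \<in> I" by (rule dv_modular_mem)
  moreover have "dv f - (\<Sum>T\<in>\<T>. dv (\<lambda>S. g T (S \<inter> T))) = dv (\<lambda>S. \<Sum>i\<in>S. u i)"
  proof -
    have "(\<Sum>i\<in>S. u i) = f S - (\<Sum>T\<in>\<T>. g T (S \<inter> T))" for S
      unfolding u g_def sum_subtractf split[of S] using p by (simp cong: sum.cong)
    then show ?thesis by (simp add: dv_diff dv_sum)
  qed
  ultimately have "dv f - (\<Sum>T\<in>\<T>. dv (\<lambda>S. g T (S \<inter> T))) \<in> I" by simp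
  moreover have "(\<Sum>T\<in>\<T>. dv (\<lambda>S. g T (S \<inter> T))) ^ Suc (\<Sum>T\<in>\<T>. r T - 1) \<in> I"
  proof (rule power_sum_mem)
    fix T assume "T \<in> \<T>"
    then have "dv (\<lambda>S. g T (S \<inter> T)) ^ r T \<in> I"
      using ne p f0 by (intro restriction_power_mem) (auto simp: g_def)
    then show "dv (\<lambda>S. g T (S \<inter> T)) ^ Suc (r T - 1) \<in> I" using rk_pos[OF ne[OF \<open>T \<in> \<T>\<close>]] by simp
  qed simp
  ultimately show ?thesis using mem_cong[OF cong_power] by blast
qed

end

section \<open>Linear functionals and substitutions on polynomials\<close>

definition lin_ext :: "('m \<Rightarrow> 'r::comm_ring_1) \<Rightarrow> ('m \<Rightarrow>\<^sub>0 int) \<Rightarrow> 'r" where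
  "lin_ext v p = (\<Sum>m\<in>Poly_Mapping.keys p. of_int (Poly_Mapping.lookup p m) * v m)"

lemma lin_ext_superset:
  assumes "finite A" "Poly_Mapping.keys p \<subseteq> A"
  shows "lin_ext v p = (\<Sum>m\<in>A. of_int (Poly_Mapping.lookup p m) * v m)"
  unfolding lin_ext_def using assms by (intro sum.mono_neutral_left) (auto simp: in_keys_iff)

lemma lin_ext_zero: "lin_ext v 0 = 0"
  by (simp add: lin_ext_def)

lemma lin_ext_add: "lin_ext v (p + q) = lin_ext v p + lin_ext v q"
proof -
  let ?A = "Poly_Mapping.keys p \<union> Poly_Mapping.keys q"
  have "lin_ext v (p + q) = (\<Sum>m\<in>?A. of_int (Poly_Mapping.lookup (p + q) m) * v m)"
    by (rule lin_ext_superset) (auto dest: subsetD[OF Poly_Mapping.keys_add])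
  also have "\<dots> = lin_ext v p + lin_ext v q"
    by (simp add: lin_ext_superset[of ?A] lookup_add distrib_right sum.distrib)
  finally show ?thesis .
qed

lemma lin_ext_single: "lin_ext v (Poly_Mapping.single m c) = of_int c * v m"
  by (subst lin_ext_superset[of "{m}"]) auto

lemma lin_ext_sum: "lin_ext v (\<Sum>a\<in>A. f a) = (\<Sum>a\<in>A. lin_ext v (f a))"
  by (induction A rule: infinite_finite_induct) (simp_all add: lin_ext_zero lin_ext_add)

lemma poly_sum_singles:
  fixes p :: "'m \<Rightarrow>\<^sub>0 int"
  shows "p = (\<Sum>m\<in>Poly_Mapping.keys p. Poly_Mapping.single m (Poly_Mapping.lookup p m))"
proof (rule poly_mapping_eqI)
  fix k
  have "Poly_Mapping.lookup (\<Sum>m\<in>Poly_Mapping.keys p. Poly_Mapping.single m (Poly_Mapping.lookup p m)) k =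
      (\<Sum>m\<in>Poly_Mapping.keys p. if m = k then Poly_Mapping.lookup p m else 0)"
    unfolding lookup_sum by (intro sum.cong) (auto simp: lookup_single when_def)
  also have "\<dots> = Poly_Mapping.lookup p k" by (auto simp: sum.delta' in_keys_iff)
  finally show "Poly_Mapping.lookup p k =
    Poly_Mapping.lookup (\<Sum>m\<in>Poly_Mapping.keys p. Poly_Mapping.single m (Poly_Mapping.lookup p m)) k" ..
qed

lemma poly_induct [case_names zero single add]:
  fixes p :: "'m \<Rightarrow>\<^sub>0 int"
  assumes "P 0" "\<And>m c. P (Poly_Mapping.single m c)" "\<And>p q. P p \<Longrightarrow> P q \<Longrightarrow> P (p + q)"
  shows "P p"
proof -
  have "P (\<Sum>m\<in>A. Poly_Mapping.single m (Poly_Mapping.lookup p m))" for A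
    by (induction A rule: infinite_finite_induct) (use assms in auto)
  then show ?thesis using poly_sum_singles[of p] by metis
qed

lemma lin_ext_scale:
  fixes p :: "'n cpoly"
  shows "lin_ext v (of_int c * p) = of_int c * lin_ext v p"
proof (induction p rule: poly_induct)
  case (single m d)
  have "of_int c * Poly_Mapping.single m d = (Poly_Mapping.single m (c * d) :: 'n cpoly)"
    by (simp add: mult_single flip: single_of_int)
  then show ?case by (simp add: lin_ext_single mult.assoc)
qed (simp_all add: lin_ext_zero lin_ext_add distrib_left)

lemma lin_ext_diff:
  fixes p q :: "'n cpoly"
  shows "lin_ext v (p - q) = lin_ext v p - lin_ext v q"
  using lin_ext_add[of v p "of_int (- 1) * q"] lin_ext_scale[of v "- 1" q] by simp

definition insertion :: "('n::finite set \<Rightarrow> 'r::comm_ring_1) \<Rightarrow> 'n cpoly \<Rightarrow> 'r" where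
  "insertion q = lin_ext (\<lambda>m. \<Prod>S\<in>UNIV. q S ^ Poly_Mapping.lookup m S)"

lemma insertion_add: "insertion q (p + p') = insertion q p + insertion q p'"
  by (simp add: insertion_def lin_ext_add)

lemma insertion_diff: "insertion q (p - p') = insertion q p - insertion q p'"
  by (simp add: insertion_def lin_ext_diff)

lemma insertion_sum: "insertion q (\<Sum>a\<in>A. f a) = (\<Sum>a\<in>A. insertion q (f a))"
  by (simp add: insertion_def lin_ext_sum)

lemma insertion_scale: "insertion q (of_int c * p) = of_int c * insertion q p"
  by (simp add: insertion_def lin_ext_scale)

lemma insertion_mult: "insertion q (p * p') = insertion q p * insertion q p'"
proof (induction p rule: poly_induct)
  case (single m c)
  show ?case
  proof (induction p' rule: poly_induct)
    case (single m' c')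
    show ?case
      by (simp add: insertion_def mult_single lin_ext_single lookup_add power_add prod.distrib mult_ac)
  qed (simp_all add: insertion_def lin_ext_zero lin_ext_add distrib_left)
qed (simp_all add: insertion_def lin_ext_zero lin_ext_add distrib_right)

lemma insertion_one: "insertion q 1 = 1"
  using lin_ext_single[of "\<lambda>m. \<Prod>S\<in>UNIV. q S ^ Poly_Mapping.lookup m S" 0 1] by (simp add: insertion_def)

lemma insertion_power: "insertion q (p ^ k) = insertion q p ^ k"
  by (induction k) (simp_all add: insertion_one insertion_mult)

lemma insertion_xvar: "insertion q (xvar S) = q S"
proof -
  have "(\<Prod>T\<in>UNIV. q T ^ Poly_Mapping.lookup (Poly_Mapping.single S (1::nat)) T) = (\<Prod>T\<in>UNIV. if T = S then q T else 1)"
    by (intro prod.cong) (auto simp: lookup_single when_def)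
  then show ?thesis by (simp add: insertion_def xvar_def lin_ext_single)
qed

lemma sum_Pow_alternating:
  assumes "finite Y"
  shows "(\<Sum>X\<in>Pow Y. (- 1) ^ card X) = (of_bool (Y = {}) :: 'r::comm_ring_1)"
  using assms
proof (induction Y)
  case (insert a Y)
  have "(\<Sum>X\<in>insert a ` Pow Y. (- 1) ^ card X) = (\<Sum>X\<in>Pow Y. (- 1) ^ card (insert a X) :: 'r)"
    using insert.hyps by (subst sum.reindex) (auto simp: inj_on_def)
  also have "\<dots> = (\<Sum>X\<in>Pow Y. - ((- 1) ^ card X))"
  proof (intro sum.cong refl)
    fix X assume "X \<in> Pow Y"
    then have "a \<notin> X" "finite X" using insert.hyps finite_subset by auto
    then show "(- 1) ^ card (insert a X) = - ((- 1) ^ card X :: 'r)" by simp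
  qed
  finally have "(\<Sum>X\<in>insert a ` Pow Y. (- 1) ^ card X) = - (\<Sum>X\<in>Pow Y. (- 1) ^ card X :: 'r)"
    by (simp add: sum_negf)
  moreover have "Pow Y \<inter> insert a ` Pow Y = {}" using insert.hyps by auto
  ultimately show ?case using insert.hyps by (simp add: Pow_insert sum.union_disjoint)
qed simp


section \<open>The degree functional\<close>

context loopless_matroid
begin

text \<open>In terms of the classes \<open>h S\<close> of simplices, which the polynomial variables \<open>xvar S\<close> stand for in
  this section, the degree of a monomial is given by the dragon Hall-Rado condition: it is one if for
  each flat \<open>A\<close> either no factor or fewer than \<open>r A\<close> factors are indexed by subsets of \<open>A\<close>, and zero otherwise.\<close>

definition num_below :: "('n set \<Rightarrow>\<^sub>0 nat) \<Rightarrow> 'n set \<Rightarrow> nat" where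
  "num_below m A = (\<Sum>F\<in>Pow A. Poly_Mapping.lookup m F)"

definition dragon :: "('n set \<Rightarrow>\<^sub>0 nat) \<Rightarrow> bool" where
  "dragon m \<longleftrightarrow> (\<forall>A. flat \<B> A \<longrightarrow> 0 < num_below m A \<longrightarrow> num_below m A < r A)"

text \<open>Not homogeneous: on a monomial of degree below \<open>r UNIV - 1\<close> this is the
  value after filling up with factors \<open>xvar UNIV\<close>.\<close>

definition deg :: "'n cpoly \<Rightarrow> int" where
  "deg = lin_ext (\<lambda>m. of_bool (dragon m))"

text \<open>The largest ideal on which the linear functional \<open>deg\<close> vanishes.\<close>

definition deg_kernel :: "'n cpoly set" where
  "deg_kernel = {p. \<forall>y. deg (p * y) = 0}"

lemma deg_add: "deg (p + q) = deg p + deg q"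
  by (simp add: deg_def lin_ext_add)

lemma deg_diff: "deg (p - q) = deg p - deg q"
  by (simp add: deg_def lin_ext_diff)

lemma deg_sum: "deg (\<Sum>a\<in>A. f a) = (\<Sum>a\<in>A. deg (f a))"
  by (simp add: deg_def lin_ext_sum)

lemma deg_scale: "deg (of_int c * p) = c * deg p"
  by (simp add: deg_def lin_ext_scale)

lemma deg_single: "deg (Poly_Mapping.single m 1) = of_bool (dragon m)"
  by (simp add: deg_def lin_ext_single)

sublocale deg_kernel: ring_ideal deg_kernel
proof
  show "0 \<in> deg_kernel" by (simp add: deg_kernel_def deg_def lin_ext_zero)
  show "p + q \<in> deg_kernel" if "p \<in> deg_kernel" "q \<in> deg_kernel" for p q
    using that by (simp add: deg_kernel_def distrib_right deg_add)
  show "p * q \<in> deg_kernel" if "p \<in> deg_kernel" for p q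
    using that by (simp add: deg_kernel_def mult.assoc)
qed

lemma deg_kernelD: "p \<in> deg_kernel \<Longrightarrow> deg p = 0"
  unfolding deg_kernel_def by (metis (mono_tags) mem_Collect_eq mult.right_neutral)

lemma deg_cong: "p - q \<in> deg_kernel \<Longrightarrow> deg p = deg q"
  using deg_kernelD[of "p - q"] by (simp add: deg_diff)

lemma deg_kernelI:
  assumes "\<And>m. deg (p * Poly_Mapping.single m 1) = 0"
  shows "p \<in> deg_kernel"
proof -
  have "deg (p * y) = 0" for y
  proof (induction y rule: poly_induct)
    case (single m c)
    have "p * Poly_Mapping.single m c = of_int c * (p * Poly_Mapping.single m 1)"
    proof -
      have "Poly_Mapping.single m c = of_int c * (Poly_Mapping.single m 1 :: 'n cpoly)"
        by (simp add: mult_single flip: single_of_int)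
      then show ?thesis by (simp add: mult_ac)
    qed
    then show ?case using assms by (simp add: deg_scale)
  qed (simp_all add: deg_def lin_ext_zero lin_ext_add distrib_left)
  then show ?thesis by (simp add: deg_kernel_def)
qed

lemma num_below_add: "num_below (m + m') A = num_below m A + num_below m' A"
  by (simp add: num_below_def lookup_add sum.distrib)

lemma num_below_single: "num_below (Poly_Mapping.single S (Suc 0)) A = of_bool (S \<subseteq> A)"
proof -
  have "num_below (Poly_Mapping.single S (Suc 0)) A = (\<Sum>F\<in>Pow A. if F = S then 1 else 0)"
    unfolding num_below_def by (intro sum.cong) (auto simp: lookup_single when_def)
  then show ?thesis by simp
qed

lemma num_below_mono: "A \<subseteq> B \<Longrightarrow> num_below m A \<le> num_below m B"
  unfolding num_below_def by (intro sum_mono2) auto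

lemma num_below_supermodular: "num_below m A + num_below m B \<le> num_below m (A \<union> B) + num_below m (A \<inter> B)"
proof -
  have "num_below m A + num_below m B = (\<Sum>F\<in>Pow A \<union> Pow B. Poly_Mapping.lookup m F) + (\<Sum>F\<in>Pow A \<inter> Pow B. Poly_Mapping.lookup m F)"
    unfolding num_below_def by (rule sum.union_inter[symmetric]) auto
  also have "\<dots> \<le> num_below m (A \<union> B) + num_below m (A \<inter> B)"
    unfolding num_below_def Pow_Int_eq by (intro add_right_mono sum_mono2) auto
  finally show ?thesis .
qed

text \<open>Passing to the closure keeps the rank and can only increase the count, so the condition
  on flats gives it for all sets.\<close>

lemma dragonD:
  assumes "dragon m" "0 < num_below m A"
  shows "num_below m A < r A"
proof -
  have "0 < num_below m (cl A)" using assms(2) num_below_mono[OF subset_cl, of m A] by simp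
  then have "num_below m (cl A) < r (cl A)" using assms(1) flat_cl[of A] unfolding dragon_def by blast
  then show ?thesis using num_below_mono[OF subset_cl, of m A] by (simp add: rk_cl)
qed

lemma dragon_antimono:
  assumes "dragon m" "\<And>A. flat \<B> A \<Longrightarrow> num_below m' A \<le> num_below m A"
  shows "dragon m'"
  unfolding dragon_def
proof (intro allI impI)
  fix A assume A: "flat \<B> A" "0 < num_below m' A"
  then have "num_below m A < r A" using assms(2)[OF A(1)] by (intro dragonD assms(1)) simp
  then show "num_below m' A < r A" using assms(2)[OF A(1)] by simp
qed

lemma single_mem_deg_kernel:
  assumes "flat \<B> A" "0 < num_below m A" "r A \<le> num_below m A"
  shows "Poly_Mapping.single m 1 \<in> deg_kernel"
proof (rule deg_kernelI)
  fix m'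
  have "\<not> dragon (m + m')"
    using assms dragonD[of "m + m'" A] by (auto simp: num_below_add)
  then show "deg (Poly_Mapping.single m 1 * Poly_Mapping.single m' 1) = 0"
    by (simp add: mult_single deg_single)
qed

lemma xvar_times_single: "xvar S * Poly_Mapping.single m 1 = Poly_Mapping.single (Poly_Mapping.single S 1 + m) 1"
  by (simp add: xvar_def mult_single)

lemma xvar_mem_deg_kernel:
  assumes "r S \<le> 1"
  shows "xvar S \<in> deg_kernel"
  unfolding xvar_def
  by (rule single_mem_deg_kernel[OF flat_cl[of S]]) (use subset_cl[of S] assms in \<open>auto simp: num_below_single rk_cl\<close>)

text \<open>The dragon condition is tested on flats, and a flat contains \<open>S\<close> iff it
  contains \<open>cl S\<close>.\<close>

lemma xvar_cl_cong:
  assumes "cl S = cl T"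
  shows "xvar S - xvar T \<in> deg_kernel"
proof (rule deg_kernelI)
  fix m
  have "S \<subseteq> A \<longleftrightarrow> T \<subseteq> A" if "flat \<B> A" for A
    using cl_subset_flat[OF that, of S] cl_subset_flat[OF that, of T] subset_cl[of S] subset_cl[of T] assms by auto
  then have "num_below (Poly_Mapping.single S 1 + m) A = num_below (Poly_Mapping.single T 1 + m) A" if "flat \<B> A" for A
    using that by (simp add: num_below_add num_below_single)
  then have "dragon (Poly_Mapping.single S 1 + m) \<longleftrightarrow> dragon (Poly_Mapping.single T 1 + m)"
    by (simp add: dragon_def)
  then show "deg ((xvar S - xvar T) * Poly_Mapping.single m 1) = 0"
    by (simp add: left_diff_distrib xvar_times_single deg_diff deg_single)
qed

text \<open>If \<open>h S\<close> and \<open>h T\<close> were both obstructed, by flats \<open>A \<supseteq> S\<close> and \<open>B \<supseteq> T\<close>, then by submodularity of the rank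
  \<open>A \<union> B\<close> or \<open>A \<inter> B\<close> would obstruct \<open>h (S \<union> T) ^ 2\<close>.\<close>

lemma xvar_Un_relation: "(xvar S - xvar (S \<union> T)) * (xvar T - xvar (S \<union> T)) \<in> deg_kernel"
proof (rule deg_kernelI)
  fix m
  define M where "M X Y = Poly_Mapping.single X (1::nat) + (Poly_Mapping.single Y 1 + m)" for X Y :: "'n set"
  let ?G = "S \<union> T"
  have nb: "num_below (M X Y) A = of_bool (X \<subseteq> A) + of_bool (Y \<subseteq> A) + num_below m A" for X Y A
    by (simp add: M_def num_below_add num_below_single)
  have eq: "deg ((xvar S - xvar ?G) * (xvar T - xvar ?G) * Poly_Mapping.single m 1) =
      of_bool (dragon (M S T)) - of_bool (dragon (M S ?G)) - of_bool (dragon (M ?G T)) + of_bool (dragon (M ?G ?G))"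
    by (simp add: left_diff_distrib right_diff_distrib mult.assoc xvar_times_single deg_diff deg_single M_def)
  \<comment> \<open>The alternating sum vanishes by inclusion-exclusion: the condition for
    \<open>M S T\<close> is the conjunction of those for \<open>M S ?G\<close> and
    \<open>M ?G T\<close>, and the one for \<open>M ?G ?G\<close> is their disjunction.\<close>
  have mono1: "dragon (M S T) \<Longrightarrow> dragon (M S ?G)" and mono2: "dragon (M S T) \<Longrightarrow> dragon (M ?G T)"
    and mono3: "dragon (M S ?G) \<Longrightarrow> dragon (M ?G ?G)" and mono4: "dragon (M ?G T) \<Longrightarrow> dragon (M ?G ?G)"
    by (erule dragon_antimono; simp add: nb)+
  have both: "dragon (M S T)" if 1: "dragon (M S ?G)" and 2: "dragon (M ?G T)"
    unfolding dragon_def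
  proof (intro allI impI)
    fix A assume A: "flat \<B> A" "0 < num_below (M S T) A"
    show "num_below (M S T) A < r A"
      using A(2) dragonD[OF 1, of A] dragonD[OF 2, of A]
      by (cases "S \<subseteq> A"; cases "T \<subseteq> A") (auto simp: nb)
  qed
  have one: "dragon (M S ?G) \<or> dragon (M ?G T)" if GG: "dragon (M ?G ?G)"
  proof (rule ccontr)
    assume "\<not> ?thesis"
    then obtain A B where A: "0 < num_below (M S ?G) A" "r A \<le> num_below (M S ?G) A"
      and B: "0 < num_below (M ?G T) B" "r B \<le> num_below (M ?G T) B"
      by (auto simp: dragon_def not_less)
    have "\<not> num_below (M S ?G) A \<le> num_below (M ?G ?G) A" using A dragonD[OF GG, of A] by linarith
    then have SA: "S \<subseteq> A" "\<not> T \<subseteq> A" by (cases "S \<subseteq> A"; cases "T \<subseteq> A"; simp add: nb)+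
    have "\<not> num_below (M ?G T) B \<le> num_below (M ?G ?G) B" using B dragonD[OF GG, of B] by linarith
    then have TB: "T \<subseteq> B" "\<not> S \<subseteq> B" by (cases "S \<subseteq> B"; cases "T \<subseteq> B"; simp add: nb)+
    have rA: "r A \<le> 1 + num_below m A" and rB: "r B \<le> 1 + num_below m B"
      using A B SA TB by (auto simp: nb)
    have "S \<union> T \<subseteq> A \<union> B" using SA TB by blast
    then have "2 + num_below m (A \<union> B) < r (A \<union> B)" using dragonD[OF GG, of "A \<union> B"] by (simp add: nb)
    moreover have "num_below m (A \<inter> B) \<le> r (A \<inter> B)"
      using dragonD[OF GG, of "A \<inter> B"] by (cases "num_below m (A \<inter> B) = 0") (auto simp: nb)
    ultimately show False
      using rk_submodular[of A B] num_below_supermodular[of m A B] rA rB by linarith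
  qed
  show "deg ((xvar S - xvar ?G) * (xvar T - xvar ?G) * Poly_Mapping.single m 1) = 0"
    unfolding eq using mono1 mono2 mono3 mono4 both one by (auto simp: of_bool_def)
qed

text \<open>\<open>h S = - (\<Sum>T \<supseteq> S. ray_class T)\<close>, so the classes of the rays are obtained from the \<open>h S\<close> by Moebius inversion.\<close>

definition ray_class :: "'n set \<Rightarrow> 'n cpoly" where
  "ray_class S = (\<Sum>T\<in>{T. S \<subseteq> T}. (- 1) ^ Suc (card (T - S)) * xvar T)"

lemma sum_ray_class: "(\<Sum>T\<in>{T. S \<subseteq> T}. ray_class T) = - xvar S"
proof -
  have inner: "(\<Sum>T\<in>{T. S \<subseteq> T \<and> T \<subseteq> U}. (- 1) ^ Suc (card (U - T)) * xvar U) = (if U = S then - xvar U else 0 :: 'n cpoly)"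
    if "S \<subseteq> U" for U
  proof -
    have "(\<Sum>T\<in>{T. S \<subseteq> T \<and> T \<subseteq> U}. (- 1) ^ card (U - T)) = (\<Sum>X\<in>Pow (U - S). (- 1) ^ card X :: 'n cpoly)"
      using that by (intro sum.reindex_bij_witness[of _ "\<lambda>X. U - X" "\<lambda>T. U - T"]) (auto simp: double_diff)
    also have "\<dots> = of_bool (U = S)" using that by (auto simp: sum_Pow_alternating)
    finally show ?thesis by (simp add: sum_negf flip: sum_distrib_right)
  qed
  have "(\<Sum>T\<in>{T. S \<subseteq> T}. ray_class T) =
      (\<Sum>T\<in>{T. S \<subseteq> T}. \<Sum>U\<in>{U. U \<in> {U. S \<subseteq> U} \<and> T \<subseteq> U}. (- 1) ^ Suc (card (U - T)) * xvar U)"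
    unfolding ray_class_def by (intro sum.cong) auto
  also have "\<dots> = (\<Sum>U\<in>{U. S \<subseteq> U}. \<Sum>T\<in>{T. T \<in> {T. S \<subseteq> T} \<and> T \<subseteq> U}. (- 1) ^ Suc (card (U - T)) * xvar U)"
    by (rule sum.swap_restrict) auto
  also have "\<dots> = (\<Sum>U\<in>{U. S \<subseteq> U}. if U = S then - xvar U else 0)"
    by (intro sum.cong refl) (use inner in simp)
  finally show ?thesis by simp
qed

section \<open>The Chow relations for ray classes\<close>

lemma sum_ray_class_diff:
  assumes "S \<subseteq> G"
  shows "(\<Sum>T\<in>{T. S \<subseteq> T \<and> \<not> G \<subseteq> T}. ray_class T) = xvar G - xvar S"
proof -
  have "{T. S \<subseteq> T} = {T. S \<subseteq> T \<and> \<not> G \<subseteq> T} \<union> {T. G \<subseteq> T}" using assms by blast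
  then have "sum ray_class {T. S \<subseteq> T} = sum ray_class {T. S \<subseteq> T \<and> \<not> G \<subseteq> T} + sum ray_class {T. G \<subseteq> T}"
    by (simp add: sum.union_disjoint disjoint_iff)
  then show ?thesis by (simp add: sum_ray_class algebra_simps)
qed

text \<open>For \<open>e \<in> cl S - S\<close> the terms of \<open>T\<close> and
  \<open>insert e T\<close> have opposite signs and congruent variables, so they cancel in
  pairs.\<close>

lemma ray_class_nonflat:
  assumes "\<not> flat \<B> S"
  shows "ray_class S \<in> deg_kernel"
proof -
  obtain e where e: "e \<in> cl S" "e \<notin> S" using assms flat_iff_cl by blast
  define A where "A = {T. S \<subseteq> T \<and> e \<notin> T}"
  have un: "{T. S \<subseteq> T} = A \<union> insert e ` A"
  proof -
    have "T \<in> insert e ` A" if "S \<subseteq> T" "e \<in> T" for T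
      using that e by (intro image_eqI[of _ _ "T - {e}"]) (auto simp: A_def)
    then show ?thesis by (auto simp: A_def)
  qed
  have "ray_class S = (\<Sum>T\<in>A. (- 1) ^ Suc (card (T - S)) * xvar T) + (\<Sum>T\<in>insert e ` A. (- 1) ^ Suc (card (T - S)) * xvar T)"
    unfolding ray_class_def un by (rule sum.union_disjoint) (auto simp: A_def)
  also have "(\<Sum>T\<in>insert e ` A. (- 1) ^ Suc (card (T - S)) * xvar T) = (\<Sum>T\<in>A. (- 1) ^ Suc (card (insert e T - S)) * (xvar (insert e T) :: 'n cpoly))"
    by (subst sum.reindex) (auto simp: inj_on_def A_def)
  also have "\<dots> = (\<Sum>T\<in>A. - ((- 1) ^ Suc (card (T - S)) * xvar (insert e T)))"
  proof (intro sum.cong refl)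
    fix T assume "T \<in> A"
    then have "card (insert e T - S) = Suc (card (T - S))" using e by (simp add: A_def insert_Diff_if)
    then show "(- 1) ^ Suc (card (insert e T - S)) * xvar (insert e T) = - ((- 1) ^ Suc (card (T - S)) * (xvar (insert e T) :: 'n cpoly))"
      by simp
  qed
  finally have "ray_class S = (\<Sum>T\<in>A. (- 1) ^ Suc (card (T - S)) * (xvar T - xvar (insert e T)))"
    by (simp add: sum_negf sum_subtractf right_diff_distrib)
  also have "\<dots> \<in> deg_kernel"
  proof (intro deg_kernel.sum_mem deg_kernel.mult_mem' xvar_cl_cong)
    fix T assume "T \<in> A"
    then show "cl T = cl (insert e T)" using cl_insert cl_mono[of S T] e by (auto simp: A_def)
  qed
  finally show ?thesis .
qed

text \<open>Expanded in ray classes, the quadratic relation is a sum over pairs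
  \<open>T \<supseteq> S\<close>, \<open>T' \<supseteq> S'\<close>, neither containing
  \<open>S \<union> S'\<close>. All these pairs are incomparable, and all but \<open>(S, S')\<close>
  have smaller complements, so induction removes them.\<close>

lemma ray_class_incomparable:
  assumes "\<not> S \<subseteq> S'" "\<not> S' \<subseteq> S"
  shows "ray_class S * ray_class S' \<in> deg_kernel"
  using assms
proof (induction "card (- S) + card (- S')" arbitrary: S S' rule: less_induct)
  case less
  define A where "A = {T. S \<subseteq> T \<and> \<not> S \<union> S' \<subseteq> T}"
  define A' where "A' = {T. S' \<subseteq> T \<and> \<not> S \<union> S' \<subseteq> T}"
  have mem: "(S, S') \<in> A \<times> A'" using less.prems by (auto simp: A_def A'_def)
  have "(xvar (S \<union> S') - xvar S) * (xvar (S \<union> S') - xvar S') \<in> deg_kernel"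
    using xvar_Un_relation[of S S'] by (simp add: algebra_simps)
  then have "sum ray_class A * sum ray_class A' \<in> deg_kernel"
    by (simp only: A_def A'_def sum_ray_class_diff[OF Un_upper1] sum_ray_class_diff[OF Un_upper2])
  then have "(\<Sum>(T, T')\<in>A \<times> A'. ray_class T * ray_class T') \<in> deg_kernel"
    by (simp add: sum_product sum.cartesian_product)
  then have all: "ray_class S * ray_class S' + (\<Sum>(T, T')\<in>A \<times> A' - {(S, S')}. ray_class T * ray_class T') \<in> deg_kernel"
    by (subst (asm) sum.remove[OF _ mem]) auto
  have "(\<Sum>(T, T')\<in>A \<times> A' - {(S, S')}. ray_class T * ray_class T') \<in> deg_kernel"
  proof (rule deg_kernel.sum_mem)
    fix z assume z: "z \<in> A \<times> A' - {(S, S')}"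
    obtain T T' where T: "z = (T, T')" by (cases z)
    have TT: "S \<subseteq> T" "S' \<subseteq> T'" "\<not> T \<subseteq> T'" "\<not> T' \<subseteq> T" "T \<noteq> S \<or> T' \<noteq> S'"
      using z T by (auto simp: A_def A'_def)
    have "card (- T) \<le> card (- S)" "card (- T') \<le> card (- S')" using TT by (auto intro!: card_mono)
    moreover have "card (- T) < card (- S) \<or> card (- T') < card (- S')"
      using TT by (metis Compl_subset_Compl_iff finite psubset_card_mono psubsetI compl_eq_compl_iff)
    ultimately have "card (- T) + card (- T') < card (- S) + card (- S')" by linarith
    from less.hyps[OF this TT(3,4)] show "(case z of (T, T') \<Rightarrow> ray_class T * ray_class T') \<in> deg_kernel"
      by (simp add: T)
  qed
  from deg_kernel.diff_mem[OF all this] show ?case by simp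
qed

end

section \<open>Positivity\<close>

lemma prod_list_xvar:
  "prod_list (map xvar Ss) = Poly_Mapping.single (sum_list (map (\<lambda>S. Poly_Mapping.single S 1) Ss)) 1"
  by (induction Ss) (simp_all add: xvar_def mult_single)

context loopless_matroid
begin

lemma num_below_sum_list:
  "num_below (sum_list (map (\<lambda>S. Poly_Mapping.single S 1) Ss)) A = length (filter (\<lambda>S. S \<subseteq> A) Ss)"
proof (induction Ss)
  case Nil
  show ?case by (simp add: num_below_def)
qed (simp add: num_below_add num_below_single)

text \<open>Moebius inversion also yields nonzero polynomials at \<open>{}\<close> and
  \<open>UNIV\<close>, which correspond to no ray of the fan.\<close>

definition ray :: "'n set \<Rightarrow> 'n cpoly" where
  "ray S = (if S \<in> proper_subsets then ray_class S else 0)"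

text \<open>Gives the linear relations: the term of \<open>UNIV\<close> does not depend on
  \<open>i\<close>, and \<open>xvar {i}\<close> lies in the kernel because
  \<open>r {i} = 1\<close>.\<close>

lemma sum_ray_containing: "(\<Sum>S\<in>{S. i \<in> S}. ray S) = - xvar {i} - ray_class UNIV"
proof -
  have eq: "{S. {i} \<subseteq> S} = insert UNIV {S. i \<in> S \<and> S \<noteq> UNIV}" by auto
  have "(\<Sum>S\<in>{S. i \<in> S}. ray S) = (\<Sum>S\<in>{S. i \<in> S \<and> S \<noteq> UNIV}. ray_class S)"
    by (rule sum.mono_neutral_cong_right) (auto simp: ray_def proper_subsets_def)
  moreover have "ray_class UNIV + (\<Sum>S\<in>{S. i \<in> S \<and> S \<noteq> UNIV}. ray_class S) = - xvar {i}"
    using sum_ray_class[of "{i}"] unfolding eq by simp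
  ultimately show ?thesis by (simp add: algebra_simps)
qed

sublocale ray: chow_elements \<B> deg_kernel ray
proof
  show "ray S \<in> deg_kernel" if "S \<notin> proper_flats \<B>" for S
    using that ray_class_nonflat[of S] deg_kernel.zero_mem by (auto simp: ray_def proper_flats_def)
  show "ray S * ray T \<in> deg_kernel" if "\<not> S \<subseteq> T" "\<not> T \<subseteq> S" for S T
    using ray_class_incomparable[OF that] deg_kernel.zero_mem by (simp add: ray_def)
  show "(\<Sum>S\<in>{S. i \<in> S}. ray S) - (\<Sum>S\<in>{S. j \<in> S}. ray S) \<in> deg_kernel" for i j
    using deg_kernel.diff_mem[OF xvar_mem_deg_kernel[of "{j}"] xvar_mem_deg_kernel[of "{i}"]]
    by (simp add: sum_ray_containing rk_singleton)
qed

text \<open>Minus the minimum of \<open>e_vec T\<close> over the simplex on the unit vectors indexed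
  by \<open>S\<close>, translated by the negative of the \<open>i\<close>-th one into the hyperplane
  of coordinate sum zero.\<close>

definition simplex_fn :: "'n \<Rightarrow> 'n set \<Rightarrow> 'n set \<Rightarrow> int" where
  "simplex_fn i S T = of_bool (i \<in> T) - of_bool (S \<subseteq> T)"

lemma dv_simplex_fn:
  assumes "i \<in> S"
  shows "ray.dv (simplex_fn i S) - xvar S \<in> deg_kernel"
proof -
  have "ray.dv (simplex_fn i S) = (\<Sum>T\<in>{T. {i} \<subseteq> T \<and> \<not> S \<subseteq> T}. ray_class T)"
    unfolding ray.dv_def
    by (rule sum.mono_neutral_cong_right) (use assms in \<open>auto simp: simplex_fn_def ray_def proper_subsets_def\<close>)
  also have "\<dots> = xvar S - xvar {i}" using assms by (intro sum_ray_class_diff) simp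
  finally show ?thesis
    using deg_kernel.uminus_mem[OF xvar_mem_deg_kernel[of "{i}"]] by (simp add: rk_singleton)
qed

text \<open>For a complete flag \<open>F\<^sub>1 \<subset> F\<^sub>2 \<subset> \<dots>\<close>, the product of the rays is congruent to the product of the differences
  \<open>h F\<^sub>k\<^sub>+\<^sub>1 - h F\<^sub>k\<close>, which in turn is congruent to the single monomial \<open>h F\<^sub>2 \<cdot> h F\<^sub>3 \<cdots>\<close>.\<close>

lemma deg_complete_flag_nonneg:
  assumes C: "\<C> \<subseteq> proper_flats \<B>" and chain: "\<And>F G. F \<in> \<C> \<Longrightarrow> G \<in> \<C> \<Longrightarrow> F \<subseteq> G \<or> G \<subseteq> F"
    and card: "card \<C> = r UNIV - 1"
  shows "0 \<le> deg (\<Prod>F\<in>\<C>. ray_class F)"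
proof -
  define R where "R = r UNIV"
  have R: "1 \<le> R" using rk_pos[of UNIV] by (simp add: R_def)
  have flatC: "flat \<B> F" "F \<noteq> {}" "F \<noteq> UNIV" if "F \<in> \<C>" for F
    using C that by (auto simp: proper_flats_def proper_subsets_def)
  have lessC: "F \<subset> G" if "F \<in> \<C>" "G \<in> \<C>" "r F < r G" for F G
    using chain[OF that(1,2)] rk_mono[of G F] that(3) by auto
  have inj: "inj_on r \<C>"
  proof (rule inj_onI)
    fix F G assume FG: "F \<in> \<C>" "G \<in> \<C>" "r F = r G"
    then show "F = G"
      using chain[OF FG(1,2)] flat_rk_less[OF flatC(1)[OF FG(1)], of G] flat_rk_less[OF flatC(1)[OF FG(2)], of F]
      by (metis less_irrefl psubsetI)
  qed
  have img: "r ` \<C> = {1..<R}"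
  proof (rule card_subset_eq)
    show "r ` \<C> \<subseteq> {1..<R}"
    proof
      fix k assume "k \<in> r ` \<C>"
      then obtain F where F: "F \<in> \<C>" "k = r F" by blast
      then have "F \<subset> UNIV" using flatC by blast
      then show "k \<in> {1..<R}"
        using flat_rk_less[OF flatC(1)[OF F(1)], of UNIV] rk_pos[OF flatC(2)[OF F(1)]] F(2) by (simp add: R_def)
    qed
    show "card (r ` \<C>) = card {1..<R}" using card_image[OF inj] card by (simp add: R_def)
  qed simp
  \<comment> \<open>By cardinality each rank from \<open>1\<close> to \<open>R - 1\<close> occurs
    exactly once in the flag; \<open>G k\<close> is the member of rank \<open>k\<close>, completed
    by \<open>G R = UNIV\<close>.\<close>
  define G where "G k = (if k = R then UNIV else the_inv_into \<C> r k)" for k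
  have GC: "G k \<in> \<C>" "r (G k) = k" if "1 \<le> k" "k < R" for k
  proof -
    have "k \<in> r ` \<C>" using img that by simp
    then show "G k \<in> \<C>" "r (G k) = k"
      using that the_inv_into_into[OF inj, of k \<C>] f_the_inv_into_f[OF inj, of k] by (simp_all add: G_def)
  qed
  have rG: "r (G k) = k" and flatG: "flat \<B> (G k)" if "1 \<le> k" "k \<le> R" for k
    using that GC[of k] flatC(1) flat_UNIV by (cases "k = R"; auto simp: G_def R_def)+
  have Gsub: "G k \<subseteq> G l" if "1 \<le> k" "k \<le> l" "l \<le> R" for k l
  proof (cases "k = l \<or> l = R")
    case False
    then show ?thesis using that lessC[of "G k" "G l"] GC[of k] GC[of l] by auto
  qed (auto simp: G_def)
  have prodC: "(\<Prod>F\<in>\<C>. ray_class F) = (\<Prod>k\<in>{1..<R}. ray_class (G k))"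
  proof (rule prod.reindex_bij_betw[symmetric])
    show "bij_betw G {1..<R} \<C>"
      unfolding bij_betw_def
    proof
      show "inj_on G {1..<R}" using GC(2) by (intro inj_onI) (metis atLeastLessThan_iff)
      show "G ` {1..<R} = \<C>"
      proof
        show "G ` {1..<R} \<subseteq> \<C>" using GC by auto
        show "\<C> \<subseteq> G ` {1..<R}"
        proof
          fix F assume F: "F \<in> \<C>"
          then have "r F \<in> {1..<R}" using img by blast
          moreover have "G (r F) = F"
            using calculation the_inv_into_f_f[OF inj F] by (simp add: G_def)
          ultimately show "F \<in> G ` {1..<R}" by (metis imageI)
        qed
      qed
    qed
  qed
  define Y where "Y j = (\<Prod>k\<in>{j..<R}. ray_class (G k))" for j
  define Z where "Z j = (\<Prod>k\<in>{j..<R}. xvar (G (Suc k)) - xvar (G k))" for j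
  have YZ: "Y j - Z j \<in> deg_kernel" if "1 \<le> j" "j \<le> R" for j
    using that(2,1)
  proof (induction rule: inc_induct)
    case base
    show ?case by (simp add: Y_def Z_def deg_kernel.zero_mem)
  next
    case (step j)
    have Yj: "Y j = ray_class (G j) * Y (Suc j)" and Zj: "Z j = (xvar (G (Suc j)) - xvar (G j)) * Z (Suc j)"
      using step by (simp_all add: Y_def Z_def prod.atLeast_Suc_lessThan)
    define A where "A = {T. G j \<subseteq> T \<and> \<not> G (Suc j) \<subseteq> T}"
    have GjA: "G j \<in> A"
      using rk_mono[of "G (Suc j)" "G j"] rG[of j] rG[of "Suc j"] step by (auto simp: A_def)
    have "xvar (G (Suc j)) - xvar (G j) = sum ray_class A"
      unfolding A_def using Gsub[of j "Suc j"] step by (intro sum_ray_class_diff[symmetric]) auto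
    then have "(xvar (G (Suc j)) - xvar (G j)) * Y (Suc j) - Y j = sum ray_class (A - {G j}) * Y (Suc j)"
      by (simp add: Yj sum.remove[OF _ GjA] algebra_simps)
    also have "\<dots> = (\<Sum>T\<in>A - {G j}. ray_class T * Y (Suc j))" by (rule sum_distrib_right)
    also have "\<dots> \<in> deg_kernel"
    proof (rule deg_kernel.sum_mem)
      fix T assume T: "T \<in> A - {G j}"
      show "ray_class T * Y (Suc j) \<in> deg_kernel"
      proof (cases "flat \<B> T")
        case True
        have "G j \<subset> T" using T by (auto simp: A_def)
        then have rT: "j < r T" using flat_rk_less[OF flatG[of j]] rG[of j] step by simp
        have nsub: "\<not> T \<subset> G (Suc j)"
          using flat_rk_less[OF True, of "G (Suc j)"] rG[of "Suc j"] rT step by auto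
        have "\<not> T \<subseteq> G (Suc j)" "\<not> G (Suc j) \<subseteq> T" using nsub T by (auto simp: A_def)
        then have inc: "ray_class T * ray_class (G (Suc j)) \<in> deg_kernel" by (rule ray_class_incomparable)
        have "Suc j \<noteq> R" using \<open>\<not> T \<subseteq> G (Suc j)\<close> by (auto simp: G_def)
        then have "Y (Suc j) = ray_class (G (Suc j)) * Y (Suc (Suc j))"
          using step by (simp add: Y_def prod.atLeast_Suc_lessThan)
        then show ?thesis using deg_kernel.mult_mem[OF inc] by (simp add: mult.assoc)
      qed (intro deg_kernel.mult_mem ray_class_nonflat)
    qed
    finally have "Y j - (xvar (G (Suc j)) - xvar (G j)) * Y (Suc j) \<in> deg_kernel"
      using deg_kernel.uminus_mem by fastforce
    moreover have "(xvar (G (Suc j)) - xvar (G j)) * Y (Suc j) - Z j \<in> deg_kernel"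
      unfolding Zj using step by (intro deg_kernel.cong_mult) (auto simp: deg_kernel.zero_mem)
    ultimately show ?case by (rule deg_kernel.cong_trans)
  qed
  define V where "V j = prod_list (map xvar (map G [2..<Suc j]))" for j
  have WV: "(\<Prod>k\<in>{1..<j}. xvar (G (Suc k)) - xvar (G k)) - V j \<in> deg_kernel" if "1 \<le> j" "j \<le> R" for j
    using that
  proof (induction rule: dec_induct)
    case base
    show ?case by (simp add: V_def deg_kernel.zero_mem)
  next
    case (step j)
    have VS: "V (Suc j) = V j * xvar (G (Suc j))" using step by (simp add: V_def)
    \<comment> \<open>The unwanted half of the next difference gives \<open>j\<close> factors, all
      indexed by subsets of the flat \<open>G j\<close> of rank \<open>j\<close>: one too many for
      the dragon condition.\<close>
    have "xvar (G j) * V j = prod_list (map xvar (G j # map G [2..<Suc j]))" by (simp add: V_def)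
    also have "\<dots> \<in> deg_kernel"
      unfolding prod_list_xvar
    proof (rule single_mem_deg_kernel[OF flatG[of j]])
      have "G k \<subseteq> G j" if "k \<in> set [2..<Suc j]" for k
        using that step by (intro Gsub) auto
      then have "filter (\<lambda>S. S \<subseteq> G j) (G j # map G [2..<Suc j]) = G j # map G [2..<Suc j]"
        by (intro filter_True) auto
      then have "num_below (sum_list (map (\<lambda>S. Poly_Mapping.single S 1) (G j # map G [2..<Suc j]))) (G j) = j"
        unfolding num_below_sum_list using step(1) by (auto simp del: upt_Suc)
      then show "0 < num_below (sum_list (map (\<lambda>S. Poly_Mapping.single S 1) (G j # map G [2..<Suc j]))) (G j)"
        "r (G j) \<le> num_below (sum_list (map (\<lambda>S. Poly_Mapping.single S 1) (G j # map G [2..<Suc j]))) (G j)"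
        using rG[of j] step by simp_all
    qed (use step in auto)
    finally have "V j * (xvar (G (Suc j)) - xvar (G j)) - V (Suc j) \<in> deg_kernel"
      using deg_kernel.uminus_mem by (fastforce simp: VS algebra_simps)
    moreover have "(\<Prod>k\<in>{1..<Suc j}. xvar (G (Suc k)) - xvar (G k)) - V j * (xvar (G (Suc j)) - xvar (G j)) \<in> deg_kernel"
      using step by (simp add: prod.atLeastLessThan_Suc) (intro deg_kernel.cong_mult; simp add: deg_kernel.zero_mem)
    ultimately show ?case by (rule deg_kernel.cong_trans[rotated])
  qed
  have "deg (\<Prod>F\<in>\<C>. ray_class F) = deg (Y 1)" by (simp add: prodC Y_def)
  also have "\<dots> = deg (Z 1)" using YZ[of 1] R by (intro deg_cong) simp
  also have "\<dots> = deg (V R)" using WV[of R] R by (intro deg_cong) (simp add: Z_def)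
  also have "0 \<le> \<dots>" unfolding V_def prod_list_xvar deg_single by simp
  finally show ?thesis .
qed

section \<open>Products of submodular classes\<close>

definition normalized_submodular :: "('n set \<Rightarrow> int) \<Rightarrow> bool" where
  "normalized_submodular f \<longleftrightarrow> f {} = 0 \<and> f UNIV = 0 \<and> (\<forall>S T. f (S \<union> T) + f (S \<inter> T) \<le> f S + f T)"

text \<open>Modulo linear relations a submodular function may be assumed to vanish on a given chain and to be
  nonnegative elsewhere, so each divisor class extends the chain with nonnegative coefficients.\<close>

lemma deg_nonneg:
  assumes "\<C> \<subseteq> proper_subsets" "\<And>F G. F \<in> \<C> \<Longrightarrow> G \<in> \<C> \<Longrightarrow> F \<subseteq> G \<or> G \<subseteq> F"
    "\<And>f. f \<in> set fs \<Longrightarrow> normalized_submodular f" "card \<C> + length fs = r UNIV - 1"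
  shows "0 \<le> deg ((\<Prod>F\<in>\<C>. ray F) * prod_list (map ray.dv fs))"
  using assms
proof (induction fs arbitrary: \<C>)
  case Nil
  show ?case
  proof (cases "\<C> \<subseteq> proper_flats \<B>")
    case True
    have "(\<Prod>F\<in>\<C>. ray F) = (\<Prod>F\<in>\<C>. ray_class F)"
      using Nil.prems(1) by (intro prod.cong) (auto simp: ray_def)
    then show ?thesis using deg_complete_flag_nonneg[OF True Nil.prems(2)] Nil.prems(4) by simp
  next
    case False
    then obtain F where F: "F \<in> \<C>" "F \<notin> proper_flats \<B>" by blast
    then have "(\<Prod>F\<in>\<C>. ray F) \<in> deg_kernel"
      using ray.x_outside by (subst prod.remove[OF _ F(1)]) (auto intro: deg_kernel.mult_mem)
    then show ?thesis using deg_kernelD by simp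
  qed
next
  case (Cons f fs)
  let ?p = "\<Prod>F\<in>\<C>. ray F" and ?q = "prod_list (map ray.dv fs)"
  have f: "f {} = 0" "f UNIV = 0" "\<And>S T. f (S \<union> T) + f (S \<inter> T) \<le> f S + f T"
    using Cons.prems(3)[of f] by (auto simp: normalized_submodular_def)
  obtain u where u: "\<And>S. sum u S \<le> f S" "\<And>F. F \<in> \<C> \<Longrightarrow> sum u F = f F" "sum u UNIV = f UNIV"
  proof -
    have "\<exists>u. (\<forall>S\<subseteq>UNIV. sum u S \<le> f S) \<and> (\<forall>F\<in>\<C>. sum u F = f F) \<and> sum u UNIV = f UNIV"
    proof (rule submodular_chain_minorant[OF f(3,1)])
      show "F \<subseteq> G \<or> G \<subseteq> F" if "F \<in> \<C>" "G \<in> \<C>" for F G using Cons.prems(2)[OF that] .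
    qed simp_all
    then show thesis using that by blast
  qed
  define g where "g S = f S - sum u S" for S
  have "ray.dv f - ray.dv g \<in> deg_kernel"
    using ray.dv_modular_mem[of u] u(3) f(2) ray.dv_diff[of f "\<lambda>S. sum u S"] by (simp add: g_def[abs_def])
  then have "?p * (ray.dv f * ?q) - ?p * (ray.dv g * ?q) \<in> deg_kernel"
    by (intro deg_kernel.cong_mult) (auto simp: deg_kernel.zero_mem)
  then have "deg (?p * (ray.dv f * ?q)) = deg (?p * (ray.dv g * ?q))" by (rule deg_cong)
  also have "?p * (ray.dv g * ?q) = (\<Sum>S\<in>UNIV. of_int (g S) * (?p * ray S * ?q))"
    by (simp add: ray.dv_def sum_distrib_left sum_distrib_right mult_ac)
  also have "deg \<dots> = (\<Sum>S\<in>UNIV. g S * deg (?p * ray S * ?q))"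
    by (simp add: deg_sum deg_scale)
  also have "0 \<le> \<dots>"
  proof (rule sum_nonneg)
    fix S
    have g: "0 \<le> g S" using u(1) by (simp add: g_def)
    consider "S \<notin> proper_subsets" | "S \<in> \<C>" | F where "F \<in> \<C>" "\<not> F \<subseteq> S" "\<not> S \<subseteq> F"
      | "S \<in> proper_subsets" "S \<notin> \<C>" "\<And>F. F \<in> \<C> \<Longrightarrow> F \<subseteq> S \<or> S \<subseteq> F" by blast
    then show "0 \<le> g S * deg (?p * ray S * ?q)"
    proof cases
      case 1
      then show ?thesis by (simp add: ray_def deg_def lin_ext_zero)
    next
      case 2
      then show ?thesis using u(2) by (simp add: g_def)
    next
      case 3
      have "?p = ray F * (\<Prod>F\<in>\<C> - {F}. ray F)" using prod.remove[OF _ 3(1)] by simp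
      then have "?p * ray S * ?q = ray F * ray S * ((\<Prod>F\<in>\<C> - {F}. ray F) * ?q)" by (simp add: mult_ac)
      then have "?p * ray S * ?q \<in> deg_kernel"
        using deg_kernel.mult_mem[OF ray.x_incomparable[OF 3(2,3)]] by simp
      then show ?thesis using deg_kernelD by simp
    next
      case 4
      have "0 \<le> deg ((\<Prod>F\<in>insert S \<C>. ray F) * ?q)"
      proof (rule Cons.IH)
        show "F \<subseteq> G \<or> G \<subseteq> F" if "F \<in> insert S \<C>" "G \<in> insert S \<C>" for F G
          using that 4(3) Cons.prems(2) by blast
      qed (use 4 Cons.prems(1,3,4) in auto)
      then show ?thesis using g 4(2) by (simp add: mult_ac)
    qed
  qed
  finally show ?case by simp
qed

text \<open>One factor is exchanged at a time, \<open>hs\<close> holding those already replaced. A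
  difference \<open>f - g\<close> need not be submodular, but it is nonnegative on rays, and each
  ray is a one-element chain for \<open>deg_nonneg\<close>.\<close>

lemma deg_mono:
  assumes "list_all2 (\<lambda>f g. \<forall>S. g S \<le> f S) fs gs"
    "\<And>f. f \<in> set hs \<union> set fs \<union> set gs \<Longrightarrow> normalized_submodular f" "length hs + length fs = r UNIV - 1"
  shows "deg (prod_list (map ray.dv (hs @ gs))) \<le> deg (prod_list (map ray.dv (hs @ fs)))"
  using assms
proof (induction arbitrary: hs rule: list_all2_induct)
  case Nil
  show ?case by simp
next
  case (Cons f fs g gs)
  let ?q = "prod_list (map ray.dv (hs @ fs))"
  have "deg (prod_list (map ray.dv ((hs @ [g]) @ gs))) \<le> deg (prod_list (map ray.dv ((hs @ [g]) @ fs)))"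
    by (rule Cons.IH) (use Cons.prems in auto)
  moreover have "0 \<le> deg ((ray.dv f - ray.dv g) * ?q)"
  proof -
    have "(ray.dv f - ray.dv g) * ?q = (\<Sum>S\<in>UNIV. of_int (f S - g S) * (ray S * ?q))"
      by (subst ray.dv_diff[symmetric]) (simp only: ray.dv_def sum_distrib_right mult.assoc)
    then have "deg ((ray.dv f - ray.dv g) * ?q) = (\<Sum>S\<in>UNIV. (f S - g S) * deg (ray S * ?q))"
      by (simp only: deg_sum deg_scale)
    also have "0 \<le> \<dots>"
    proof (intro sum_nonneg mult_nonneg_nonneg)
      fix S
      show "0 \<le> f S - g S" using Cons.hyps(1) by simp
      show "0 \<le> deg (ray S * ?q)"
      proof (cases "S \<in> proper_subsets")
        case True
        have "0 \<le> deg ((\<Prod>F\<in>{S}. ray F) * ?q)"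
          by (rule deg_nonneg) (use True Cons.prems in auto)
        then show ?thesis by simp
      qed (simp add: ray_def deg_def lin_ext_zero)
    qed
    finally show ?thesis .
  qed
  moreover have "deg ((ray.dv f - ray.dv g) * ?q) = deg (ray.dv f * ?q) - deg (ray.dv g * ?q)"
    by (simp only: left_diff_distrib deg_diff)
  ultimately show ?case by (simp add: mult_ac)
qed

lemma normalized_submodular_simplex_fn:
  assumes "i \<in> S"
  shows "normalized_submodular (simplex_fn i S)"
  using assms unfolding normalized_submodular_def simplex_fn_def by (auto simp: of_bool_def)

lemma length_filter_concat_replicate:
  "distinct Ps \<Longrightarrow> length (filter Q (concat (map (\<lambda>S. replicate (a S) S) Ps))) = (\<Sum>S\<in>{S \<in> set Ps. Q S}. a S)"
proof (induction Ps)
  case (Cons P Ps)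
  have "{S \<in> set (P # Ps). Q S} = (if Q P then insert P {S \<in> set Ps. Q S} else {S \<in> set Ps. Q S})" by auto
  then show ?case using Cons by (simp add: filter_replicate)
qed simp

text \<open>If the power were in the kernel, a multiple of it would have degree zero, although it
  dominates a product of simplex classes that is a dragon monomial of degree one.\<close>

lemma dv_power_not_mem:
  assumes \<P>: "partition_on UNIV \<P>" and a: "\<And>J. J \<subseteq> \<P> \<Longrightarrow> J \<noteq> {} \<Longrightarrow> sum a J < r (\<Union>J)"
    and f: "normalized_submodular f" and p: "\<And>S. S \<in> \<P> \<Longrightarrow> p S \<in> S"
    and ge: "\<And>S T. S \<in> \<P> \<Longrightarrow> simplex_fn (p S) S T \<le> f T"
  shows "ray.dv f ^ sum a \<P> \<notin> deg_kernel"
proof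
  assume mem: "ray.dv f ^ sum a \<P> \<in> deg_kernel"
  obtain i0 :: 'n where True by simp
  have UN: "\<Union>\<P> = UNIV" and ne: "\<P> \<noteq> {}" using \<P> by (auto simp: partition_on_def)
  have lt: "sum a \<P> < r UNIV" using a[of \<P>] UN ne by simp
  \<comment> \<open>The number of full simplices that fill up the product to
    \<open>r UNIV - 1\<close> factors, the length required by \<open>deg_mono\<close>.\<close>
  define e where "e = r UNIV - 1 - sum a \<P>"
  obtain Ps where Ps: "set Ps = \<P>" "distinct Ps" using finite_distinct_list[of \<P>] by auto
  define As where "As = concat (map (\<lambda>S. replicate (a S) S) Ps)"
  have lenA: "length As = sum a \<P>" using length_filter_concat_replicate[OF Ps(2), of "\<lambda>_. True" a] by (simp add: As_def Ps)
  have setA: "set As \<subseteq> \<P>" using Ps by (auto simp: As_def)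
  \<comment> \<open>The default \<open>i0\<close> serves the padding factors, as \<open>UNIV\<close>
    need not be a block.\<close>
  define i where "i S = (if S \<in> \<P> then p S else i0)" for S
  define Ls where "Ls = As @ replicate e UNIV"
  have iL: "i S \<in> S" if "S \<in> set Ls" for S using that setA p by (auto simp: Ls_def i_def split: if_splits)
  define gs where "gs = map (\<lambda>S. simplex_fn (i S) S) Ls"
  define fs where "fs = replicate (length As) f @ replicate e (simplex_fn (i UNIV) UNIV)"
  have "deg (prod_list (map ray.dv ([] @ gs))) \<le> deg (prod_list (map ray.dv ([] @ fs)))"
  proof (rule deg_mono)
    have "As ! j \<in> \<P>" if "j < length As" for j using setA nth_mem[OF that] by blast
    then have "list_all2 (\<lambda>f g. \<forall>S. g S \<le> f S) (replicate (length As) f) (map (\<lambda>S. simplex_fn (i S) S) As)"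
      using ge by (simp add: list_all2_conv_all_nth i_def)
    then show "list_all2 (\<lambda>f g. \<forall>S. g S \<le> f S) fs gs"
      unfolding fs_def gs_def Ls_def map_append by (rule list_all2_appendI) (simp add: list_all2_conv_all_nth)
    show "normalized_submodular h" if "h \<in> set [] \<union> set fs \<union> set gs" for h
      using that f iL normalized_submodular_simplex_fn by (auto simp: fs_def gs_def Ls_def)
    show "length [] + length fs = r UNIV - 1" using lt by (simp add: fs_def lenA e_def)
  qed
  moreover have "prod_list (map ray.dv fs) \<in> deg_kernel"
    using deg_kernel.mult_mem[OF mem] by (simp add: fs_def lenA)
  ultimately have "deg (prod_list (map ray.dv gs)) \<le> 0" using deg_kernelD by simp
  moreover have "prod_list (map ray.dv gs) - prod_list (map xvar Ls) \<in> deg_kernel"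
    unfolding gs_def using iL
  proof (induction Ls)
    case (Cons S Ls)
    then show ?case using dv_simplex_fn[of "i S" S] by (simp add: deg_kernel.cong_mult)
  qed (simp add: deg_kernel.zero_mem)
  moreover have "deg (prod_list (map xvar Ls)) = 1"
  proof -
    \<comment> \<open>At \<open>UNIV\<close> there are \<open>r UNIV - 1\<close> factors in total; a
      smaller flat sees no padding, and the blocks inside it obey the bound on
      \<open>a\<close>.\<close>
    have "dragon (sum_list (map (\<lambda>S. Poly_Mapping.single S 1) Ls))"
      unfolding dragon_def num_below_sum_list
    proof (intro allI impI)
      fix A assume pos: "0 < length (filter (\<lambda>S. S \<subseteq> A) Ls)"
      show "length (filter (\<lambda>S. S \<subseteq> A) Ls) < r A"
      proof (cases "A = UNIV")
        case True
        then show ?thesis using lt by (simp add: Ls_def lenA e_def)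
      next
        case False
        define J where "J = {S \<in> \<P>. S \<subseteq> A}"
        have "length (filter (\<lambda>S. S \<subseteq> A) Ls) = sum a J"
          using length_filter_concat_replicate[OF Ps(2), of "\<lambda>S. S \<subseteq> A" a] False
          by (simp add: Ls_def As_def J_def Ps filter_replicate top.extremum_unique)
        moreover have "J \<noteq> {}" using pos calculation by auto
        moreover have "r (\<Union>J) \<le> r A" by (intro rk_mono) (auto simp: J_def)
        ultimately show ?thesis using a[of J] by (auto simp: J_def)
      qed
    qed
    then show ?thesis by (simp only: prod_list_xvar deg_single) simp
  qed
  ultimately show False using deg_cong by fastforce
qed

end

section \<open>The numerical dimension\<close>

lemma chow_class_eq_zero_iff:
  assumes "p \<in> carrier (poly_ring_on \<F>)"
  shows "chow_class \<F> p = \<zero>\<^bsub>chow_ring_on \<F>\<^esub> \<longleftrightarrow> p \<in> chow_ideal \<F>"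
proof -
  interpret h: ring_hom_cring "poly_ring_on \<F>" "chow_ring_on \<F>" "chow_class \<F>"
    by (rule chow_class_hom)
  have "0 \<in> carrier (poly_ring_on \<F>)" "chow_class \<F> 0 = \<zero>\<^bsub>chow_ring_on \<F>\<^esub>"
    using h.hom_zero by (simp_all add: poly_ring_on_def)
  then show ?thesis using chow_class_eq_iff[OF assms, of 0] by simp
qed

lemma chow_class_pow:
  assumes "p \<in> carrier (poly_ring_on \<F>)"
  shows "p ^ k \<in> carrier (poly_ring_on \<F>)"
    and "chow_class \<F> p [^]\<^bsub>chow_ring_on \<F>\<^esub> k = chow_class \<F> (p ^ k)"
proof -
  interpret h: ring_hom_cring "poly_ring_on \<F>" "chow_ring_on \<F>" "chow_class \<F>"
    by (rule chow_class_hom)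
  have eqs: "x \<otimes>\<^bsub>poly_ring_on \<F>\<^esub> y = x * y" "\<one>\<^bsub>poly_ring_on \<F>\<^esub> = 1" for x y :: "'a cpoly"
    by (simp_all add: poly_ring_on_def)
  show car: "p ^ k \<in> carrier (poly_ring_on \<F>)" for k
  proof (induction k)
    case 0
    show ?case using h.R.one_closed by (simp add: eqs)
  qed (simp add: poly_ring_on_mult assms)
  show "chow_class \<F> p [^]\<^bsub>chow_ring_on \<F>\<^esub> k = chow_class \<F> (p ^ k)"
  proof (induction k)
    case 0
    show ?case using h.hom_one by (simp add: eqs)
  next
    case (Suc k)
    then show ?case using h.hom_mult[OF car[of k] assms] by (simp add: eqs mult.commute)
  qed
qed

lemma kill_outside_power: "kill_outside \<G> (p ^ k) = kill_outside \<G> p ^ k"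
  by (induction k) (simp_all add: kill_outside_one kill_outside_mult)

lemma insertion_zero: "insertion q 0 = 0"
  by (simp add: insertion_def lin_ext_zero)

context loopless_matroid
begin

text \<open>The Chow ideal lives in the polynomial ring on the flats; its preimage is an ideal of the whole type.\<close>

definition chow_preimage :: "'n cpoly set" where
  "chow_preimage = {p. kill_outside (proper_flats \<B>) p \<in> chow_ideal (proper_flats \<B>)}"

sublocale chow: chow_elements \<B> chow_preimage xvar
proof -
  let ?\<F> = "proper_flats \<B>"
  interpret i: ideal "chow_ideal ?\<F>" "poly_ring_on ?\<F>" by (rule chow_ideal_ideal)
  have zero: "0 \<in> chow_ideal ?\<F>"
    using additive_subgroup.zero_closed[OF i.additive_subgroup_axioms] by (simp add: poly_ring_on_def)
  show "chow_elements \<B> chow_preimage xvar"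
  proof
    have "kill_outside ?\<F> 0 = 0" by (rule kill_outside_zero) simp
    then show "0 \<in> chow_preimage" using zero by (simp add: chow_preimage_def)
    show "p + q \<in> chow_preimage" if "p \<in> chow_preimage" "q \<in> chow_preimage" for p q
      using that additive_subgroup.a_closed[OF i.additive_subgroup_axioms]
      by (simp add: chow_preimage_def kill_outside_add poly_ring_on_def)
    show "p * q \<in> chow_preimage" if "p \<in> chow_preimage" for p q
      using that i.I_r_closed[OF _ kill_outside_carrier]
      by (simp add: chow_preimage_def kill_outside_mult poly_ring_on_def)
    show "xvar S \<in> chow_preimage" if "S \<notin> ?\<F>" for S
      using that zero by (simp add: chow_preimage_def kill_outside_xvar)
    show "xvar S * xvar T \<in> chow_preimage" if "\<not> S \<subseteq> T" "\<not> T \<subseteq> S" for S T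
    proof (cases "S \<in> ?\<F> \<and> T \<in> ?\<F>")
      case True
      then have "xvar S * xvar T \<in> chow_relations ?\<F>" using that unfolding chow_relations_def by blast
      then show ?thesis
        using chow_relations_in_ideal True by (auto simp: chow_preimage_def kill_outside_mult kill_outside_xvar)
    next
      case False
      then show ?thesis using zero by (auto simp: chow_preimage_def kill_outside_mult kill_outside_xvar)
    qed
    show "(\<Sum>S\<in>{S. i \<in> S}. xvar S) - (\<Sum>S\<in>{S. j \<in> S}. xvar S) \<in> chow_preimage" for i j
    proof -
      have s: "kill_outside ?\<F> (\<Sum>S\<in>{S. i \<in> S}. xvar S) = (\<Sum>F\<in>{F\<in>?\<F>. i \<in> F}. xvar F)" for i
        unfolding kill_outside_sum kill_outside_xvar by (intro sum.mono_neutral_cong_right) auto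
      have "kill_outside ?\<F> ((\<Sum>S\<in>{S. i \<in> S}. xvar S) - (\<Sum>S\<in>{S. j \<in> S}. xvar S)) \<in> chow_relations ?\<F>"
        unfolding kill_outside_diff s chow_relations_def by blast
      then show ?thesis using chow_relations_in_ideal by (auto simp: chow_preimage_def)
    qed
  qed
qed

text \<open>The rays satisfy the Chow relations modulo \<open>deg_kernel\<close>, so substituting
  them induces a ring map out of the Chow ring; a power that survives this map is nonzero in the
  Chow ring.\<close>

lemma chow_preimage_insertion:
  assumes "p \<in> chow_preimage"
  shows "insertion ray (kill_outside (proper_flats \<B>) p) \<in> deg_kernel"
proof -
  let ?\<F> = "proper_flats \<B>"
  interpret R: cring "poly_ring_on ?\<F>" by (rule poly_ring_on_cring)
  define J where "J = {p \<in> carrier (poly_ring_on ?\<F>). insertion ray p \<in> deg_kernel}"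
  have "ideal J (poly_ring_on ?\<F>)"
  proof (rule idealI[OF R.ring_axioms])
    show "subgroup J (add_monoid (poly_ring_on ?\<F>))"
    proof (rule R.add.subgroupI)
      show "J \<subseteq> carrier (poly_ring_on ?\<F>)" by (auto simp: J_def)
      have "0 \<in> J" using R.zero_closed deg_kernel.zero_mem
        by (simp add: J_def insertion_def lin_ext_zero poly_ring_on_def)
      then show "J \<noteq> {}" by blast
    next
      fix a assume a: "a \<in> J"
      have "\<ominus>\<^bsub>poly_ring_on ?\<F>\<^esub> a = - a"
        using poly_ring_on_diff(2)[OF R.zero_closed, of a] a R.minus_eq[of "\<zero>\<^bsub>poly_ring_on ?\<F>\<^esub>" a]
        by (simp add: J_def poly_ring_on_def)
      moreover have "- a \<in> J"
        using a insertion_diff[of ray 0 a] deg_kernel.uminus_mem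
        by (auto simp: J_def poly_ring_on_def insertion_def lin_ext_zero)
      ultimately show "\<ominus>\<^bsub>poly_ring_on ?\<F>\<^esub> a \<in> J" by simp
    next
      fix a b assume ab: "a \<in> J" "b \<in> J"
      then have "a \<oplus>\<^bsub>poly_ring_on ?\<F>\<^esub> b \<in> carrier (poly_ring_on ?\<F>)" by (auto simp: J_def)
      moreover have "insertion ray (a + b) \<in> deg_kernel"
        using ab by (auto simp: J_def insertion_add intro: deg_kernel.add_mem)
      ultimately show "a \<oplus>\<^bsub>poly_ring_on ?\<F>\<^esub> b \<in> J" by (simp add: J_def poly_ring_on_def)
    qed
    fix a y assume a: "a \<in> J" and y: "y \<in> carrier (poly_ring_on ?\<F>)"
    have "insertion ray (y * a) \<in> deg_kernel"
      using a by (auto simp: J_def insertion_mult intro: deg_kernel.mult_mem')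
    moreover have "y * a \<in> carrier (poly_ring_on ?\<F>)" using a y by (auto simp: J_def intro: poly_ring_on_mult)
    ultimately show "y \<otimes>\<^bsub>poly_ring_on ?\<F>\<^esub> a \<in> J" "a \<otimes>\<^bsub>poly_ring_on ?\<F>\<^esub> y \<in> J"
      by (simp_all add: J_def poly_ring_on_def mult.commute)
  qed
  moreover have "chow_relations ?\<F> \<subseteq> J"
  proof
    fix q assume q: "q \<in> chow_relations ?\<F>"
    have "insertion ray q \<in> deg_kernel"
      using q unfolding chow_relations_def
    proof (elim UnE CollectE exE conjE)
      fix F G assume "q = xvar F * xvar G" "\<not> F \<subseteq> G" "\<not> G \<subseteq> F"
      then show ?thesis by (simp add: insertion_mult insertion_xvar ray.x_incomparable)
    next
      fix i j assume q: "q = (\<Sum>F\<in>{F \<in> ?\<F>. i \<in> F}. xvar F) - (\<Sum>F\<in>{F \<in> ?\<F>. j \<in> F}. xvar F)"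
      have "(\<Sum>S\<in>{S. i \<in> S}. ray S) = (\<Sum>F\<in>{F \<in> ?\<F>. i \<in> F}. ray F) + (\<Sum>S\<in>{S. i \<in> S \<and> S \<notin> ?\<F>}. ray S)" for i
        by (subst sum.union_disjoint[symmetric]) (auto intro: sum.cong)
      moreover have "(\<Sum>S\<in>{S. i \<in> S \<and> S \<notin> ?\<F>}. ray S) \<in> deg_kernel" for i
        by (intro deg_kernel.sum_mem ray.x_outside) auto
      ultimately have c: "(\<Sum>S\<in>{S. i \<in> S}. ray S) - (\<Sum>F\<in>{F \<in> ?\<F>. i \<in> F}. ray F) \<in> deg_kernel" for i
        by simp
      have "((\<Sum>S\<in>{S. i \<in> S}. ray S) - (\<Sum>S\<in>{S. j \<in> S}. ray S)) +
          ((\<Sum>S\<in>{S. j \<in> S}. ray S) - (\<Sum>F\<in>{F \<in> ?\<F>. j \<in> F}. ray F)) -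
          ((\<Sum>S\<in>{S. i \<in> S}. ray S) - (\<Sum>F\<in>{F \<in> ?\<F>. i \<in> F}. ray F)) \<in> deg_kernel"
        by (intro deg_kernel.add_mem deg_kernel.diff_mem c ray.x_linear)
      then show ?thesis by (simp add: q insertion_diff insertion_sum insertion_xvar)
    qed
    then show "q \<in> J" using chow_relations_carrier q by (auto simp: J_def)
  qed
  ultimately have "chow_ideal ?\<F> \<subseteq> J" unfolding chow_ideal_def by (rule R.genideal_minimal)
  then show ?thesis using assms by (auto simp: chow_preimage_def J_def)
qed

lemma chow_dv_power_mem_imp:
  assumes "chow.dv f ^ k \<in> chow_preimage"
  shows "ray.dv f ^ k \<in> deg_kernel"
proof -
  let ?\<F> = "proper_flats \<B>"
  have "insertion ray (kill_outside ?\<F> (chow.dv f)) = (\<Sum>S\<in>UNIV. of_int (f S) * (if S \<in> ?\<F> then ray S else 0))"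
    unfolding chow.dv_def kill_outside_sum insertion_sum
    by (intro sum.cong refl) (simp add: kill_outside_mult kill_outside_id[OF poly_ring_on_of_int]
        kill_outside_xvar insertion_scale insertion_xvar insertion_zero)
  then have "ray.dv f - insertion ray (kill_outside ?\<F> (chow.dv f)) =
      (\<Sum>S\<in>UNIV. of_int (f S) * (if S \<in> ?\<F> then 0 else ray S))"
    unfolding ray.dv_def by (simp only: sum_subtractf[symmetric] right_diff_distrib[symmetric])
      (intro sum.cong, auto)
  also have "\<dots> \<in> deg_kernel"
    by (intro deg_kernel.sum_mem deg_kernel.mult_mem') (simp add: ray.x_outside deg_kernel.zero_mem)
  finally have "ray.dv f ^ k - insertion ray (kill_outside ?\<F> (chow.dv f)) ^ k \<in> deg_kernel"
    by (rule deg_kernel.cong_power)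
  moreover have "insertion ray (kill_outside ?\<F> (chow.dv f)) ^ k \<in> deg_kernel"
    using chow_preimage_insertion[OF assms] by (simp add: kill_outside_power insertion_power)
  ultimately show ?thesis by (rule deg_kernel.mem_cong)
qed

text \<open>Turns the statement about cosets into ideal membership; the support function vanishes at
  \<open>{}\<close> and \<open>UNIV\<close>, so the sum may run over all sets.\<close>

lemma c1_power_eq_zero_iff:
  fixes P :: "(real ^ 'n) set"
  assumes P: "generalized_permutohedron P" and t: "centering P t"
  shows "c1 \<B> P [^]\<^bsub>chow_ring \<B>\<^esub> k = \<zero>\<^bsub>chow_ring \<B>\<^esub> \<longleftrightarrow>
    chow.dv (\<lambda>S. - \<lfloor>min_on ((+) t ` P) S\<rfloor>) ^ k \<in> chow_preimage"
proof -
  let ?\<F> = "proper_flats \<B>" and ?f = "\<lambda>S. - \<lfloor>min_on ((+) t ` P) S\<rfloor>"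
  let ?p = "\<Sum>S\<in>proper_subsets. of_int (?f S) * xvar S"
  have car: "?p \<in> carrier (poly_ring_on proper_subsets)"
    by (intro poly_ring_on_sum poly_ring_on_mult poly_ring_on_of_int xvar_carrier)
  have p: "?p = chow.dv ?f"
    unfolding chow.dv_def using support_fn_empty[OF P t] support_fn_UNIV[OF P t]
    by (intro sum.mono_neutral_left) (auto simp: proper_subsets_def)
  have c1: "c1 \<B> P = chow_class ?\<F> (kill_outside ?\<F> (chow.dv ?f))"
    unfolding c1_def c1_perm_eq[OF P t] c1_centered_def chow_restrict_class[OF car] unfolding p ..
  show ?thesis
    unfolding chow_ring_def c1 chow_class_pow(2)[OF kill_outside_carrier]
      chow_class_eq_zero_iff[OF chow_class_pow(1)[OF kill_outside_carrier]]
    by (simp add: chow_preimage_def kill_outside_power)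
qed

text \<open>The equality \<open>f T + f (- T) = 0\<close> closes a circle of submodular
  inequalities: \<open>f A \<le> f (A \<inter> T) + f (A - T) \<le> f (A \<inter> T) + f (A \<union>
  T) + f (- T) \<le> f A + f T + f (- T)\<close>.\<close>

lemma submodular_split:
  fixes f :: "'n set \<Rightarrow> int"
  assumes f: "normalized_submodular f" and \<T>: "partition_on UNIV \<T>"
    and compl: "\<And>T. T \<in> \<T> \<Longrightarrow> f T + f (- T) = 0"
  shows "f S = (\<Sum>T\<in>\<T>. f (S \<inter> T))"
proof -
  have f0: "f {} = 0" "f UNIV = 0" and sub: "f (A \<union> B) + f (A \<inter> B) \<le> f A + f B" for A B
    using f by (auto simp: normalized_submodular_def)
  have split: "f A = f (A \<inter> T) + f (A - T)" if "T \<in> \<T>" for A T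
  proof -
    have "(A \<inter> T) \<union> (A - T) = A" "(A \<inter> T) \<inter> (A - T) = {}" by auto
    then have "f A \<le> f (A \<inter> T) + f (A - T)" using sub[of "A \<inter> T" "A - T"] f0 by simp
    moreover have "(A \<union> T) \<union> - T = UNIV" "(A \<union> T) \<inter> - T = A - T" by auto
    then have "f (A - T) \<le> f (A \<union> T) + f (- T)" using sub[of "A \<union> T" "- T"] f0 by simp
    ultimately show ?thesis using sub[of A T] compl[OF that] by linarith
  qed
  have "f (S \<inter> \<Union>\<A>) = (\<Sum>T\<in>\<A>. f (S \<inter> T))" if "\<A> \<subseteq> \<T>" for \<A>
    using finite[of \<A>] that
  proof (induction \<A>)
    case empty
    show ?case by (simp add: f0)
  next
    case (insert T \<A>)
    have "U \<inter> T = {}" if "U \<in> \<A>" for U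
      by (rule disjointD[OF partition_onD2[OF \<T>]]) (use that insert.prems insert.hyps in auto)
    then have "S \<inter> \<Union>(insert T \<A>) - T = S \<inter> \<Union>\<A>" "S \<inter> \<Union>(insert T \<A>) \<inter> T = S \<inter> T" by auto
    then show ?case using split[of T "S \<inter> \<Union>(insert T \<A>)"] insert by simp
  qed
  from this[of \<T>] show ?thesis using \<T> by (simp add: partition_on_def)
qed

end

theorem theorem4p2:
  fixes \<B> :: "'n::finite set set" and P :: "(real ^ 'n) set"
  assumes "is_matroid \<B>" and "loopless \<B>"
    and "generalized_permutohedron P"
  shows "\<exists>d. numerical_dimension (chow_ring \<B>) (c1 \<B> P) d \<and>
    int d = Min {\<Sum>T\<in>\<T>. (int (rk \<B> T) - 1) |\<T>. refines UNIV (induced_partition P) \<T>}"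
proof -
  interpret loopless_matroid \<B> using assms by unfold_locales
  note P = assms(3)
  obtain t where t: "centering P t" using centering_exists[OF P] by blast
  define f where "f = (\<lambda>S. - \<lfloor>min_on ((+) t ` P) S\<rfloor>)"
  have f: "normalized_submodular f"
    unfolding normalized_submodular_def f_def
    using support_fn_empty[OF P t] support_fn_UNIV[OF P t] support_fn_submodular[OF P t] by blast
  define \<P> where "\<P> = induced_partition P"
  have \<P>: "partition_on UNIV \<P>" unfolding \<P>_def by (rule induced_partition_on)
  have const_iff: "(\<forall>x\<in>P. \<forall>y\<in>P. x \<bullet> e_vec S = y \<bullet> e_vec S) \<longleftrightarrow> (\<forall>X\<in>\<P>. X \<subseteq> S \<or> X \<inter> S = {})" for S
    unfolding \<P>_def by (rule gp_e_vec_const_iff[OF P])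
  obtain a \<T>0 where a: "\<And>J. J \<subseteq> \<P> \<Longrightarrow> J \<noteq> {} \<Longrightarrow> sum a J < r (\<Union>J)"
    and \<T>0: "refines UNIV \<P> \<T>0" "sum a \<P> = (\<Sum>T\<in>\<T>0. r T - 1)"
    using dilworth_vector[OF \<P>] by blast
  define d where "d = sum a \<P>"
  have nonzero: "chow.dv f ^ d \<notin> chow_preimage"
  proof
    assume "chow.dv f ^ d \<in> chow_preimage"
    then have mem: "ray.dv f ^ d \<in> deg_kernel" by (rule chow_dv_power_mem_imp)
    obtain N u where u: "sum u UNIV = 0" "\<And>S. 0 \<le> int N * f S + sum u S"
      "\<And>S. \<exists>x\<in>P. \<exists>y\<in>P. x \<bullet> e_vec S \<noteq> y \<bullet> e_vec S \<Longrightarrow> 1 \<le> int N * f S + sum u S"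
      unfolding f_def by (rule support_fn_strict[OF P t]) (rule that[unfolded f_def])
    \<comment> \<open>\<open>g\<close> represents \<open>N\<close> times the class of
      \<open>f\<close>, because \<open>u\<close> is modular of total zero.\<close>
    define g where "g S = int N * f S + sum u S" for S
    define p where "p S = (SOME i. i \<in> S)" for S :: "'n set"
    have p: "p S \<in> S" if "S \<in> \<P>" for S
    proof -
      have "S \<noteq> {}" using \<P> that by (auto simp: partition_on_def)
      then show ?thesis unfolding p_def by (simp add: some_in_eq)
    qed
    have g: "normalized_submodular g"
      unfolding normalized_submodular_def
    proof (intro conjI allI)
      show "g {} = 0" "g UNIV = 0" using f u(1) by (simp_all add: g_def normalized_submodular_def)
      fix S T
      have "int N * (f (S \<union> T) + f (S \<inter> T)) \<le> int N * (f S + f T)"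
        using f by (intro mult_left_mono) (simp_all add: normalized_submodular_def)
      moreover have "sum u (S \<union> T) + sum u (S \<inter> T) = sum u S + sum u T" by (rule sum.union_inter) auto
      ultimately show "g (S \<union> T) + g (S \<inter> T) \<le> g S + g T" by (simp add: g_def algebra_simps)
    qed
    have ge: "simplex_fn (p S) S T \<le> g T" if S: "S \<in> \<P>" for S T
    \<comment> \<open>If \<open>T\<close> is a union of blocks, the simplex function of a block is
      zero at \<open>T\<close>; otherwise it is at most one, and \<open>g T\<close> is at least one
      since \<open>e_vec T\<close> is not constant on \<open>P\<close>.\<close>
    proof (cases "\<forall>X\<in>\<P>. X \<subseteq> T \<or> X \<inter> T = {}")
      case True
      then have "p S \<in> T \<longleftrightarrow> S \<subseteq> T" using p[OF S] S by blast
      then show ?thesis using u(2)[of T] by (simp add: simplex_fn_def g_def)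
    next
      case False
      then have "\<not> (\<forall>x\<in>P. \<forall>y\<in>P. x \<bullet> e_vec T = y \<bullet> e_vec T)" using const_iff[of T] by (simp only:) simp
      then have "1 \<le> g T" unfolding g_def by (intro u(3)) blast
      moreover have "simplex_fn (p S) S T \<le> 1" by (simp add: simplex_fn_def of_bool_def)
      ultimately show ?thesis by linarith
    qed
    have "ray.dv g ^ d \<notin> deg_kernel" unfolding d_def by (rule dv_power_not_mem[OF \<P> a g p ge])
    moreover have "ray.dv g - of_int (int N) * ray.dv f \<in> deg_kernel"
    proof -
      have "ray.dv g - of_int (int N) * ray.dv f = ray.dv (\<lambda>S. g S - int N * f S)"
        by (simp only: ray.dv_diff ray.dv_scale)
      also have "(\<lambda>S. g S - int N * f S) = sum u" by (simp add: g_def fun_eq_iff)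
      finally show ?thesis using ray.dv_modular_mem[OF u(1)] by simp
    qed
    moreover have "(of_int (int N) * ray.dv f) ^ d \<in> deg_kernel"
      unfolding power_mult_distrib by (rule deg_kernel.mult_mem'[OF mem])
    ultimately show False using deg_kernel.mem_cong[OF deg_kernel.cong_power] by blast
  qed
  have bound: "e \<le> (\<Sum>T\<in>\<T>. r T - 1)" if \<T>: "refines UNIV \<P> \<T>" and e: "chow.dv f ^ e \<notin> chow_preimage" for \<T> e
  proof -
    have part: "partition_on UNIV \<T>" using \<T> by (simp add: refines_def)
    have "f T + f (- T) = 0" if T: "T \<in> \<T>" for T
    proof -
      have "X \<subseteq> T \<or> X \<inter> T = {}" if X: "X \<in> \<P>" for X
      proof -
        obtain Y where Y: "Y \<in> \<T>" "X \<subseteq> Y" using \<T> X by (auto simp: refines_def)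
        then show ?thesis using disjointD[OF partition_onD2[OF part] Y(1) T] by blast
      qed
      then have "\<forall>x\<in>P. \<forall>y\<in>P. x \<bullet> e_vec T = y \<bullet> e_vec T" using const_iff[of T] by blast
      then show ?thesis unfolding f_def by (intro support_fn_compl[OF P t]) blast
    qed
    from chow.dv_power_mem[OF part _ _ submodular_split[OF f part this]] f
    have "chow.dv f ^ Suc (\<Sum>T\<in>\<T>. r T - 1) \<in> chow_preimage" by (simp add: normalized_submodular_def)
    then show ?thesis using chow.power_mono_mem[of "chow.dv f"] e by (meson not_less_eq_eq)
  qed
  \<comment> \<open>Parts are nonempty and so have positive rank; the subtraction in
    \<open>nat\<close> does not truncate.\<close>
  have conv: "(\<Sum>T\<in>\<T>. int (r T) - 1) = int (\<Sum>T\<in>\<T>. r T - 1)" if "refines UNIV \<P> \<T>" for \<T>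
  proof -
    have "1 \<le> r T" if "T \<in> \<T>" for T
      using rk_pos[of T] \<open>refines UNIV \<P> \<T>\<close> that by (cases "T = {}") (auto simp: refines_def partition_on_def)
    then show ?thesis unfolding of_nat_sum by (intro sum.cong refl) (simp add: of_nat_diff)
  qed
  have zero_iff: "c1 \<B> P [^]\<^bsub>chow_ring \<B>\<^esub> k = \<zero>\<^bsub>chow_ring \<B>\<^esub> \<longleftrightarrow> chow.dv f ^ k \<in> chow_preimage" for k
    unfolding f_def by (rule c1_power_eq_zero_iff[OF P t])
  have "numerical_dimension (chow_ring \<B>) (c1 \<B> P) d"
    unfolding numerical_dimension_def zero_iff using nonzero bound[OF \<T>0(1)] \<T>0(2) by (simp add: d_def)
  moreover have "int d = Min {\<Sum>T\<in>\<T>. (int (rk \<B> T) - 1) |\<T>. refines UNIV (induced_partition P) \<T>}"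
    unfolding \<P>_def[symmetric]
  proof (rule Min_eqI[symmetric])
    show "finite {\<Sum>T\<in>\<T>. (int (rk \<B> T) - 1) |\<T>. refines UNIV \<P> \<T>}"
      by (rule finite_subset[of _ "range (\<lambda>\<T>. \<Sum>T\<in>\<T>. (int (rk \<B> T) - 1))"]) auto
    show "int d \<in> {\<Sum>T\<in>\<T>. (int (rk \<B> T) - 1) |\<T>. refines UNIV \<P> \<T>}"
    proof -
      have "int d = (\<Sum>T\<in>\<T>0. int (r T) - 1)" unfolding conv[OF \<T>0(1)] d_def \<T>0(2) ..
      then show ?thesis using \<T>0(1) by blast
    qed
    show "int d \<le> y" if y: "y \<in> {\<Sum>T\<in>\<T>. (int (rk \<B> T) - 1) |\<T>. refines UNIV \<P> \<T>}" for y
    proof -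
      obtain \<T> where \<T>: "y = (\<Sum>T\<in>\<T>. int (r T) - 1)" "refines UNIV \<P> \<T>" using y by blast
      show ?thesis unfolding \<T>(1) conv[OF \<T>(2)] of_nat_le_iff by (rule bound[OF \<T>(2) nonzero])
    qed
  qed
  ultimately show ?thesis by blast
qed

end
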